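(* Fix integers $N,K\ge 1$ and real numbers $M>0$, $\alpha>0$. Let $X=(X_1,\dots,X_N)$ and $Y=(Y_1,\dots,Y_N)$ be elements of $(S_{M,K})^N$ with probabilistic Fréchet means $\mu_X$ and $\mu_Y$ respectively (both formed with the perturbation parameter $\alpha$). For each $i\in\{1,\dots,N\}$ let $\phi_i:X_i\to Y_i$ be any optimal matching, and let $\widetilde X_i$ be the diagram whose off-diagonal points are the off-diagonal points $x\in X_i$ such that $\phi_i(x)\neq\Delta$. Let $\overline M$ be the maximal $W_2$-distance between two diagrams in $S_{M,NK}$. Then $$\mathbb{W}_2(\mu_X,\mu_Y)\le C\left(\sum_{i=1}^N\sum_{x\in\widetilde X_i}\|x-\phi_i(x)\|+\overrightarrow{d_2}(X,Y)^2\right)^{1/2},$$ where $$C=\sqrt{2\left(\frac1{N^2}+\frac{\overline M^2}{\alpha^2}\right)+\frac{4\overline M^2}{\alpha}+1}.$$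
   Context: **Diagrams.** $\|\cdot\|$ is the Euclidean norm on $\mathbb{R}^2$. $\Delta=\{(t,t):t\in\mathbb{R}\}$ is the diagonal and $\|x-\Delta\|=\min_{z\in\Delta}\|x-z\|$. A persistence diagram is a countable multiset of off-diagonal points in $\{(b,d)\in\mathbb{R}^2: d>b\}$ together with countably infinitely many copies of every point of $\Delta$. A matching $\phi:X\to Y$ of diagrams is a bijection; we write $\phi(x)=\Delta$ when $\phi(x)$ lies on the diagonal (and similarly for $\phi^{-1}$). $W_2(X,Y)=\inf_{\phi}\big(\sum_{x\in X}\|x-\phi(x)\|^2\big)^{1/2}$ over all matchings; a matching is optimal if it attains the infimum. $S_{M,K}$ is the set of diagrams with at most $K$ off-diagonal points (counted with multiplicity), all of whose off-diagonal points $(x_1,x_2)$ satisfy $0\le x_1,x_2\le M$; it has the metric $W_2$. On $(S_{M,K})^N$ put $\overrightarrow{d_2}(X,Y)=\big(\sum_{i=1}^N W_2(X_i,Y_i)^2\big)^{1/2}$. Sums over points of a diagram $\widetilde X_i$ run over its off-diagonal points, with multiplicity. **Wasserstein distance on measures.** $\mathcal{P}(S_{M,NK})$ is the space of probability measures with finite second moment on $S_{M,NK}$, with metric $\mathbb{W}_2(\nu,\eta)=\big(\inf_\gamma\int W_2(U,V)^2\,d\gamma(U,V)\big)^{1/2}$, the infimum over couplings $\gamma$ of $\nu$ and $\eta$. **Selections and groupings.** Let $X=(X_1,\dots,X_N)$ be diagrams with finitely many off-diagonal points, which are labeled (so repeated points are distinguished). A selection is a choice, for each $i$, of either an off-diagonal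 point of $X_i$ or the symbol $\Delta$. The trivial selection for an off-diagonal $x\in X_i$ chooses $x$ for $X_i$ and $\Delta$ for all other diagrams. A grouping is a collection of selections such that every off-diagonal point of every diagram is in exactly one selection; groupings are identified up to reordering and up to adding or removing all-$\Delta$ selections. $\mathrm{mean}(s)$ is the point of the plane minimizing the sum of squared distances to the $N$ elements of $s$ (distance to an entry $\Delta$ is distance to the diagonal). $\mathrm{mean}_X(G)$ is the diagram whose off-diagonal points are the $\mathrm{mean}(s)$ for the (not all-$\Delta$) selections $s$ of $G$. A grouping $G$ is optimal for $X$ if $\mathrm{mean}_X(G)$ minimizes the Fréchet function $Z\mapsto\sum_{i=1}^N W_2(Z,X_i)^2$ over diagrams $Z$ with $W_2(Z,D_\emptyset)<\infty$, where $D_\emptyset$ is the diagram with no off-diagonal points. **The random grouping $\mathcal{H}_X$ and the PFM.** Fix $\alpha>0$. For an off-diagonal point $x$ let $r=\min\{\alpha,\|x-\Delta\|\}$ and let $\eta_x$ be the probability distribution on $\mathbb{R}^2\cup\{\Delta\}$ given by $\eta_x=\frac1{\pi\alpha^2}\mathbf{1}_{B(x,r)}+\frac{\alpha^2-r^2}{\alpha^2}\delta_\Delta$ (first term: density with respect to Lebesgue measure; second term: an atom at $\Delta$). Given $X\in(S_{M,K})^N$, draw independently $x'\sim\eta_x$ for each labeled off-diagonal point $x$ of each $X_i$, and let $X_i'$ be the diagram whose off-diagonal points are those $x'\ne\Delta$ with $x\in X_i$. With probability one $X_1',\dots,X_N'$ have a unique optimal grouping; replacing each $x'$ in it by $x$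 and adding the trivial selection for every $x$ with $x'=\Delta$ gives a grouping of $X$. This random grouping is $\mathcal{H}_X$. The probabilistic Fréchet mean (PFM) of $X$ is $\mu_X=\sum_G\mathbb{P}(\mathcal{H}_X=G)\,\delta_{\mathrm{mean}_X(G)}\in\mathcal{P}(S_{M,NK})$, the sum over all groupings $G$ of $X$. *)

theory Defs
  imports "HOL-Probability.Probability"
begin

section \<open>Persistence diagrams and the 2-Wasserstein distance\<close>

type_synonym point = "real \<times> real"

text \<open>The norm of \<^typ>\<open>real \<times> real\<close> is the Euclidean one. The distance \<open>\<parallel>x - \<Delta>\<parallel>\<close> is
  \<open>infdist x diag\<close>.\<close>

definition diag :: "point set" where
  "diag = {(t, t) | t. True}"

text \<open>A diagram is given by its multiplicity function, which is infinite on the whole diagonal.\<close>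

type_synonym diagram = "point \<Rightarrow> enat"

definition diagrams :: "diagram set" where
  "diagrams = {D. countable {p. p \<notin> diag \<and> D p \<noteq> 0} \<and>
                  (\<forall>b d. (b, d) \<notin> diag \<longrightarrow> D (b, d) \<noteq> 0 \<longrightarrow> b < d) \<and>
                  (\<forall>p\<in>diag. D p = \<infinity>)}"

text \<open>The \<open>k\<close>-th copy of the point \<open>p\<close> is \<open>(p, k)\<close>; so repeated points are distinguished.\<close>

type_synonym dpoint = "point \<times> nat"

definition pts :: "diagram \<Rightarrow> dpoint set" where
  "pts D = {(p, k). enat k < D p}"

definition offpts :: "diagram \<Rightarrow> dpoint set" where
  "offpts D = {x \<in> pts D. fst x \<notin> diag}"

text \<open>The diagram whose off-diagonal points are the \<open>f i\<close>, \<open>i \<in> I\<close>, with multiplicity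
  (for finite \<open>I\<close>).\<close>

definition mk_diagram :: "'i set \<Rightarrow> ('i \<Rightarrow> point) \<Rightarrow> diagram" where
  "mk_diagram I f = (\<lambda>p. if p \<in> diag then \<infinity> else enat (card {i \<in> I. f i = p}))"

definition empty_diagram :: diagram where
  "empty_diagram = (\<lambda>p. if p \<in> diag then \<infinity> else 0)"

definition matching :: "diagram \<Rightarrow> diagram \<Rightarrow> (dpoint \<Rightarrow> dpoint) \<Rightarrow> bool" where
  "matching X Y \<phi> \<longleftrightarrow> bij_betw \<phi> (pts X) (pts Y)"

definition esqrt :: "ennreal \<Rightarrow> ennreal" where
  "esqrt x = (if x = \<infinity> then \<infinity> else ennreal (sqrt (enn2real x)))"

definition matching_cost :: "diagram \<Rightarrow> (dpoint \<Rightarrow> dpoint) \<Rightarrow> ennreal" where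
  "matching_cost X \<phi> = esqrt (\<Sum>\<^sub>\<infinity>x\<in>pts X. ennreal ((norm (fst x - fst (\<phi> x)))\<^sup>2))"

definition W2 :: "diagram \<Rightarrow> diagram \<Rightarrow> ennreal" where
  "W2 X Y = (INF \<phi>\<in>{\<phi>. matching X Y \<phi>}. matching_cost X \<phi>)"

definition optimal_matching :: "diagram \<Rightarrow> diagram \<Rightarrow> (dpoint \<Rightarrow> dpoint) \<Rightarrow> bool" where
  "optimal_matching X Y \<phi> \<longleftrightarrow> matching X Y \<phi> \<and> matching_cost X \<phi> = W2 X Y"

text \<open>Real-valued version, used only between diagrams at finite distance.\<close>

definition W2r :: "diagram \<Rightarrow> diagram \<Rightarrow> real" where
  "W2r X Y = enn2real (W2 X Y)"

definition diagram_space :: "real \<Rightarrow> nat \<Rightarrow> diagram set" where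
  "diagram_space M K = {D \<in> diagrams. finite (offpts D) \<and> card (offpts D) \<le> K \<and>
     (\<forall>x\<in>offpts D. 0 \<le> fst (fst x) \<and> fst (fst x) \<le> M \<and>
                    0 \<le> snd (fst x) \<and> snd (fst x) \<le> M)}"

text \<open>Tuples \<open>(X\<^sub>1, \<dots>, X\<^sub>N)\<close> are functions on \<^typ>\<open>nat\<close>, of which only the values at
  \<open>i < N\<close> matter.\<close>

definition d2_vec :: "nat \<Rightarrow> (nat \<Rightarrow> diagram) \<Rightarrow> (nat \<Rightarrow> diagram) \<Rightarrow> real" where
  "d2_vec N X Y = sqrt (\<Sum>i<N. (W2r (X i) (Y i))\<^sup>2)"

text \<open>The space is bounded (and compact), so this supremum is the maximal distance.\<close>

definition max_dist :: "real \<Rightarrow> nat \<Rightarrow> real" where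
  "max_dist M K = (SUP (U, V)\<in>diagram_space M K \<times> diagram_space M K. W2r U V)"

section \<open>The Wasserstein distance between measures on the space of diagrams\<close>

definition diagram_borel :: "real \<Rightarrow> nat \<Rightarrow> diagram measure" where
  "diagram_borel M K = sigma (diagram_space M K)
     {U. openin (Metric_space.mtopology (diagram_space M K) W2r) U}"

definition couplings :: "'a measure \<Rightarrow> 'a measure \<Rightarrow> ('a \<times> 'a) measure set" where
  "couplings \<nu> \<eta> = {\<gamma>. sets \<gamma> = sets (\<nu> \<Otimes>\<^sub>M \<eta>) \<and> distr \<gamma> \<nu> fst = \<nu> \<and> distr \<gamma> \<eta> snd = \<eta>}"

definition wasserstein2 :: "diagram measure \<Rightarrow> diagram measure \<Rightarrow> ennreal" where
  "wasserstein2 \<nu> \<eta> = esqrt (INF \<gamma>\<in>couplings \<nu> \<eta>. \<integral>\<^sup>+ (U, V). (W2 U V)\<^sup>2 \<partial>\<gamma>)"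

section \<open>Selections and groupings\<close>

text \<open>Labeled diagrams with finitely many off-diagonal points are described by the sets \<open>L i\<close> of
  labels of the off-diagonal points of the \<open>i\<close>-th diagram, for \<open>i < N\<close>, and the positions
  \<open>loc i l\<close> of these points. The value \<^const>\<open>None\<close> stands for \<open>\<Delta>\<close>. Selections are
  \<^const>\<open>None\<close> beyond the index range, to make them determined by their \<open>N\<close> entries.\<close>

type_synonym 'l selection = "nat \<Rightarrow> 'l option"

definition is_selection :: "nat \<Rightarrow> (nat \<Rightarrow> 'l set) \<Rightarrow> 'l selection \<Rightarrow> bool" where
  "is_selection N L s \<longleftrightarrow> (\<forall>i<N. s i \<in> insert None (Some ` L i)) \<and> (\<forall>i\<ge>N. s i = None)"

definition trivial_selection :: "nat \<Rightarrow> 'l \<Rightarrow> 'l selection" where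
  "trivial_selection i l = (\<lambda>_. None)(i := Some l)"

text \<open>Each grouping is represented by its set of selections other than the all-\<open>\<Delta>\<close> one. No
  other selection can be repeated, as its labels are in exactly one selection.\<close>

definition is_grouping :: "nat \<Rightarrow> (nat \<Rightarrow> 'l set) \<Rightarrow> 'l selection set \<Rightarrow> bool" where
  "is_grouping N L G \<longleftrightarrow>
     (\<forall>s\<in>G. is_selection N L s \<and> s \<noteq> (\<lambda>_. None)) \<and>
     (\<forall>i<N. \<forall>l\<in>L i. \<exists>!s. s \<in> G \<and> s i = Some l)"

definition sel_mean :: "nat \<Rightarrow> (nat \<Rightarrow> 'l \<Rightarrow> point) \<Rightarrow> 'l selection \<Rightarrow> point" where
  "sel_mean N loc s = arg_min
     (\<lambda>z. \<Sum>i<N. (case s i of None \<Rightarrow> infdist z diag | Some l \<Rightarrow> norm (z - loc i l))\<^sup>2) (\<lambda>_. True)"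

definition grouping_mean :: "nat \<Rightarrow> (nat \<Rightarrow> 'l \<Rightarrow> point) \<Rightarrow> 'l selection set \<Rightarrow> diagram" where
  "grouping_mean N loc G = mk_diagram G (sel_mean N loc)"

definition frechet_fun :: "nat \<Rightarrow> (nat \<Rightarrow> diagram) \<Rightarrow> diagram \<Rightarrow> ennreal" where
  "frechet_fun N X Z = (\<Sum>i<N. (W2 Z (X i))\<^sup>2)"

definition optimal_grouping ::
    "nat \<Rightarrow> (nat \<Rightarrow> 'l set) \<Rightarrow> (nat \<Rightarrow> 'l \<Rightarrow> point) \<Rightarrow> 'l selection set \<Rightarrow> bool" where
  "optimal_grouping N L loc G \<longleftrightarrow> is_grouping N L G \<and>
     is_arg_min (frechet_fun N (\<lambda>i. mk_diagram (L i) (loc i)))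
       (\<lambda>Z. Z \<in> diagrams \<and> W2 Z empty_diagram < \<infinity>) (grouping_mean N loc G)"

section \<open>The probabilistic Frechet mean\<close>

text \<open>The perturbation law of \<open>x\<close>, on the disjoint union of the plane and the point
  \<open>\<Delta>\<close> (\<^const>\<open>None\<close>).\<close>

definition perturb :: "real \<Rightarrow> point \<Rightarrow> point option measure" where
  "perturb \<alpha> x = (let r = min \<alpha> (infdist x diag) in
     measure_of UNIV {A. Some -` A \<in> sets borel}
       (\<lambda>A. ennreal (1 / (pi * \<alpha>\<^sup>2)) * emeasure lborel (Some -` A \<inter> ball x r) +
            ennreal ((\<alpha>\<^sup>2 - r\<^sup>2) / \<alpha>\<^sup>2) * indicator A None))"

text \<open>The law of the family of all perturbed points, indexed by \<open>(i, x)\<close> for the labeled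
  off-diagonal points \<open>x\<close> of \<open>X i\<close>. It is completed because the random grouping is specified
  only outside a null set.\<close>

definition perturb_space ::
    "nat \<Rightarrow> real \<Rightarrow> (nat \<Rightarrow> diagram) \<Rightarrow> (nat \<times> dpoint \<Rightarrow> point option) measure" where
  "perturb_space N \<alpha> X = completion
     (PiM (SIGMA i:{..<N}. offpts (X i)) (\<lambda>(i, x). perturb \<alpha> (fst x)))"

text \<open>A perturbed point \<open>x'\<close> keeps the label of \<open>x\<close>, so the replacement of \<open>x'\<close> by \<open>x\<close> in a
  grouping of the perturbed diagrams does not change the selections.\<close>

definition random_grouping ::
    "nat \<Rightarrow> (nat \<Rightarrow> diagram) \<Rightarrow> (nat \<times> dpoint \<Rightarrow> point option) \<Rightarrow> dpoint selection set" where
  "random_grouping N X \<omega> =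
     (THE G. optimal_grouping N (\<lambda>i. {x \<in> offpts (X i). \<omega> (i, x) \<noteq> None})
               (\<lambda>i x. the (\<omega> (i, x))) G) \<union>
     {trivial_selection i x | i x. i < N \<and> x \<in> offpts (X i) \<and> \<omega> (i, x) = None}"

definition grouping_prob ::
    "nat \<Rightarrow> real \<Rightarrow> (nat \<Rightarrow> diagram) \<Rightarrow> dpoint selection set \<Rightarrow> real" where
  "grouping_prob N \<alpha> X G = measure (perturb_space N \<alpha> X)
     {\<omega> \<in> space (perturb_space N \<alpha> X). random_grouping N X \<omega> = G}"

definition pfm :: "real \<Rightarrow> nat \<Rightarrow> nat \<Rightarrow> real \<Rightarrow> (nat \<Rightarrow> diagram) \<Rightarrow> diagram measure" where
  "pfm M N K \<alpha> X =
     measure_of (diagram_space M (N * K)) (sets (diagram_borel M (N * K)))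
       (\<lambda>A. \<Sum>G | is_grouping N (\<lambda>i. offpts (X i)) G.
          ennreal (grouping_prob N \<alpha> X G) * indicator A (grouping_mean N (\<lambda>i. fst) G))"

end

theory Submission
  imports Defs
begin

text \<open>
  The mean of a selection and the cost of a grouping are explicit quadratic functions of the
  coordinates of the points along and across the diagonal. The Frechet function is bounded below by
  the least cost of a grouping, because matchings of a diagram with the data induce a grouping; in
  generic position the optimal grouping is therefore the unique one of least cost, and almost every
  perturbed family is in generic position.

  Fix the optimal matchings. For a matched pair \<open>x, y\<close> of off-diagonal points the laws
  \<open>\<eta>\<^sub>x\<close> and \<open>\<eta>\<^sub>y\<close> have a common part of mass at least
  \<open>1 - 2 \<parallel>x - y\<parallel> / \<alpha>\<close>, and an unmatched \<open>x\<close> is sent to \<open>\<Delta>\<close> with probability at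
  least \<open>1 - \<parallel>x - \<Delta>\<parallel>\<^sup>2 / \<alpha>\<^sup>2\<close>. The product of these common parts couples all but a mass
  \<open>2 S / \<alpha> + d\<^sup>2 / \<alpha>\<^sup>2\<close> of the two perturbations, \<open>S\<close> being the sum of the matched distances.
  On the coupled part the two groupings correspond, up to trivial selections of unmatched points,
  and their means are at distance at most \<open>d\<close>, the distance of the tuples; elsewhere the distance
  is at most the maximal one.
\<close>

section \<open>Coordinates along and across the diagonal, and matchings\<close>

text \<open>A \<Delta>-entry pulls the height \<open>hc\<close> of a mean towards 0 and leaves its
  position \<open>mc\<close> along the diagonal free. So a selection with k entries off the diagonal
  has mean position (sum of \<open>mc\<close>) / k but mean height (sum of \<open>hc\<close>) / N.
  Its cost is twice what remains of the sum of squares after subtracting one square term for each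
  coordinate, and the sums of squares add up to the same total for all groupings. This is why the
  difference of two costs is affine in the height of a single point. The obstacle is that optimality
  speaks of the diagram mean(G) and its Frechet value, and this diagram may be matched to the data
  through a grouping other than G. Distinct height sums make every such detour cost a fixed amount
  above the optimum. For the constants: when the centres of two perturbation discs are a distance
  delta apart, the common part loses at most 2 delta r / \<alpha> squared with a radius r of at most
  \<alpha>; an unmatched point loses its squared radius over \<alpha> squared. Summing the losses
  gives the uncoupled mass. It is weighted with the squared maximal distance, and the resulting
  coefficients are compared with the square of \<open>C\<close>.\<close>

definition mc :: "point \<Rightarrow> real" where "mc p = (fst p + snd p) / 2"

definition hc :: "point \<Rightarrow> real" where "hc p = (snd p - fst p) / 2"

definition diag_proj :: "point \<Rightarrow> point" where "diag_proj p = (mc p, mc p)"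

text \<open>\<open>mc\<close> and \<open>hc\<close> are orthogonal coordinates with
  \<open>p = (mc p - hc p, mc p + hc p)\<close>; a unit of either has length sqrt 2, hence the
  factor 2. Squared distances thus split into a part along and a part across the diagonal.\<close>

lemma norm_point_sq: "(norm (p - q))\<^sup>2 = 2 * ((mc p - mc q)\<^sup>2 + (hc p - hc q)\<^sup>2)" for p q :: point
proof -
  have "(norm (p - q))\<^sup>2 = (fst p - fst q)\<^sup>2 + (snd p - snd q)\<^sup>2"
    by (simp add: norm_prod_def)
  then show ?thesis
    by (simp add: mc_def hc_def power2_eq_square field_simps)
qed

lemma in_diag_iff: "p \<in> diag \<longleftrightarrow> hc p = 0"
  by (cases p) (auto simp: diag_def hc_def)

lemma diag_proj_in_diag [simp]: "diag_proj p \<in> diag"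
  by (simp add: diag_proj_def diag_def)

lemma mc_diag_proj [simp]: "mc (diag_proj p) = mc p" and hc_diag_proj [simp]: "hc (diag_proj p) = 0"
  by (simp_all add: diag_proj_def mc_def hc_def)

lemma mc_Pair [simp]: "mc (a - b, a + b) = a" and hc_Pair [simp]: "hc (a - b, a + b) = b"
  by (simp_all add: mc_def hc_def)

lemma diag_nonempty [simp]: "diag \<noteq> {}"
  by (auto simp: diag_def)

lemma infdist_diag: "infdist p diag = norm (p - diag_proj p)"
proof (rule antisym)
  show "infdist p diag \<le> norm (p - diag_proj p)"
    using infdist_le[OF diag_proj_in_diag[of p], of p] by (simp add: dist_norm)
  have "norm (p - diag_proj p) \<le> norm (p - z)" if "z \<in> diag" for z
    by (rule power2_le_imp_le)
      (use that in \<open>auto simp: norm_point_sq in_diag_iff\<close>)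
  then show "norm (p - diag_proj p) \<le> infdist p diag"
    by (simp add: infdist_notempty dist_norm cINF_greatest)
qed

lemma infdist_diag_sq: "(infdist p diag)\<^sup>2 = 2 * (hc p)\<^sup>2"
  by (simp add: infdist_diag norm_point_sq)

lemma infdist_diag_le: "z \<in> diag \<Longrightarrow> infdist p diag \<le> norm (p - z)"
  using infdist_le[of z diag p] by (simp add: dist_norm)

section \<open>Squared distances and near-optimal matchings\<close>

lemma esqrt_sq [simp]: "(esqrt x)\<^sup>2 = x"
proof (cases "x = \<infinity>")
  case False
  then show ?thesis
    by (simp add: esqrt_def ennreal_power less_top)
qed (simp add: esqrt_def power2_eq_square)

lemma ennreal_power2_mono: "x \<le> y \<longleftrightarrow> x\<^sup>2 \<le> y\<^sup>2" for x y :: ennreal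
proof
  assume "x\<^sup>2 \<le> y\<^sup>2"
  show "x \<le> y"
  proof (rule ccontr)
    assume "\<not> x \<le> y"
    then have l: "y < x" by simp
    then have "y < top" by (rule less_le_trans) simp
    obtain b where b: "y = ennreal b" "b \<ge> 0" using \<open>y < top\<close> by (cases y) auto
    have "y\<^sup>2 < x\<^sup>2"
    proof (cases x)
      case (real a)
      then have "b < a" using l b by (simp add: ennreal_less_iff)
      then have "b\<^sup>2 < a\<^sup>2" using b by (intro power_strict_mono) auto
      then show ?thesis using real b by (simp add: ennreal_power ennreal_less_iff)
    next
      case top
      then show ?thesis using b by (simp add: ennreal_power power2_eq_square[of top])
    qed
    with \<open>x\<^sup>2 \<le> y\<^sup>2\<close> show False by simp
  qed
qed (rule power_mono, auto)

lemma esqrt_le_iff: "esqrt x \<le> y \<longleftrightarrow> x \<le> y\<^sup>2"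
  by (subst ennreal_power2_mono) simp

lemma W2_sq_le: "matching X Y \<phi> \<Longrightarrow>
   (W2 X Y)\<^sup>2 \<le> (\<Sum>\<^sub>\<infinity>x\<in>pts X. ennreal ((norm (fst x - fst (\<phi> x)))\<^sup>2))"
proof -
  assume "matching X Y \<phi>"
  then have "W2 X Y \<le> matching_cost X \<phi>"
    unfolding W2_def by (intro INF_lower) simp
  then have "(W2 X Y)\<^sup>2 \<le> (matching_cost X \<phi>)\<^sup>2"
    by (rule power_mono) simp
  then show ?thesis by (simp add: matching_cost_def)
qed

text \<open>The infimum in \<open>W2\<close> is not known to be attained here, so lower bounds go
  through matchings that are optimal up to \<open>e\<close>. If none existed, a number above
  \<open>W2 X Y\<close> would bound all costs from below.\<close>

lemma W2_sq_approx:
  assumes "W2 X Y < \<infinity>" "e > 0"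
  shows "\<exists>\<phi>. matching X Y \<phi> \<and> (matching_cost X \<phi>)\<^sup>2 \<le> (W2 X Y)\<^sup>2 + ennreal e"
proof (rule ccontr)
  assume "\<not> ?thesis"
  then have *: "(W2 X Y)\<^sup>2 + ennreal e \<le> (matching_cost X \<phi>)\<^sup>2" if "matching X Y \<phi>" for \<phi>
    using that by (auto simp: not_le less_imp_le)
  have "esqrt ((W2 X Y)\<^sup>2 + ennreal e) \<le> W2 X Y"
    by (subst (2) W2_def, rule INF_greatest) (auto simp: esqrt_le_iff *)
  then have "(W2 X Y)\<^sup>2 + ennreal e \<le> (W2 X Y)\<^sup>2"
    by (simp add: esqrt_le_iff)
  moreover have "(W2 X Y)\<^sup>2 < top" using assms by (simp add: power_less_top_ennreal)
  ultimately show False using \<open>e > 0\<close>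
    by (cases "(W2 X Y)\<^sup>2") (auto simp flip: ennreal_plus)
qed

text \<open>Near-optimal matchings approach the Frechet value, with the error split among the
  \<open>N\<close> diagrams; so a bound valid for every choice of \<open>N\<close> matchings passes
  to the infima.\<close>

lemma le_sum_W2_sqI:
  fixes c :: ennreal
  assumes "\<And>\<phi>. (\<And>i. i < N \<Longrightarrow> matching Z (X i) (\<phi> i)) \<Longrightarrow> c \<le> (\<Sum>i<N. (matching_cost Z (\<phi> i))\<^sup>2)"
  shows "c \<le> frechet_fun N X Z"
  unfolding frechet_fun_def
proof (rule ennreal_le_epsilon)
  fix e :: real assume fin: "(\<Sum>i<N. (W2 Z (X i))\<^sup>2) < top" and e: "e > 0"
  \<comment> \<open>\<open>N + 1\<close> keeps the quotient meaningful for \<open>N = 0\<close>; the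
    \<open>N\<close> shares add up to at most \<open>e\<close>.\<close>
  define e' where "e' = e / (real N + 1)"
  have e': "e' > 0" using e by (simp add: e'_def)
  have "\<exists>\<phi>. matching Z (X i) \<phi> \<and> (matching_cost Z \<phi>)\<^sup>2 \<le> (W2 Z (X i))\<^sup>2 + ennreal e'" if "i < N" for i
  proof (rule W2_sq_approx[OF _ e'])
    have "(W2 Z (X i))\<^sup>2 < top" using fin that member_le_sum[of i "{..<N}" "\<lambda>i. (W2 Z (X i))\<^sup>2"] by (auto intro: le_less_trans)
    then show "W2 Z (X i) < \<infinity>" by (simp add: power_less_top_ennreal)
  qed
  then obtain \<phi> where \<phi>: "\<And>i. i < N \<Longrightarrow> matching Z (X i) (\<phi> i)"
     "\<And>i. i < N \<Longrightarrow> (matching_cost Z (\<phi> i))\<^sup>2 \<le> (W2 Z (X i))\<^sup>2 + ennreal e'" by metis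
  have "c \<le> (\<Sum>i<N. (matching_cost Z (\<phi> i))\<^sup>2)" by (rule assms) (rule \<phi>)
  also have "\<dots> \<le> (\<Sum>i<N. (W2 Z (X i))\<^sup>2 + ennreal e')" by (intro sum_mono \<phi>) auto
  also have "\<dots> = (\<Sum>i<N. (W2 Z (X i))\<^sup>2) + ennreal (real N * e')"
    using e' by (simp add: sum.distrib ennreal_mult ennreal_of_nat_eq_real_of_nat)
  also have "\<dots> \<le> (\<Sum>i<N. (W2 Z (X i))\<^sup>2) + ennreal e"
    using e by (intro add_left_mono ennreal_leI) (simp add: e'_def field_simps)
  finally show "c \<le> (\<Sum>i<N. (W2 Z (X i))\<^sup>2) + ennreal e" .
qed

text \<open>A diagram of the form \<^const>\<open>mk_diagram\<close> is, up to a location-preserving bijection, the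
  disjoint union of its indices and one sequence of copies of every diagonal point.\<close>

definition ext_loc :: "('i \<Rightarrow> point) \<Rightarrow> 'i + dpoint \<Rightarrow> point" where
  "ext_loc f u = (case u of Inl i \<Rightarrow> f i | Inr x \<Rightarrow> fst x)"

text \<open>Gluing of bijections between fibres. It turns the search for a location-preserving
  bijection into a count of the fibre over each point.\<close>

lemma fibrewise_bij:
  assumes "\<And>p. \<exists>b. bij_betw b {x\<in>A. u x = p} {y\<in>B. v y = p}"
  shows "\<exists>b. bij_betw b A B \<and> (\<forall>x\<in>A. v (b x) = u x)"
proof -
  obtain b where b: "\<And>p. bij_betw (b p) {x\<in>A. u x = p} {y\<in>B. v y = p}" using assms by metis
  define c where "c x = b (u x) x" for x
  have c: "c x \<in> B \<and> v (c x) = u x" if "x \<in> A" for x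
    using b[of "u x"] that by (auto simp: bij_betw_def c_def)
  have "bij_betw c A B"
  proof (rule bij_betwI')
    fix x y assume "x \<in> A" "y \<in> A"
    then show "(c x = c y) = (x = y)"
      using c[of x] c[of y] b[of "u x"] by (auto simp: bij_betw_def c_def inj_on_def)
  next
    fix x assume "x \<in> A" then show "c x \<in> B" using c by auto
  next
    fix y assume "y \<in> B"
    then have "y \<in> b (v y) ` {x\<in>A. u x = v y}" using b[of "v y"] by (auto simp: bij_betw_def)
    then obtain x where "x \<in> A" "u x = v y" "y = b (v y) x" by auto
    then have "y = c x" by (simp add: c_def)
    with \<open>x \<in> A\<close> show "\<exists>x\<in>A. y = c x" by auto
  qed
  then show ?thesis using c by auto
qed

lemma mk_diagram_bij:
  assumes "finite I"
  shows "\<exists>b. bij_betw b (pts (mk_diagram I f)) (I <+> diag \<times> UNIV) \<and>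
             (\<forall>x\<in>pts (mk_diagram I f). ext_loc f (b x) = fst x)"
proof (rule fibrewise_bij)
  fix p
  show "\<exists>b. bij_betw b {x \<in> pts (mk_diagram I f). fst x = p} {y \<in> I <+> diag \<times> UNIV. ext_loc f y = p}"
  proof (cases "p \<in> diag")
    \<comment> \<open>Over a diagonal point both fibres are countably infinite; finitely many extra
      indices located there are absorbed.\<close>
    case True
    have "{x \<in> pts (mk_diagram I f). fst x = p} = {p} \<times> UNIV"
      using True by (auto simp: pts_def mk_diagram_def)
    moreover have "{y \<in> I <+> diag \<times> UNIV. ext_loc f y = p} = {i\<in>I. f i = p} <+> {p} \<times> UNIV"
      using True by (auto simp: ext_loc_def)
    moreover have "countable ({p} \<times> (UNIV::nat set))" "infinite ({p} \<times> (UNIV::nat set))"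
      by (auto dest: finite_cartesian_productD2)
    moreover have "countable ({i\<in>I. f i = p} <+> {p} \<times> (UNIV::nat set))"
      "infinite ({i\<in>I. f i = p} <+> {p} \<times> (UNIV::nat set))"
      using assms by (auto simp: countable_finite finite_Plus_iff dest: finite_cartesian_productD2 intro!: countable_Plus)
    ultimately show ?thesis
      by (metis (no_types, lifting) bij_betw_from_nat_into bij_betw_inv bij_betw_trans to_nat_on_infinite)
  next
    case False
    have "{x \<in> pts (mk_diagram I f). fst x = p} = {p} \<times> {..<card {i\<in>I. f i = p}}"
      using False by (auto simp: pts_def mk_diagram_def)
    moreover have "{y \<in> I <+> diag \<times> UNIV. ext_loc f y = p} = Inl ` {i\<in>I. f i = p}"
      using False by (auto simp: ext_loc_def)
    ultimately show ?thesis
      using assms by (auto intro!: finite_same_card_bij simp: card_image card_cartesian_product_singleton)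
  qed
qed

text \<open>Index \<open>i\<close> is matched with itself and each diagonal copy with itself, so
  only the indices contribute. As \<open>f i\<close> or \<open>g i\<close> may lie on the diagonal,
  the bound also covers points that are paired with \<Delta>.\<close>

lemma W2_mk_diagram_le:
  assumes "finite I"
  shows "(W2 (mk_diagram I f) (mk_diagram I g))\<^sup>2 \<le> (\<Sum>i\<in>I. ennreal ((norm (f i - g i))\<^sup>2))"
proof -
  obtain b where b: "bij_betw b (pts (mk_diagram I f)) (I <+> diag \<times> UNIV)"
    "\<And>x. x\<in>pts (mk_diagram I f) \<Longrightarrow> ext_loc f (b x) = fst x"
    using mk_diagram_bij[OF assms] by metis
  obtain c where c: "bij_betw c (pts (mk_diagram I g)) (I <+> diag \<times> UNIV)"
    "\<And>x. x\<in>pts (mk_diagram I g) \<Longrightarrow> ext_loc g (c x) = fst x"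
    using mk_diagram_bij[OF assms] by metis
  define c' where "c' = inv_into (pts (mk_diagram I g)) c"
  have c': "bij_betw c' (I <+> diag \<times> UNIV) (pts (mk_diagram I g))"
    unfolding c'_def by (rule bij_betw_inv_into[OF c(1)])
  have c'2: "fst (c' u) = ext_loc g u" if "u \<in> I <+> diag \<times> UNIV" for u
    using c(2)[of "c' u"] c'(1) that c(1)
    by (metis bij_betwE bij_betw_inv_into_right c'_def)
  have "(W2 (mk_diagram I f) (mk_diagram I g))\<^sup>2 \<le>
     (\<Sum>\<^sub>\<infinity>x\<in>pts (mk_diagram I f). ennreal ((norm (fst x - fst ((c' \<circ> b) x)))\<^sup>2))"
    by (rule W2_sq_le, unfold matching_def, rule bij_betw_trans[OF b(1) c'])
  also have "\<dots> = (\<Sum>\<^sub>\<infinity>x\<in>pts (mk_diagram I f). ennreal ((norm (ext_loc f (b x) - ext_loc g (b x)))\<^sup>2))"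
  proof (rule infsum_cong)
    fix x assume "x \<in> pts (mk_diagram I f)"
    moreover have "b x \<in> I <+> diag \<times> UNIV" using b(1) calculation by (auto simp: bij_betw_def)
    ultimately show "ennreal ((norm (fst x - fst ((c' \<circ> b) x)))\<^sup>2) =
         ennreal ((norm (ext_loc f (b x) - ext_loc g (b x)))\<^sup>2)"
      by (simp add: b(2) c'2)
  qed
  also have "\<dots> = (\<Sum>\<^sub>\<infinity>u\<in>I <+> diag \<times> UNIV. ennreal ((norm (ext_loc f u - ext_loc g u))\<^sup>2))"
    by (rule infsum_reindex_bij_betw[OF b(1)])
  also have "\<dots> = (\<Sum>\<^sub>\<infinity>u\<in>Inl ` I. ennreal ((norm (ext_loc f u - ext_loc g u))\<^sup>2))"
    by (rule infsum_cong_neutral) (auto simp: ext_loc_def)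
  also have "\<dots> = (\<Sum>u\<in>Inl ` I. ennreal ((norm (ext_loc f u - ext_loc g u))\<^sup>2))"
    using assms by (intro infsum_finite) simp
  also have "\<dots> = (\<Sum>i\<in>I. ennreal ((norm (f i - g i))\<^sup>2))"
    by (subst sum.reindex) (auto simp: ext_loc_def)
  finally show ?thesis .
qed

lemma offpts_mk_diagram_bij:
  assumes "finite I" "\<And>i. i \<in> I \<Longrightarrow> f i \<notin> diag"
  shows "\<exists>b. bij_betw b (offpts (mk_diagram I f)) I \<and> (\<forall>x\<in>offpts (mk_diagram I f). f (b x) = fst x)"
proof (rule fibrewise_bij)
  fix p
  have "{x \<in> offpts (mk_diagram I f). fst x = p} = (if p \<in> diag then {} else {p} \<times> {..<card {i\<in>I. f i = p}})"
    by (auto simp: offpts_def pts_def mk_diagram_def)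
  moreover have "p \<in> diag \<Longrightarrow> {i\<in>I. f i = p} = {}" using assms by auto
  ultimately show "\<exists>b. bij_betw b {x \<in> offpts (mk_diagram I f). fst x = p} {y \<in> I. f y = p}"
    using assms by (auto intro!: finite_same_card_bij simp: card_image card_cartesian_product_singleton)
qed

lemma mk_diagram_offpts:
  assumes "D \<in> diagrams" "finite (offpts D)"
  shows "mk_diagram (offpts D) fst = D"
proof
  fix p
  show "mk_diagram (offpts D) fst p = D p"
  proof (cases "p \<in> diag")
    case True then show ?thesis using assms by (simp add: mk_diagram_def diagrams_def)
  next
    case False
    have fin: "finite {x \<in> offpts D. fst x = p}" using assms by auto
    have eq: "{x \<in> offpts D. fst x = p} = {p} \<times> {k. enat k < D p}"
      using False by (auto simp: offpts_def pts_def)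
    show ?thesis
    proof (cases "D p")
      case (enat n)
      then show ?thesis using False eq by (simp add: mk_diagram_def card_cartesian_product_singleton)
    next
      case infinity
      then show ?thesis using fin eq by (auto dest: finite_cartesian_productD2)
    qed
  qed
qed

text \<open>Multiplicities on the diagonal are infinite anyway, so surplus indices on either side
  are harmless as long as their positions are diagonal points.\<close>

lemma mk_diagram_reindex:
  assumes "inj_on h I" "\<And>i. i \<in> I \<Longrightarrow> f i = g (h i)"
    and "\<And>j. j \<in> J - h ` I \<Longrightarrow> g j \<in> diag" and "\<And>i. i \<in> I \<Longrightarrow> h i \<notin> J \<Longrightarrow> f i \<in> diag"
  shows "mk_diagram I f = mk_diagram J g"
proof
  fix p
  show "mk_diagram I f p = mk_diagram J g p"
  proof (cases "p \<in> diag")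
    case False
    have "bij_betw h {i\<in>I. f i = p} {j\<in>J. g j = p}"
      unfolding bij_betw_def
    proof
      show "inj_on h {i\<in>I. f i = p}" using assms(1) by (rule inj_on_subset) auto
      show "h ` {i\<in>I. f i = p} = {j\<in>J. g j = p}"
        using assms(2-) False by fastforce
    qed
    then show ?thesis using False by (simp add: mk_diagram_def bij_betw_same_card)
  qed (simp add: mk_diagram_def)
qed

lemma mk_diagram_in_diagrams:
  assumes "finite I" "\<And>i. i \<in> I \<Longrightarrow> hc (f i) \<ge> 0"
  shows "mk_diagram I f \<in> diagrams"
proof -
  have "{p. p \<notin> diag \<and> mk_diagram I f p \<noteq> 0} \<subseteq> f ` I"
    by (auto simp: mk_diagram_def zero_enat_def card_eq_0_iff split: if_splits) (metis imageI)
  then have "countable {p. p \<notin> diag \<and> mk_diagram I f p \<noteq> 0}"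
    using assms(1) by (meson countable_finite countable_subset finite_imageI)
  moreover have "b < d" if "(b, d) \<notin> diag" "mk_diagram I f (b, d) \<noteq> 0" for b d
  proof -
    have "{i \<in> I. f i = (b, d)} \<noteq> {}"
    proof
      assume "{i \<in> I. f i = (b, d)} = {}"
      with that show False by (simp add: mk_diagram_def zero_enat_def)
    qed
    then obtain i where "i \<in> I" "f i = (b, d)" by auto
    then have "hc (b, d) \<ge> 0" using assms(2)[of i] by simp
    with that(1) show ?thesis by (auto simp: in_diag_iff hc_def)
  qed
  ultimately show ?thesis by (auto simp: diagrams_def mk_diagram_def)
qed

lemma finite_offpts_mk_diagram:
  assumes "finite I"
  shows "finite (offpts (mk_diagram I f))" "card (offpts (mk_diagram I f)) \<le> card I"
    "x \<in> offpts (mk_diagram I f) \<Longrightarrow> fst x \<in> f ` I"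
proof -
  \<comment> \<open>Indices located on the diagonal are dropped first, because
    \<open>offpts_mk_diagram_bij\<close> asks for positions off it.\<close>
  define I' where "I' = {i\<in>I. f i \<notin> diag}"
  have I': "finite I'" "card I' \<le> card I" using assms by (auto simp: I'_def intro: card_mono)
  have eq: "mk_diagram I f = mk_diagram I' f"
    by (rule sym, rule mk_diagram_reindex[where h = "\<lambda>x. x"]) (auto simp: I'_def)
  obtain b where b: "bij_betw b (offpts (mk_diagram I' f)) I'" "\<And>x. x\<in>offpts (mk_diagram I' f) \<Longrightarrow> f (b x) = fst x"
    using offpts_mk_diagram_bij[OF I'(1), of f] unfolding I'_def by auto
  show "finite (offpts (mk_diagram I f))" using bij_betw_finite[OF b(1)] I' eq by simp
  show "card (offpts (mk_diagram I f)) \<le> card I" using bij_betw_same_card[OF b(1)] I' eq by simp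
  show "fst x \<in> f ` I" if "x \<in> offpts (mk_diagram I f)"
    using b that unfolding eq by (metis (no_types, lifting) I'_def bij_betwE image_eqI mem_Collect_eq)
qed

section \<open>Selections and their means\<close>

text \<open>Number of entries, sums of positions, of heights and of squares are all sums over the
  entries other than \<Delta>; one functional, linear in the weight \<open>F\<close>, serves for all
  of them.\<close>

definition sel_sum :: "nat \<Rightarrow> (nat \<Rightarrow> 'l \<Rightarrow> real) \<Rightarrow> 'l selection \<Rightarrow> real" where
  "sel_sum N F s = (\<Sum>i<N. case s i of None \<Rightarrow> 0 | Some l \<Rightarrow> F i l)"

abbreviation sel_size :: "nat \<Rightarrow> 'l selection \<Rightarrow> real" where
  "sel_size N \<equiv> sel_sum N (\<lambda>_ _. 1)"

abbreviation sel_mc :: "nat \<Rightarrow> (nat \<Rightarrow> 'l \<Rightarrow> point) \<Rightarrow> 'l selection \<Rightarrow> real" where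
  "sel_mc N loc \<equiv> sel_sum N (\<lambda>i l. mc (loc i l))"

abbreviation sel_hc :: "nat \<Rightarrow> (nat \<Rightarrow> 'l \<Rightarrow> point) \<Rightarrow> 'l selection \<Rightarrow> real" where
  "sel_hc N loc \<equiv> sel_sum N (\<lambda>i l. hc (loc i l))"

definition sel_obj :: "nat \<Rightarrow> (nat \<Rightarrow> 'l \<Rightarrow> point) \<Rightarrow> 'l selection \<Rightarrow> point \<Rightarrow> real" where
  "sel_obj N loc s z =
     (\<Sum>i<N. (case s i of None \<Rightarrow> infdist z diag | Some l \<Rightarrow> norm (z - loc i l))\<^sup>2)"

text \<open>For the all-\<open>\<Delta>\<close> selection the cost is \<open>0\<close>, as \<open>x / 0 = 0\<close>.\<close>

definition sel_cost :: "nat \<Rightarrow> (nat \<Rightarrow> 'l \<Rightarrow> point) \<Rightarrow> 'l selection \<Rightarrow> real" where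
  "sel_cost N loc s = 2 * (sel_sum N (\<lambda>i l. (mc (loc i l))\<^sup>2 + (hc (loc i l))\<^sup>2) s
     - (sel_mc N loc s)\<^sup>2 / sel_size N s - (sel_hc N loc s)\<^sup>2 / N)"

definition grouping_cost :: "nat \<Rightarrow> (nat \<Rightarrow> 'l \<Rightarrow> point) \<Rightarrow> 'l selection set \<Rightarrow> real" where
  "grouping_cost N loc G = (\<Sum>s\<in>G. sel_cost N loc s)"

lemma sel_sum_add: "sel_sum N (\<lambda>i l. F i l + F' i l) s = sel_sum N F s + sel_sum N F' s"
  unfolding sel_sum_def sum.distrib[symmetric] by (rule sum.cong) (auto split: option.splits)

lemma sel_sum_cmult: "sel_sum N (\<lambda>i l. c * F i l) s = c * sel_sum N F s"
  unfolding sel_sum_def sum_distrib_left by (rule sum.cong) (auto split: option.splits)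

lemma sel_sum_const: "sel_sum N (\<lambda>_ _. c) s = c * sel_size N s"
  using sel_sum_cmult[of N c "\<lambda>_ _. 1" s] by simp

lemma sel_sum_diff: "sel_sum N (\<lambda>i l. F i l - F' i l) s = sel_sum N F s - sel_sum N F' s"
  unfolding sel_sum_def sum_subtractf[symmetric] by (rule sum.cong) (auto split: option.splits)

lemma sel_sum_mono:
  assumes "\<And>i l. i < N \<Longrightarrow> s i = Some l \<Longrightarrow> F i l \<le> F' i l"
  shows "sel_sum N F s \<le> sel_sum N F' s"
  unfolding sel_sum_def by (rule sum_mono) (use assms in \<open>auto split: option.splits\<close>)

lemma sel_sum_cong:
  assumes "\<And>i l. i < N \<Longrightarrow> s i = Some l \<Longrightarrow> F i l = F' i l"
  shows "sel_sum N F s = sel_sum N F' s"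
  unfolding sel_sum_def by (rule sum.cong) (use assms in \<open>auto split: option.splits\<close>)

lemma sel_sum_pos:
  assumes "i < N" "s i \<noteq> None" "\<And>i l. i < N \<Longrightarrow> s i = Some l \<Longrightarrow> F i l > 0"
  shows "sel_sum N F s > 0"
  unfolding sel_sum_def
  by (rule sum_pos2[where i = i]) (use assms in \<open>auto split: option.splits intro: less_imp_le\<close>)

lemma sel_sum_nonneg: "(\<And>i l. i < N \<Longrightarrow> s i = Some l \<Longrightarrow> F i l \<ge> 0) \<Longrightarrow> sel_sum N F s \<ge> 0"
  unfolding sel_sum_def by (rule sum_nonneg) (auto split: option.splits)

lemma sel_size_le: "sel_size N s \<le> N"
  unfolding sel_sum_def
  using sum_bounded_above[of "{..<N}" "\<lambda>i. case s i of None \<Rightarrow> 0 | Some l \<Rightarrow> 1" "1::real"]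
  by (auto split: option.splits)

lemma sel_size_ge1: "i < N \<Longrightarrow> s i \<noteq> None \<Longrightarrow> sel_size N s \<ge> 1"
  unfolding sel_sum_def
  using member_le_sum[of i "{..<N}" "\<lambda>i. case s i of None \<Rightarrow> 0 | Some l \<Rightarrow> (1::real)"]
  by (auto split: option.splits)

lemma selection_nonempty:
  assumes "is_selection N L s" "s \<noteq> (\<lambda>_. None)"
  obtains i l where "i < N" "l \<in> L i" "s i = Some l"
proof -
  obtain i where i: "s i \<noteq> None" using assms(2) by (auto simp: fun_eq_iff)
  then have "i < N" using assms(1) by (meson is_selection_def leI)
  with i assms(1) that show ?thesis by (auto simp: is_selection_def)
qed

lemma sel_size_pos: "is_selection N L s \<Longrightarrow> s \<noteq> (\<lambda>_. None) \<Longrightarrow> sel_size N s > 0"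
  by (erule (1) selection_nonempty) (auto intro: sel_sum_pos)

text \<open>Completing the square separately in \<open>mc\<close> and \<open>hc\<close>. A
  \<Delta>-entry contributes twice the squared height of \<open>z\<close> and nothing in
  \<open>mc\<close>, so the height square has the weight \<open>N\<close> and the position square
  only the weight \<open>sel_size N s\<close>.\<close>

lemma sel_obj_eq:
  assumes "N \<ge> 1"
  shows "sel_obj N loc s z = sel_cost N loc s + 2 * sel_size N s * (mc z - sel_mc N loc s / sel_size N s)\<^sup>2
           + 2 * real N * (hc z - sel_hc N loc s / N)\<^sup>2"
proof -
  have "sel_obj N loc s z = (\<Sum>i<N. 2 * (hc z)\<^sup>2 + (case s i of None \<Rightarrow> 0 | Some l \<Rightarrow>
      2 * (mc z)\<^sup>2 + (((-4 * mc z) * mc (loc i l) + (-4 * hc z) * hc (loc i l)) +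
       2 * ((mc (loc i l))\<^sup>2 + (hc (loc i l))\<^sup>2))))"
    unfolding sel_obj_def
    by (intro sum.cong refl)
      (auto simp: infdist_diag_sq norm_point_sq split: option.splits, simp add: power2_eq_square algebra_simps)
  also have "\<dots> = 2 * real N * (hc z)\<^sup>2 + sel_sum N (\<lambda>i l. 2 * (mc z)\<^sup>2 +
     (((-4 * mc z) * mc (loc i l) + (-4 * hc z) * hc (loc i l)) +
       2 * ((mc (loc i l))\<^sup>2 + (hc (loc i l))\<^sup>2))) s"
    by (simp only: sum.distrib sel_sum_def sum_constant card_lessThan)
  also have "\<dots> = 2 * real N * (hc z)\<^sup>2 + 2 * (mc z)\<^sup>2 * sel_size N s - 4 * mc z * sel_mc N loc s
     - 4 * hc z * sel_hc N loc s + 2 * sel_sum N (\<lambda>i l. (mc (loc i l))\<^sup>2 + (hc (loc i l))\<^sup>2) s"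
    by (simp only: sel_sum_add sel_sum_cmult sel_sum_const[of N "(mc z)\<^sup>2"])
  also have "\<dots> = sel_cost N loc s + 2 * sel_size N s * (mc z - sel_mc N loc s / sel_size N s)\<^sup>2
           + 2 * real N * (hc z - sel_hc N loc s / N)\<^sup>2"
  proof (cases "sel_size N s = 0")
    \<comment> \<open>All entries are \<Delta>, and with \<open>x / 0 = 0\<close> only the height
      square is left on both sides.\<close>
    case True
    have "s i = None" if "i < N" for i
      using sel_size_ge1[of i N s] that True by fastforce
    then have "sel_sum N F s = 0" for F unfolding sel_sum_def by (intro sum.neutral) auto
    then show ?thesis by (simp add: sel_cost_def)
  next
    case False
    then show ?thesis using assms
      by (simp add: sel_cost_def power2_eq_square field_simps)
  qed
  finally show ?thesis .
qed

lemma sel_mean_eq: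
  assumes "N \<ge> 1" "is_selection N L s" "s \<noteq> (\<lambda>_. None)"
  shows "mc (sel_mean N loc s) = sel_mc N loc s / sel_size N s"
    and "hc (sel_mean N loc s) = sel_hc N loc s / N"
    and "sel_obj N loc s (sel_mean N loc s) = sel_cost N loc s"
proof -
  note pos = sel_size_pos[OF assms(2,3)]
  define z where "z = (sel_mc N loc s / sel_size N s - sel_hc N loc s / N,
                       sel_mc N loc s / sel_size N s + sel_hc N loc s / N)"
  have z: "sel_obj N loc s z = sel_cost N loc s"
    by (simp add: sel_obj_eq[OF assms(1)] z_def)
  \<comment> \<open>\<open>arg_min\<close> is controlled only through its value, which equals that
    at the explicit minimizer \<open>z\<close>. The point is then recovered: both weights are
    positive, so both squares must vanish.\<close>
  have "sel_obj N loc s (arg_min (sel_obj N loc s) (\<lambda>_. True)) = sel_obj N loc s z"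
    by (rule arg_min_equality) (use pos in \<open>simp_all only: z, auto simp: sel_obj_eq[OF assms(1)]\<close>)
  moreover have "sel_mean N loc s = arg_min (sel_obj N loc s) (\<lambda>_. True)"
    by (simp add: sel_mean_def sel_obj_def[abs_def])
  ultimately show c: "sel_obj N loc s (sel_mean N loc s) = sel_cost N loc s" by (simp add: z)
  have "2 * sel_size N s * (mc (sel_mean N loc s) - sel_mc N loc s / sel_size N s)\<^sup>2
           + 2 * real N * (hc (sel_mean N loc s) - sel_hc N loc s / N)\<^sup>2 = 0"
    using c by (simp add: sel_obj_eq[OF assms(1)])
  moreover have "2 * sel_size N s * (mc (sel_mean N loc s) - sel_mc N loc s / sel_size N s)\<^sup>2 \<ge> 0"
    "2 * real N * (hc (sel_mean N loc s) - sel_hc N loc s / N)\<^sup>2 \<ge> 0" using pos by auto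
  ultimately have "2 * sel_size N s * (mc (sel_mean N loc s) - sel_mc N loc s / sel_size N s)\<^sup>2 = 0"
     "2 * real N * (hc (sel_mean N loc s) - sel_hc N loc s / N)\<^sup>2 = 0" by linarith+
  then show "mc (sel_mean N loc s) = sel_mc N loc s / sel_size N s"
    "hc (sel_mean N loc s) = sel_hc N loc s / N"
    using pos assms(1) by auto
qed

section \<open>Finiteness of groupings and double counting over labels\<close>

lemma finite_selections:
  assumes "\<And>i. i < N \<Longrightarrow> finite (L i)"
  shows "finite {s. is_selection N L s}"
proof -
  have "{s. is_selection N L s} \<subseteq>
      (\<lambda>f i. if i < N then f i else None) ` (\<Pi>\<^sub>E i\<in>{..<N}. insert None (Some ` L i))"
  proof
    fix s assume "s \<in> {s. is_selection N L s}"
    then show "s \<in> (\<lambda>f i. if i < N then f i else None) ` (\<Pi>\<^sub>E i\<in>{..<N}. insert None (Some ` L i))"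
      by (intro image_eqI[of _ _ "restrict s {..<N}"] restrict_PiE_iff[THEN iffD2])
        (auto simp: is_selection_def fun_eq_iff restrict_def)
  qed
  then show ?thesis by (rule finite_subset) (use assms in \<open>auto intro!: finite_PiE\<close>)
qed

lemma grouping_subset: "is_grouping N L G \<Longrightarrow> G \<subseteq> {s. is_selection N L s}"
  by (auto simp: is_grouping_def)

lemma finite_grouping:
  assumes "\<And>i. i < N \<Longrightarrow> finite (L i)" "is_grouping N L G"
  shows "finite G"
  using finite_selections[OF assms(1)] grouping_subset[OF assms(2)] by (rule rev_finite_subset)

lemma finite_groupings:
  assumes "\<And>i. i < N \<Longrightarrow> finite (L i)"
  shows "finite {G. is_grouping N L G}"
  by (rule finite_subset[of _ "Pow {s. is_selection N L s}"])
    (use finite_selections[of N L] assms grouping_subset[of N L] in auto)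

lemma groupingD:
  assumes "is_grouping N L G" "s \<in> G"
  shows "is_selection N L s" "s \<noteq> (\<lambda>_. None)"
  using assms by (auto simp: is_grouping_def)

lemma grouping_unique:
  assumes "is_grouping N L G" "s \<in> G" "t \<in> G" "i < N" "s i = Some l" "t i = Some l"
  shows "s = t"
proof -
  have "l \<in> L i" using groupingD(1)[OF assms(1,2)] assms(4,5) by (auto simp: is_selection_def)
  then have "\<exists>!s. s \<in> G \<and> s i = Some l" using assms by (auto simp: is_grouping_def)
  then show ?thesis using assms by auto
qed

lemma grouping_ex:
  assumes "is_grouping N L G" "i < N" "l \<in> L i"
  obtains s where "s \<in> G" "s i = Some l"
  using assms by (auto simp: is_grouping_def) blast

text \<open>A selection of \<open>G'\<close> contains some label, and the selection of
  \<open>G\<close> with that label is also in \<open>G'\<close>, hence equal to it. So of two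
  distinct groupings each has a selection that the other lacks.\<close>

lemma grouping_subset_eq:
  assumes "is_grouping N L G" "is_grouping N L G'" "G \<subseteq> G'"
  shows "G = G'"
proof (rule antisym[OF assms(3)], rule subsetI)
  fix t assume t: "t \<in> G'"
  obtain i l where il: "i < N" "l \<in> L i" "t i = Some l"
    using selection_nonempty[OF groupingD[OF assms(2) t]] .
  obtain s where s: "s \<in> G" "s i = Some l" using grouping_ex[OF assms(1) il(1,2)] .
  then have "s = t" using grouping_unique[OF assms(2) _ t il(1)] il s assms(3) by auto
  with s show "t \<in> G" by simp
qed

lemma grouping_bij:
  assumes "is_grouping N L G" "i < N"
  shows "bij_betw (\<lambda>s. the (s i)) {s\<in>G. s i \<noteq> None} (L i)"
  unfolding bij_betw_def
proof
  show "inj_on (\<lambda>s. the (s i)) {s\<in>G. s i \<noteq> None}"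
    using grouping_unique[OF assms(1) _ _ assms(2)] by (auto simp: inj_on_def)
  have "the (s i) \<in> L i" if "s \<in> G" "s i \<noteq> None" for s
    using groupingD(1)[OF assms(1) that(1)] assms(2) that by (auto simp: is_selection_def)
  moreover have "l \<in> (\<lambda>s. the (s i)) ` {s\<in>G. s i \<noteq> None}" if "l \<in> L i" for l
    by (rule grouping_ex[OF assms(1,2) that]) (auto intro: rev_image_eqI)
  ultimately show "(\<lambda>s. the (s i)) ` {s \<in> G. s i \<noteq> None} = L i" by auto
qed

text \<open>Double counting, each label lying in exactly one selection. It makes the sum of squares
  in the cost independent of the grouping, and later adds the displacements of the single means up
  to a total over the points.\<close>

lemma grouping_sum:
  assumes "\<And>i. i < N \<Longrightarrow> finite (L i)" "is_grouping N L G"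
  shows "(\<Sum>s\<in>G. sel_sum N F s) = (\<Sum>i<N. \<Sum>l\<in>L i. F i l)"
proof -
  have "(\<Sum>s\<in>G. sel_sum N F s) = (\<Sum>i<N. \<Sum>s\<in>G. case s i of None \<Rightarrow> 0 | Some l \<Rightarrow> F i l)"
    unfolding sel_sum_def by (rule sum.swap)
  also have "\<dots> = (\<Sum>i<N. \<Sum>l\<in>L i. F i l)"
  proof (rule sum.cong[OF refl])
    fix i assume i: "i \<in> {..<N}"
    have "(\<Sum>s\<in>G. case s i of None \<Rightarrow> 0 | Some l \<Rightarrow> F i l) = (\<Sum>s\<in>{s\<in>G. s i \<noteq> None}. F i (the (s i)))"
      by (rule sum.mono_neutral_cong_right) (use finite_grouping[OF assms] in auto)
    also have "\<dots> = (\<Sum>l\<in>L i. F i l)"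
      using i grouping_bij[OF assms(2), of i] by (intro sum.reindex_bij_betw) auto
    finally show "(\<Sum>s\<in>G. case s i of None \<Rightarrow> 0 | Some l \<Rightarrow> F i l) = (\<Sum>l\<in>L i. F i l)" .
  qed
  finally show ?thesis .
qed

text \<open>Every selection of a grouping contains at least one label. This is the source of the
  bound \<open>N * K\<close> on the number of points of a mean.\<close>

lemma card_grouping_le:
  assumes "\<And>i. i < N \<Longrightarrow> finite (L i)" "is_grouping N L G"
  shows "card G \<le> (\<Sum>i<N. card (L i))"
proof -
  have "real (card G) = (\<Sum>s\<in>G. 1)" by simp
  also have "\<dots> \<le> (\<Sum>s\<in>G. sel_size N s)"
  proof (rule sum_mono)
    fix s assume "s \<in> G"
    from selection_nonempty[OF groupingD[OF assms(2) this]] show "1 \<le> sel_size N s"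
      by (metis option.distinct(1) sel_size_ge1)
  qed
  also have "\<dots> = real (\<Sum>i<N. card (L i))" by (simp add: grouping_sum[OF assms])
  finally show ?thesis by linarith
qed

lemma sel_obj_nonneg: "sel_obj N loc s z \<ge> 0"
  unfolding sel_obj_def by (intro sum_nonneg) auto

text \<open>The selections index a matching of the mean with each diagram: mean(s) goes to the entry
  of \<open>s\<close>, or to its own projection if that entry is \<Delta>. Other matchings may be
  cheaper, so this is only an upper bound.\<close>

lemma frechet_fun_grouping_mean_le:
  assumes "N \<ge> 1" "\<And>i. i < N \<Longrightarrow> finite (L i)" "is_grouping N L G"
  shows "frechet_fun N (\<lambda>i. mk_diagram (L i) (loc i)) (grouping_mean N loc G) \<le> ennreal (grouping_cost N loc G)"
proof -
  note finG = finite_grouping[OF assms(2,3)]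
  define g where "g i s = (case s i of None \<Rightarrow> diag_proj (sel_mean N loc s) | Some l \<Rightarrow> loc i l)" for i s
  have eq: "mk_diagram (L i) (loc i) = mk_diagram G (g i)" if i: "i < N" for i
  proof -
    have "mk_diagram {s\<in>G. s i \<noteq> None} (g i) = mk_diagram (L i) (loc i)"
      by (rule mk_diagram_reindex[where h = "\<lambda>s. the (s i)"])
        (use grouping_bij[OF assms(3) i] in \<open>auto simp: bij_betw_def g_def\<close>)
    moreover have "mk_diagram {s\<in>G. s i \<noteq> None} (g i) = mk_diagram G (g i)"
      by (rule mk_diagram_reindex[where h = "\<lambda>s. s"]) (auto simp: g_def)
    ultimately show ?thesis by simp
  qed
  have "frechet_fun N (\<lambda>i. mk_diagram (L i) (loc i)) (grouping_mean N loc G)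
     = (\<Sum>i<N. (W2 (mk_diagram G (sel_mean N loc)) (mk_diagram G (g i)))\<^sup>2)"
    unfolding frechet_fun_def grouping_mean_def by (rule sum.cong) (auto simp: eq)
  also have "\<dots> \<le> (\<Sum>i<N. \<Sum>s\<in>G. ennreal ((norm (sel_mean N loc s - g i s))\<^sup>2))"
    by (intro sum_mono W2_mk_diagram_le finG)
  also have "\<dots> = (\<Sum>s\<in>G. \<Sum>i<N. ennreal ((norm (sel_mean N loc s - g i s))\<^sup>2))"
    by (rule sum.swap)
  also have "\<dots> = (\<Sum>s\<in>G. ennreal (sel_cost N loc s))"
  proof (rule sum.cong[OF refl])
    fix s assume s: "s \<in> G"
    have "(\<Sum>i<N. ennreal ((norm (sel_mean N loc s - g i s))\<^sup>2)) = ennreal (\<Sum>i<N. (norm (sel_mean N loc s - g i s))\<^sup>2)"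
      by (simp add: sum_ennreal)
    also have "(\<Sum>i<N. (norm (sel_mean N loc s - g i s))\<^sup>2) = sel_obj N loc s (sel_mean N loc s)"
      unfolding sel_obj_def by (intro sum.cong) (auto simp: g_def infdist_diag split: option.splits)
    finally show "(\<Sum>i<N. ennreal ((norm (sel_mean N loc s - g i s))\<^sup>2)) = ennreal (sel_cost N loc s)"
      using sel_mean_eq(3)[OF assms(1) groupingD[OF assms(3) s]] by simp
  qed
  also have "\<dots> = ennreal (grouping_cost N loc G)"
    unfolding grouping_cost_def
    by (rule sum_ennreal) (metis sel_mean_eq(3)[OF assms(1) groupingD[OF assms(3)]] sel_obj_nonneg)
  finally show ?thesis .
qed

section \<open>Optimal groupings minimize the cost\<close>

lemma finite_sum_le_infsum_ennreal:
  fixes f :: "'a \<Rightarrow> ennreal"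
  assumes "finite F" "F \<subseteq> A"
  shows "sum f F \<le> infsum f A"
proof -
  have "infsum f F \<le> infsum f A"
    by (rule infsum_mono_neutral) (use assms in \<open>auto intro: nonneg_summable_on_complete\<close>)
  then show ?thesis using assms by simp
qed

text \<open>The \<open>N\<close> partners of a point \<open>z\<close> under matchings of
  \<open>Z\<close> with the data, diagonal partners being read as \<Delta>, form a selection
  \<open>sel z\<close>. The number \<open>c\<close> stands for the total matching cost; it is
  compared with finite partial sums, since \<open>pts Z\<close> is infinite.\<close>

definition induces_grouping ::
    "nat \<Rightarrow> (nat \<Rightarrow> 'l set) \<Rightarrow> (nat \<Rightarrow> 'l \<Rightarrow> point) \<Rightarrow> diagram \<Rightarrow> ennreal \<Rightarrow> (dpoint \<Rightarrow> 'l selection) \<Rightarrow> bool" where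
  "induces_grouping N L loc Z c sel \<longleftrightarrow> (\<forall>z\<in>pts Z. is_selection N L (sel z)) \<and>
    is_grouping N L (sel ` pts Z - {\<lambda>_. None}) \<and>
    inj_on sel {z \<in> pts Z. sel z \<noteq> (\<lambda>_. None)} \<and>
    (\<forall>F. finite F \<longrightarrow> F \<subseteq> pts Z \<longrightarrow> (\<Sum>z\<in>F. ennreal (sel_obj N loc (sel z) (fst z))) \<le> c)"

lemma induces_groupingD:
  assumes "induces_grouping N L loc Z c sel"
  shows "\<And>z. z \<in> pts Z \<Longrightarrow> is_selection N L (sel z)"
    and "is_grouping N L (sel ` pts Z - {\<lambda>_. None})"
    and "inj_on sel {z \<in> pts Z. sel z \<noteq> (\<lambda>_. None)}"
    and "\<And>F. finite F \<Longrightarrow> F \<subseteq> pts Z \<Longrightarrow> (\<Sum>z\<in>F. ennreal (sel_obj N loc (sel z) (fst z))) \<le> c"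
  using assms unfolding induces_grouping_def by blast+

text \<open>Each matching, being bijective, sends exactly one point of \<open>Z\<close> to each
  label, so the nonempty selections form a grouping and determine their points. A diagonal partner
  is never nearer than the diagonal itself, so the matchings cost at least
  \<open>sel_obj\<close>.\<close>

lemma induced_grouping:
  assumes fin: "\<And>i. i < N \<Longrightarrow> finite (L i)"
    and off: "\<And>i l. i < N \<Longrightarrow> l \<in> L i \<Longrightarrow> loc i l \<notin> diag"
    and match: "\<And>i. i < N \<Longrightarrow> matching Z (mk_diagram (L i) (loc i)) (\<phi> i)"
  shows "\<exists>sel. induces_grouping N L loc Z (\<Sum>i<N. (matching_cost Z (\<phi> i))\<^sup>2) sel"
proof -
  let ?D = "\<lambda>i. mk_diagram (L i) (loc i)"
  have "\<exists>b. bij_betw b (offpts (?D i)) (L i) \<and> (\<forall>x\<in>offpts (?D i). loc i (b x) = fst x)" if "i < N" for i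
    using offpts_mk_diagram_bij[OF fin[OF that], of "loc i"] off[OF that] by auto
  then obtain b where b: "\<And>i. i < N \<Longrightarrow> bij_betw (b i) (offpts (?D i)) (L i)"
    "\<And>i x. i < N \<Longrightarrow> x \<in> offpts (?D i) \<Longrightarrow> loc i (b i x) = fst x"
    by metis
  define sel where "sel z = (\<lambda>i. if i < N \<and> fst (\<phi> i z) \<notin> diag then Some (b i (\<phi> i z)) else None)" for z
  have off_phi: "\<phi> i z \<in> offpts (?D i)" if "i < N" "z \<in> pts Z" "fst (\<phi> i z) \<notin> diag" for i z
    using match[OF that(1)] that by (auto simp: matching_def offpts_def bij_betw_def)
  have sel: "is_selection N L (sel z)" if "z \<in> pts Z" for z
    using off_phi[OF _ that] b(1) by (auto simp: is_selection_def sel_def bij_betw_def intro!: imageI)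
  have uniq: "z = z'" if "z \<in> pts Z" "z' \<in> pts Z" "i < N" "sel z i = Some l" "sel z' i = Some l" for z z' i l
  proof -
    have "fst (\<phi> i z) \<notin> diag" "fst (\<phi> i z') \<notin> diag" "b i (\<phi> i z) = b i (\<phi> i z')"
      using that by (auto simp: sel_def split: if_splits)
    then have "\<phi> i z = \<phi> i z'"
      using off_phi that b(1)[OF that(3)] by (meson bij_betw_imp_inj_on inj_onD)
    then show ?thesis using match[OF that(3)] that(1,2) by (auto simp: matching_def bij_betw_def inj_on_def)
  qed
  have "\<exists>!s. s \<in> sel ` pts Z - {\<lambda>_. None} \<and> s i = Some l" if il: "i < N" "l \<in> L i" for i l
  proof -
    obtain y where y: "y \<in> offpts (?D i)" "b i y = l"
      using b(1)[OF il(1)] il(2) unfolding bij_betw_def by (metis imageE)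
    then have "y \<in> \<phi> i ` pts Z"
      using match[OF il(1)] by (simp add: matching_def offpts_def bij_betw_imp_surj_on)
    then obtain z where z: "z \<in> pts Z" "\<phi> i z = y" by blast
    have "sel z i = Some l" using y z il by (auto simp: sel_def offpts_def)
    show ?thesis
    proof (rule ex1I[of _ "sel z"])
      show "sel z \<in> sel ` pts Z - {\<lambda>_. None} \<and> sel z i = Some l"
        using z \<open>sel z i = Some l\<close> by auto
      fix s assume "s \<in> sel ` pts Z - {\<lambda>_. None} \<and> s i = Some l"
      then obtain z' where "z' \<in> pts Z" "s = sel z'" "sel z' i = Some l" by blast
      then show "s = sel z" using uniq[OF _ z(1) il(1) _ \<open>sel z i = Some l\<close>] by blast
    qed
  qed
  then have grp: "is_grouping N L (sel ` pts Z - {\<lambda>_. None})"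
    using sel by (auto simp: is_grouping_def)
  have inj: "inj_on sel {z \<in> pts Z. sel z \<noteq> (\<lambda>_. None)}"
  proof (rule inj_onI, clarify)
    fix p k p' k' assume *: "(p, k) \<in> pts Z" "sel (p, k) \<noteq> (\<lambda>_. None)" "(p', k') \<in> pts Z" "sel (p, k) = sel (p', k')"
    obtain i l where "i < N" "sel (p, k) i = Some l"
      using selection_nonempty[OF sel[OF *(1)] *(2)] .
    then show "p = p' \<and> k = k'" using uniq[OF *(1,3)] * by auto
  qed
  have "(\<Sum>z\<in>F. ennreal (sel_obj N loc (sel z) (fst z))) \<le> (\<Sum>i<N. (matching_cost Z (\<phi> i))\<^sup>2)"
    if F: "finite F" "F \<subseteq> pts Z" for F
  proof -
    have "(\<Sum>z\<in>F. ennreal (sel_obj N loc (sel z) (fst z)))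
       \<le> (\<Sum>z\<in>F. \<Sum>i<N. ennreal ((norm (fst z - fst (\<phi> i z)))\<^sup>2))"
    proof (rule sum_mono)
      fix z assume "z \<in> F"
      then have z: "z \<in> pts Z" using F by auto
      have "sel_obj N loc (sel z) (fst z) \<le> (\<Sum>i<N. (norm (fst z - fst (\<phi> i z)))\<^sup>2)"
        unfolding sel_obj_def
      proof (intro sum_mono power_mono)
        fix i assume "i \<in> {..<N}"
        then show "(case sel z i of None \<Rightarrow> infdist (fst z) diag | Some l \<Rightarrow> norm (fst z - loc i l))
               \<le> norm (fst z - fst (\<phi> i z))"
          using b(2)[OF _ off_phi, of i z] z by (auto simp: sel_def infdist_diag_le)
      qed (auto split: option.splits simp: infdist_nonneg)
      then have "ennreal (sel_obj N loc (sel z) (fst z)) \<le> ennreal (\<Sum>i<N. (norm (fst z - fst (\<phi> i z)))\<^sup>2)"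
        by (rule ennreal_leI)
      then show "ennreal (sel_obj N loc (sel z) (fst z)) \<le> (\<Sum>i<N. ennreal ((norm (fst z - fst (\<phi> i z)))\<^sup>2))"
        by (simp add: sum_ennreal)
    qed
    also have "\<dots> = (\<Sum>i<N. \<Sum>z\<in>F. ennreal ((norm (fst z - fst (\<phi> i z)))\<^sup>2))" by (rule sum.swap)
    also have "\<dots> \<le> (\<Sum>i<N. (matching_cost Z (\<phi> i))\<^sup>2)"
      unfolding matching_cost_def esqrt_sq by (intro sum_mono finite_sum_le_infsum_ennreal F)
    finally show ?thesis .
  qed
  with sel grp inj have "induces_grouping N L loc Z (\<Sum>i<N. (matching_cost Z (\<phi> i))\<^sup>2) sel"
    unfolding induces_grouping_def by blast
  then show ?thesis by (rule exI[of _ sel])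
qed

lemma sel_sum_empty [simp]: "sel_sum N F (\<lambda>_. None) = 0"
  by (simp add: sel_sum_def)

lemma sel_cost_empty [simp]: "sel_cost N loc (\<lambda>_. None) = 0"
  by (simp add: sel_cost_def)

text \<open>The position square is dropped and the height square kept: it supplies the gap when a
  point serves a selection other than its own.\<close>

lemma sel_cost_le_obj: "N \<ge> 1 \<Longrightarrow> sel_cost N loc s + 2 * real N * (hc z - sel_hc N loc s / N)\<^sup>2 \<le> sel_obj N loc s z"
  by (simp add: sel_obj_eq sel_sum_nonneg)

lemma sel_cost_le_obj': "N \<ge> 1 \<Longrightarrow> sel_cost N loc s \<le> sel_obj N loc s z"
  by (rule order_trans[OF _ sel_cost_le_obj]) auto

context
  fixes N :: nat and L :: "nat \<Rightarrow> 'l set" and loc :: "nat \<Rightarrow> 'l \<Rightarrow> point"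
  assumes N: "N \<ge> 1" and fin: "\<And>i. i < N \<Longrightarrow> finite (L i)"
    and off: "\<And>i l. i < N \<Longrightarrow> l \<in> L i \<Longrightarrow> loc i l \<notin> diag"
begin

abbreviation "frechet \<equiv> frechet_fun N (\<lambda>i. mk_diagram (L i) (loc i))"

text \<open>A nonempty selection determines its point and a grouping is finite, so only finitely
  many points of \<open>Z\<close> carry one.\<close>

lemma induced_grouping_cost:
  assumes grp: "is_grouping N L (sel ` pts Z - {\<lambda>_. None})" and inj: "inj_on sel {z \<in> pts Z. sel z \<noteq> (\<lambda>_. None)}"
  shows "finite {z \<in> pts Z. sel z \<noteq> (\<lambda>_. None)}"
    and "(\<Sum>z | z \<in> pts Z \<and> sel z \<noteq> (\<lambda>_. None). sel_cost N loc (sel z)) =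
         grouping_cost N loc (sel ` pts Z - {\<lambda>_. None})"
proof -
  let ?P = "{z \<in> pts Z. sel z \<noteq> (\<lambda>_. None)}"
  have eq: "sel ` ?P = sel ` pts Z - {\<lambda>_. None}" by auto
  show "finite ?P"
    using finite_grouping[OF fin grp] inj unfolding eq[symmetric] by (simp add: finite_image_iff)
  show "(\<Sum>z\<in>?P. sel_cost N loc (sel z)) = grouping_cost N loc (sel ` pts Z - {\<lambda>_. None})"
    unfolding grouping_cost_def eq[symmetric] by (simp add: sum.reindex[OF inj])
qed

text \<open>\<open>Z\<close> ranges over all diagrams and not only over means: whatever the
  matchings, they induce a grouping, and its cost is at least \<open>c\<close>.\<close>

lemma le_frechet_fun:
  assumes c: "\<And>G. is_grouping N L G \<Longrightarrow> c \<le> grouping_cost N loc G"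
  shows "ennreal c \<le> frechet Z"
proof (rule le_sum_W2_sqI)
  fix \<phi> assume match: "\<And>i. i < N \<Longrightarrow> matching Z (mk_diagram (L i) (loc i)) (\<phi> i)"
  obtain sel where "induces_grouping N L loc Z (\<Sum>i<N. (matching_cost Z (\<phi> i))\<^sup>2) sel"
    using induced_grouping[of N L loc Z \<phi>] fin off match by auto
  note sel = induces_groupingD[OF this]
  define P where "P = {z \<in> pts Z. sel z \<noteq> (\<lambda>_. None)}"
  note cost = induced_grouping_cost[OF sel(2,3), folded P_def]
  have "c \<le> (\<Sum>z\<in>P. sel_cost N loc (sel z))" using c[OF sel(2)] cost by simp
  also have "\<dots> \<le> (\<Sum>z\<in>P. sel_obj N loc (sel z) (fst z))" by (intro sum_mono sel_cost_le_obj'[OF N])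
  finally have "ennreal c \<le> ennreal (\<Sum>z\<in>P. sel_obj N loc (sel z) (fst z))" by (rule ennreal_leI)
  also have "\<dots> = (\<Sum>z\<in>P. ennreal (sel_obj N loc (sel z) (fst z)))" by (simp add: sum_ennreal sel_obj_nonneg)
  also have "\<dots> \<le> (\<Sum>i<N. (matching_cost Z (\<phi> i))\<^sup>2)" by (rule sel(4)) (auto simp: cost(1) P_def[symmetric], auto simp: P_def)
  finally show "ennreal c \<le> (\<Sum>i<N. (matching_cost Z (\<phi> i))\<^sup>2)" .
qed

text \<open>A selection \<open>t \<noteq> s\<close> can only be served by the point \<open>mean(s)\<close> at an extra
  cost of at least the gap \<open>d\<close>, so a matching of \<open>mean(G)\<close> with the data that does better than the
  optimum by less than \<open>d\<close> induces the grouping \<open>G\<close> itself.\<close>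

lemma le_frechet_fun_grouping_mean:
  assumes gap: "\<And>s t. is_selection N L s \<Longrightarrow> is_selection N L t \<Longrightarrow> s \<noteq> t \<Longrightarrow>
     d \<le> 2 * real N * (sel_hc N loc s / N - sel_hc N loc t / N)\<^sup>2" and d: "d > 0"
    and c: "\<And>G. is_grouping N L G \<Longrightarrow> c \<le> grouping_cost N loc G"
    and G: "is_grouping N L G"
  shows "ennreal (min (grouping_cost N loc G) (c + d)) \<le> frechet (grouping_mean N loc G)"
proof (rule le_sum_W2_sqI)
  fix \<phi> assume "\<And>i. i < N \<Longrightarrow> matching (grouping_mean N loc G) (mk_diagram (L i) (loc i)) (\<phi> i)"
  moreover define Z where "Z = grouping_mean N loc G"
  ultimately have match: "\<And>i. i < N \<Longrightarrow> matching Z (mk_diagram (L i) (loc i)) (\<phi> i)" by simp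
  note finG = finite_grouping[OF fin G]
  obtain sel where "induces_grouping N L loc Z (\<Sum>i<N. (matching_cost Z (\<phi> i))\<^sup>2) sel"
    using induced_grouping[of N L loc Z \<phi>] fin off match by auto
  note sel = induces_groupingD[OF this]
  define P where "P = {z \<in> pts Z. sel z \<noteq> (\<lambda>_. None)}"
  note cost = induced_grouping_cost[OF sel(2,3), folded P_def]
  \<comment> \<open>The copy with number 0 of each mean. Selections with equal means share it, but
    then \<open>sel (q s) = s\<close> fails for one of them.\<close>
  define q where "q s = (sel_mean N loc s, 0::nat)" for s
  have q: "q s \<in> pts Z" if "s \<in> G" for s
    using that finG
    by (auto simp: q_def pts_def Z_def grouping_mean_def mk_diagram_def zero_enat_def card_gt_0_iff)
  note mean = sel_mean_eq[OF N groupingD[OF G]]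
  have "\<exists>F. finite F \<and> F \<subseteq> pts Z \<and>
     min (grouping_cost N loc G) (c + d) \<le> (\<Sum>z\<in>F. sel_obj N loc (sel z) (fst z))"
  \<comment> \<open>Either every mean serves its own selection and the matchings pay for all of
    \<open>G\<close>, or some mean serves another selection and the matchings pay the gap on top of
    the cost of a grouping.\<close>
  proof (cases "\<forall>s\<in>G. sel (q s) = s")
    case True
    have inj: "inj_on q G" by (rule inj_on_inverseI[of _ sel]) (use True in auto)
    have "grouping_cost N loc G = (\<Sum>s\<in>G. sel_obj N loc (sel (q s)) (fst (q s)))"
      unfolding grouping_cost_def by (rule sum.cong) (use mean(3) True in \<open>auto simp: q_def\<close>)
    also have "\<dots> = (\<Sum>z\<in>q ` G. sel_obj N loc (sel z) (fst z))"
      by (simp add: sum.reindex[OF inj])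
    finally show ?thesis using finG q by (intro exI[of _ "q ` G"]) auto
  next
    case False
    then obtain s where s: "s \<in> G" "sel (q s) \<noteq> s" by auto
    have "c + d \<le> (\<Sum>z\<in>P. sel_cost N loc (sel z)) +
          2 * real N * (sel_hc N loc s / N - sel_hc N loc (sel (q s)) / N)\<^sup>2"
      using c[OF sel(2)] cost(2) gap[of s "sel (q s)"] s sel(1)[OF q[OF s(1)]] groupingD(1)[OF G s(1)]
      by (simp add: add_mono)
    \<comment> \<open>\<open>q s\<close> may carry the all-\<Delta> selection and so lie outside
      \<open>P\<close>; adding it is free because that selection has cost 0.\<close>
    also have "(\<Sum>z\<in>P. sel_cost N loc (sel z)) = (\<Sum>z\<in>insert (q s) P. sel_cost N loc (sel z))"
      by (rule sum.mono_neutral_left) (use cost(1) q[OF s(1)] in \<open>auto simp: P_def\<close>)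
    also have "\<dots> + 2 * real N * (sel_hc N loc s / N - sel_hc N loc (sel (q s)) / N)\<^sup>2 =
       (\<Sum>z\<in>insert (q s) P. sel_cost N loc (sel z) +
         (if z = q s then 2 * real N * (hc (fst z) - sel_hc N loc (sel z) / N)\<^sup>2 else 0))"
      using cost(1) mean(2)[OF s(1) s(1)] by (simp add: sum.distrib sum.delta q_def)
    also have "\<dots> \<le> (\<Sum>z\<in>insert (q s) P. sel_obj N loc (sel z) (fst z))"
      by (rule sum_mono) (auto simp: sel_cost_le_obj[OF N] sel_cost_le_obj'[OF N])
    finally show ?thesis using cost(1) q[OF s(1)] by (intro exI[of _ "insert (q s) P"]) (auto simp: P_def)
  qed
  then obtain F where F: "finite F" "F \<subseteq> pts Z"
     "min (grouping_cost N loc G) (c + d) \<le> (\<Sum>z\<in>F. sel_obj N loc (sel z) (fst z))" by auto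
  have "ennreal (min (grouping_cost N loc G) (c + d)) \<le> ennreal (\<Sum>z\<in>F. sel_obj N loc (sel z) (fst z))"
    using F(3) by (rule ennreal_leI)
  also have "\<dots> = (\<Sum>z\<in>F. ennreal (sel_obj N loc (sel z) (fst z)))" by (simp add: sum_ennreal sel_obj_nonneg)
  also have "\<dots> \<le> (\<Sum>i<N. (matching_cost Z (\<phi> i))\<^sup>2)" by (rule sel(4)[OF F(1,2)])
  finally show "ennreal (min (grouping_cost N loc G) (c + d)) \<le>
      (\<Sum>i<N. (matching_cost (grouping_mean N loc G) (\<phi> i))\<^sup>2)" by (simp add: Z_def)
qed

lemma sel_hc_nonneg:
  assumes "\<And>i l. i < N \<Longrightarrow> l \<in> L i \<Longrightarrow> hc (loc i l) \<ge> 0" "is_selection N L s"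
  shows "sel_hc N loc s \<ge> 0"
  using assms by (intro sel_sum_nonneg) (auto simp: is_selection_def)

lemma grouping_mean_in_diagrams:
  assumes hc: "\<And>i l. i < N \<Longrightarrow> l \<in> L i \<Longrightarrow> hc (loc i l) \<ge> 0" and G: "is_grouping N L G"
  shows "grouping_mean N loc G \<in> diagrams"
  unfolding grouping_mean_def
  by (rule mk_diagram_in_diagrams[OF finite_grouping[OF fin G]])
    (use sel_mean_eq(2)[OF N groupingD[OF G]] sel_hc_nonneg[OF hc groupingD(1)[OF G]] in auto)

lemma W2_mk_diagram_empty: "finite I \<Longrightarrow> W2 (mk_diagram I f) empty_diagram < \<infinity>"
proof -
  assume I: "finite I"
  have "mk_diagram I (\<lambda>i. diag_proj (f i)) = empty_diagram"
    by (auto simp: mk_diagram_def empty_diagram_def fun_eq_iff zero_enat_def card_eq_0_iff)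
      (metis diag_proj_in_diag)
  with W2_mk_diagram_le[OF I, of f "\<lambda>i. diag_proj (f i)"]
  have "(W2 (mk_diagram I f) empty_diagram)\<^sup>2 \<le> (\<Sum>i\<in>I. ennreal ((norm (f i - diag_proj (f i)))\<^sup>2))" by simp
  also have "\<dots> < top" using I by (simp add: less_top)
  finally show ?thesis by (simp add: power_less_top_ennreal)
qed

text \<open>The mean of \<open>G0\<close> attains the lower bound valid for all diagrams.
  Conversely, the Frechet value of an optimal \<open>G\<close> is at most the cost of
  \<open>G0\<close>, and at least the smaller of the cost of \<open>G\<close> and the cost of
  \<open>G0\<close> plus the gap; so \<open>G\<close> is as cheap as \<open>G0\<close>.\<close>

lemma optimal_grouping_iff:
  assumes hc: "\<And>i l. i < N \<Longrightarrow> l \<in> L i \<Longrightarrow> hc (loc i l) > 0"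
    and generic: "\<And>s t. is_selection N L s \<Longrightarrow> is_selection N L t \<Longrightarrow> s \<noteq> t \<Longrightarrow> sel_hc N loc s \<noteq> sel_hc N loc t"
    and G0: "is_grouping N L G0"
    and min: "\<And>G. is_grouping N L G \<Longrightarrow> G \<noteq> G0 \<Longrightarrow> grouping_cost N loc G0 < grouping_cost N loc G"
  shows "optimal_grouping N L loc G \<longleftrightarrow> G = G0"
proof -
  let ?S = "{s. is_selection N L s}"
  let ?c = "grouping_cost N loc G0"
  define gap where "gap = (\<lambda>(s, t). 2 * real N * (sel_hc N loc s / N - sel_hc N loc t / N)\<^sup>2)"
  \<comment> \<open>The element 1 keeps the set nonempty when there is only one selection, and its
    minimum positive.\<close>
  define B where "B = insert 1 (gap ` {(s, t) \<in> ?S \<times> ?S. s \<noteq> t})"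
  have "finite (?S \<times> ?S)" using finite_selections[OF fin] by simp
  then have finB: "finite B" unfolding B_def by (auto intro: rev_finite_subset)
  define d where "d = Min B"
  have "d \<in> B" unfolding d_def by (rule Min_in[OF finB]) (auto simp: B_def)
  then have d: "d > 0" using generic N by (auto simp: B_def gap_def zero_less_power2)
  have gap: "d \<le> 2 * real N * (sel_hc N loc s / N - sel_hc N loc t / N)\<^sup>2"
    if "is_selection N L s" "is_selection N L t" "s \<noteq> t" for s t
    unfolding d_def using that by (intro Min_le[OF finB]) (force simp: B_def gap_def)
  have min': "?c \<le> grouping_cost N loc G" if "is_grouping N L G" for G
    using min[OF that] by (cases "G = G0") auto
  have c0: "?c \<ge> 0" unfolding grouping_cost_def
    by (intro sum_nonneg) (metis sel_mean_eq(3)[OF N groupingD[OF G0]] sel_obj_nonneg)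
  have hc': "\<And>i l. i < N \<Longrightarrow> l \<in> L i \<Longrightarrow> hc (loc i l) \<ge> 0" using hc by (simp add: less_imp_le)
  have adm: "grouping_mean N loc G \<in> diagrams \<and> W2 (grouping_mean N loc G) empty_diagram < \<infinity>"
    if "is_grouping N L G" for G
    using grouping_mean_in_diagrams[OF hc' that] W2_mk_diagram_empty[OF finite_grouping[OF fin that]]
    by (simp add: grouping_mean_def)
  have le: "frechet (grouping_mean N loc G0) \<le> ennreal ?c"
    by (rule frechet_fun_grouping_mean_le[OF N fin G0])
  show ?thesis
  proof
    assume "G = G0"
    moreover have "\<not> frechet Z < frechet (grouping_mean N loc G0)" for Z
      using le_frechet_fun[OF min', of Z] le by auto
    ultimately show "optimal_grouping N L loc G"
      using adm[OF G0] G0 by (auto simp: optimal_grouping_def is_arg_min_def)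
  next
    assume "optimal_grouping N L loc G"
    then have G: "is_grouping N L G" and "\<not> frechet (grouping_mean N loc G0) < frechet (grouping_mean N loc G)"
      using adm[OF G0] by (auto simp: optimal_grouping_def is_arg_min_def)
    then have "frechet (grouping_mean N loc G) \<le> ennreal ?c" using le by simp
    with le_frechet_fun_grouping_mean[OF gap d min' G]
    have "ennreal (min (grouping_cost N loc G) (?c + d)) \<le> ennreal ?c" by (rule order_trans)
    then have "min (grouping_cost N loc G) (?c + d) \<le> ?c"
      using c0 by (simp add: ennreal_le_iff)
    then show "G = G0" using d min[OF G] by (cases "G = G0") (auto simp: min_def split: if_splits)
  qed
qed

end

section \<open>Perturbation measures\<close>

text \<open>Fubini in the coordinates along and across the diagonal: the preimage of
  \<open>S\<close> under the linear map \<open>T\<close> has finite fibres and is therefore null,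
  and linear maps of the plane preserve null sets.\<close>

lemma planar_null_set:
  assumes S: "S \<in> sets (borel :: point measure)"
    and fin: "\<And>m. finite {h. (m - h, m + h) \<in> S}"
  shows "emeasure lborel S = 0"
proof -
  define T where "T = (\<lambda>(m, h). (m - h, m + h) :: point)"
  define S' where "S' = T -` S"
  have cT: "continuous_on UNIV T" unfolding T_def case_prod_unfold by (intro continuous_intros)
  then have "T \<in> borel_measurable borel" by (rule borel_measurable_continuous_onI)
  then have S': "S' \<in> sets borel" using S unfolding S'_def
    by (metis measurable_sets_borel)
  then have S'2: "S' \<in> sets (lborel \<Otimes>\<^sub>M lborel)" by (metis lborel_prod sets_lborel)
  have "emeasure lborel S' = emeasure (lborel \<Otimes>\<^sub>M lborel) S'" by (simp add: lborel_prod)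
  also have "\<dots> = (\<integral>\<^sup>+ m. emeasure lborel (Pair m -` S') \<partial>lborel)"
    by (rule lborel.emeasure_pair_measure_alt[OF S'2])
  also have "\<dots> = (\<integral>\<^sup>+ (m::real). 0 \<partial>lborel)"
  proof (intro nn_integral_cong)
    fix m
    have "Pair m -` S' = {h. (m - h, m + h) \<in> S}" by (auto simp: S'_def T_def)
    then show "emeasure lborel (Pair m -` S') = 0"
      using fin[of m] by (simp add: emeasure_lborel_countable countable_finite)
  qed
  finally have "S' \<in> null_sets lborel" using S' by (simp add: null_sets_def)
  then have neg: "negligible S'" by (simp add: negligible_iff_null_sets null_sets_completionI)
  have "linear T" by (rule linearI) (auto simp: T_def algebra_simps)
  then have "negligible (T ` S')"
    by (intro negligible_differentiable_image_negligible[OF _ neg] linear_imp_differentiable_on) auto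
  moreover have "T ` S' = S"
  proof
    show "S \<subseteq> T ` S'"
    proof
      fix p assume "p \<in> S"
      moreover have "p = T (mc p, hc p)" by (cases p) (auto simp: T_def mc_def hc_def field_simps)
      ultimately show "p \<in> T ` S'" by (metis S'_def image_eqI vimage_eq)
    qed
  qed (auto simp: S'_def)
  ultimately have "S \<in> null_sets lebesgue" by (simp add: negligible_iff_null_sets)
  then have "S \<in> null_sets lborel" using S by (simp add: null_sets_completion_iff)
  then show ?thesis by auto
qed

text \<open>Common shape of the perturbation laws and of the common part of two of them: constant
  density \<open>c\<close> on \<open>B\<close> and an atom \<open>w\<close> at \<Delta>. The total
  mass is left free, as common parts may have mass below 1.\<close>

definition opt_meas :: "real \<Rightarrow> point set \<Rightarrow> real \<Rightarrow> point option measure" where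
  "opt_meas c B w = measure_of UNIV {A. Some -` A \<in> sets borel}
     (\<lambda>A. ennreal c * emeasure lborel (Some -` A \<inter> B) + ennreal w * indicator A None)"

lemma sigma_algebra_opt: "sigma_algebra UNIV {A. Some -` A \<in> sets (borel :: point measure)}"
proof -
  have "sigma_algebra UNIV (Pow UNIV \<inter> {A. Some -` A \<in> sets (borel :: point measure)})"
    unfolding sigma_algebra_iff2
    by (auto simp: vimage_Union vimage_UN image_image vimage_Diff)
  then show ?thesis by simp
qed

lemma space_opt_meas [simp]: "space (opt_meas c B w) = UNIV"
  and sets_opt_meas: "sets (opt_meas c B w) = {A. Some -` A \<in> sets borel}"
  by (simp_all add: opt_meas_def sigma_algebra.sets_measure_of_eq[OF sigma_algebra_opt] space_measure_of_conv)

lemma emeasure_opt_meas: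
  assumes B: "B \<in> sets borel" and A: "Some -` A \<in> sets borel"
  shows "emeasure (opt_meas c B w) A =
     ennreal c * emeasure lborel (Some -` A \<inter> B) + ennreal w * indicator A None"
proof -
  let ?\<mu> = "\<lambda>A. ennreal c * emeasure lborel (Some -` A \<inter> B) + ennreal w * indicator A None"
  show ?thesis unfolding opt_meas_def
  proof (rule emeasure_measure_of_sigma[OF sigma_algebra_opt])
    show "positive {A. Some -` A \<in> sets borel} ?\<mu>" by (simp add: positive_def)
    show "countably_additive {A. Some -` A \<in> sets borel} ?\<mu>"
      unfolding countably_additive_def
    proof (intro allI impI)
      fix A :: "nat \<Rightarrow> point option set"
      assume *: "range A \<subseteq> {A. Some -` A \<in> sets borel}" "disjoint_family A"
      have m: "\<And>i. Some -` A i \<inter> B \<in> sets lborel" using * B by auto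
      have d: "disjoint_family (\<lambda>i. Some -` A i \<inter> B)" using *(2) by (auto simp: disjoint_family_on_def)
      have "(\<Sum>i. ?\<mu> (A i)) = (\<Sum>i. ennreal c * emeasure lborel (Some -` A i \<inter> B)) + (\<Sum>i. ennreal w * indicator (A i) None)"
        by (intro suminf_add[symmetric]) auto
      also have "\<dots> = ennreal c * (\<Sum>i. emeasure lborel (Some -` A i \<inter> B)) + ennreal w * (\<Sum>i. indicator (A i) None)"
        by (simp add: ennreal_suminf_cmult)
      also have "(\<Sum>i. emeasure lborel (Some -` A i \<inter> B)) = emeasure lborel (\<Union>i. Some -` A i \<inter> B)"
        using m d by (intro suminf_emeasure) auto
      also have "(\<Union>i. Some -` A i \<inter> B) = Some -` (\<Union>i. A i) \<inter> B" by auto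
      also have "(\<Sum>i. indicator (A i) None :: ennreal) = indicator (\<Union>i. A i) None"
        by (rule suminf_indicator[OF *(2)])
      finally show "(\<Sum>i. ?\<mu> (A i)) = ?\<mu> (\<Union>i. A i)" .
    qed
  qed (use A in auto)
qed

lemma None_in_sets_opt [measurable]: "{None} \<in> sets (opt_meas c B w)"
  by (simp add: sets_opt_meas vimage_def)

text \<open>The unspecified value \<open>the None\<close> is harmless, because this sigma-algebra
  constrains a set only through its part in the plane.\<close>

lemma measurable_the_opt:
  fixes g :: "point \<Rightarrow> 'b::topological_space"
  assumes "g \<in> borel_measurable borel"
  shows "(\<lambda>u. g (the u)) \<in> borel_measurable (opt_meas c B w)"
proof (rule measurableI)
  fix A :: "'b set" assume "A \<in> sets borel"
  then have "g -` A \<in> sets borel" using assms by (metis measurable_sets_borel)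
  moreover have "Some -` ((\<lambda>u. g (the u)) -` A \<inter> space (opt_meas c B w)) = g -` A" by auto
  ultimately show "(\<lambda>u. g (the u)) -` A \<inter> space (opt_meas c B w) \<in> sets (opt_meas c B w)"
    unfolding sets_opt_meas by simp
qed simp

lemma finite_measure_opt_meas:
  assumes "B \<in> sets borel" "bounded B"
  shows "finite_measure (opt_meas c B w)"
proof
  have "emeasure lborel B < \<infinity>" by (rule emeasure_bounded_finite[OF assms(2)])
  then show "emeasure (opt_meas c B w) (space (opt_meas c B w)) \<noteq> \<infinity>"
    using assms by (simp add: emeasure_opt_meas ennreal_mult_eq_top_iff less_top)
qed

lemma opt_meas_atom_le:
  assumes "B \<in> sets borel" "g \<in> borel_measurable (opt_meas c B w)"
  shows "ennreal w * g None \<le> (\<integral>\<^sup>+ x. g x \<partial>opt_meas c B w)"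
proof -
  have "ennreal w * g None = g None * emeasure (opt_meas c B w) {None}"
    using assms by (simp add: emeasure_opt_meas vimage_def mult.commute)
  also have "\<dots> = (\<integral>\<^sup>+ x. g None * indicator {None} x \<partial>opt_meas c B w)"
    by (simp add: nn_integral_cmult_indicator)
  also have "\<dots> \<le> (\<integral>\<^sup>+ x. g x \<partial>opt_meas c B w)"
    by (intro nn_integral_mono) (auto split: split_indicator)
  finally show ?thesis .
qed

lemma nn_integral_opt_meas_mono:
  assumes "B \<in> sets borel" "B' \<in> sets borel" "B \<subseteq> B'" "w \<le> w'"
  shows "(\<integral>\<^sup>+ x. g x \<partial>opt_meas c B w) \<le> (\<integral>\<^sup>+ x. g x \<partial>opt_meas c B' w')"
proof (rule nn_integral_mono_measure)
  show "sets (opt_meas c B w) = sets (opt_meas c B' w')" by (simp add: sets_opt_meas)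
  show "opt_meas c B w \<le> opt_meas c B' w'"
  proof (subst le_measure)
    show "\<forall>A\<in>sets (opt_meas c B w). emeasure (opt_meas c B w) A \<le> emeasure (opt_meas c B' w') A"
      using assms
      by (auto simp: sets_opt_meas emeasure_opt_meas intro!: add_mono mult_mono emeasure_mono ennreal_leI)
  qed (simp add: sets_opt_meas)
qed

lemma emeasure_ball_point: "r \<ge> 0 \<Longrightarrow> emeasure lborel (ball (x::point) r) = ennreal (pi * r\<^sup>2)"
  by (simp add: emeasure_ball unit_ball_vol_2 power2_eq_square)

lemma perturb_eq: "perturb \<alpha> x = opt_meas (1 / (pi * \<alpha>\<^sup>2)) (ball x (min \<alpha> (infdist x diag)))
    ((\<alpha>\<^sup>2 - (min \<alpha> (infdist x diag))\<^sup>2) / \<alpha>\<^sup>2)"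
  by (simp add: perturb_def opt_meas_def Let_def)

lemma prob_space_perturb:
  assumes "\<alpha> > 0"
  shows "prob_space (perturb \<alpha> x)"
proof
  define r where "r = min \<alpha> (infdist x diag)"
  have r: "r \<ge> 0" "r \<le> \<alpha>" using assms by (auto simp: r_def infdist_nonneg)
  then have r2: "r\<^sup>2 \<le> \<alpha>\<^sup>2" by (simp add: power_mono)
  have "emeasure (perturb \<alpha> x) UNIV = ennreal (1 / (pi * \<alpha>\<^sup>2)) * ennreal (pi * r\<^sup>2) + ennreal ((\<alpha>\<^sup>2 - r\<^sup>2) / \<alpha>\<^sup>2)"
    using r unfolding perturb_eq r_def[symmetric] by (subst emeasure_opt_meas) (auto simp: emeasure_ball_point)
  also have "\<dots> = ennreal (1 / (pi * \<alpha>\<^sup>2) * (pi * r\<^sup>2) + (\<alpha>\<^sup>2 - r\<^sup>2) / \<alpha>\<^sup>2)"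
    using r2 by (simp flip: ennreal_mult ennreal_plus)
  also have "1 / (pi * \<alpha>\<^sup>2) * (pi * r\<^sup>2) + (\<alpha>\<^sup>2 - r\<^sup>2) / \<alpha>\<^sup>2 = 1" using assms by (simp add: field_simps)
  finally show "emeasure (perturb \<alpha> x) (space (perturb \<alpha> x)) = 1" by (simp add: perturb_eq)
qed

text \<open>Extends a family on the matched labels to all labels of one tuple: labels in
  \<open>T\<close> read the coordinate \<open>s i\<close>, the others get the constant
  \<open>d\<close>, which will be \<Delta>. Restricting to \<open>I\<close> puts the result into the
  product space.\<close>

definition ext_fam :: "'i set \<Rightarrow> 'i set \<Rightarrow> ('i \<Rightarrow> 'j) \<Rightarrow> 'a \<Rightarrow> ('j \<Rightarrow> 'a) \<Rightarrow> 'i \<Rightarrow> 'a" where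
  "ext_fam I T s d v = (\<lambda>i\<in>I. if i \<in> T then v (s i) else d)"

lemma measurable_ext_fam:
  assumes "\<And>i. i \<in> I \<Longrightarrow> d \<in> space (M i)" "\<And>i. i \<in> T \<Longrightarrow> s i \<in> J" "\<And>i. i \<in> T \<Longrightarrow> sets (Q (s i)) = sets (M i)"
  shows "ext_fam I T s d \<in> measurable (PiM J Q) (PiM I M)"
proof -
  have "(\<lambda>v. \<lambda>i\<in>I. if i \<in> T then v (s i) else d) \<in> measurable (PiM J Q) (PiM I M)"
  proof (rule measurable_restrict)
    fix i assume i: "i \<in> I"
    show "(\<lambda>v. if i \<in> T then v (s i) else d) \<in> measurable (PiM J Q) (M i)"
    proof (cases "i \<in> T")
      case True
      have "(\<lambda>v. v (s i)) \<in> measurable (PiM J Q) (Q (s i))"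
        using assms(2)[OF True] by (rule measurable_component_singleton)
      then show ?thesis using True measurable_cong_sets[OF refl assms(3)[OF True]] by auto
    next
      case False then show ?thesis using assms(1)[OF i] by simp
    qed
  qed
  then show ?thesis by (simp add: ext_fam_def[abs_def])
qed

text \<open>Domination between product measures, one coordinate at a time by Fubini. A coordinate in
  \<open>T\<close> is integrated against a smaller measure, one in \<open>R\<close> only over its
  atom at \<open>d\<close>. So the image of the product of the \<open>Q (s i)\<close>, scaled by the
  weights \<open>w i\<close>, lies below the product of the \<open>M i\<close>.\<close>

lemma nn_integral_PiM_ext_fam_le:
  assumes M: "product_sigma_finite M" and Q: "product_sigma_finite Q"
    and fin: "finite T" "finite R" and dis: "T \<inter> R = {}" and inj: "inj_on s T"
    and sets: "\<And>i. i \<in> T \<Longrightarrow> sets (Q (s i)) = sets (M i)"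
    and le: "\<And>i g. i \<in> T \<Longrightarrow> g \<in> borel_measurable (M i) \<Longrightarrow> (\<integral>\<^sup>+ y. g y \<partial>Q (s i)) \<le> (\<integral>\<^sup>+ y. g y \<partial>M i)"
    and atom: "\<And>i g. i \<in> R \<Longrightarrow> g \<in> borel_measurable (M i) \<Longrightarrow> w i * g d \<le> (\<integral>\<^sup>+ y. g y \<partial>M i)"
    and d: "\<And>i. d \<in> space (M i)"
    and f: "f \<in> borel_measurable (PiM (T \<union> R) M)"
  shows "(\<Prod>i\<in>R. w i) * (\<integral>\<^sup>+ v. f (ext_fam (T \<union> R) T s d v) \<partial>PiM (s ` T) Q) \<le> (\<integral>\<^sup>+ v. f v \<partial>PiM (T \<union> R) M)"
proof -
  interpret M: product_sigma_finite M by fact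
  interpret Q: product_sigma_finite Q by fact
  \<comment> \<open>Coordinates in \<open>T\<close> alone. The integrand varies in the induction,
    since integrating out a coordinate produces a new one.\<close>
  have base: "(\<integral>\<^sup>+ v. f (ext_fam T T s d v) \<partial>PiM (s ` T) Q) \<le> (\<integral>\<^sup>+ v. f v \<partial>PiM T M)"
    if "f \<in> borel_measurable (PiM T M)" for f :: "('a \<Rightarrow> 'b) \<Rightarrow> ennreal"
    using fin(1) inj sets le that
  proof (induction T arbitrary: f rule: finite_induct)
    case empty
    then show ?case by (simp add: PiM_empty nn_integral_count_space_finite ext_fam_def restrict_def)
  next
    case (insert i T)
    note f = \<open>f \<in> borel_measurable (PiM (insert i T) M)\<close>
    have si: "s i \<notin> s ` T" using insert.hyps insert.prems(1) by auto
    have add: "(\<lambda>(x, y). f (x(i := y))) \<in> borel_measurable (PiM T M \<Otimes>\<^sub>M M i)"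
      using measurable_comp[OF measurable_add_dim f] by (simp add: comp_def case_prod_unfold)
    have g: "(\<lambda>x. \<integral>\<^sup>+ y. f (x(i := y)) \<partial>M i) \<in> borel_measurable (PiM T M)"
      using M.sigma_finite_measures[of i] add
      by (intro sigma_finite_measure.borel_measurable_nn_integral) auto
    have ext_m: "ext_fam (insert i T) (insert i T) s d \<in> measurable (PiM (insert (s i) (s ` T)) Q) (PiM (insert i T) M)"
      by (rule measurable_ext_fam) (use d insert.prems in auto)
    have "(\<integral>\<^sup>+ v. f (ext_fam (insert i T) (insert i T) s d v) \<partial>PiM (s ` insert i T) Q)
       = (\<integral>\<^sup>+ v. (\<integral>\<^sup>+ y. f (ext_fam (insert i T) (insert i T) s d (v(s i := y))) \<partial>Q (s i)) \<partial>PiM (s ` T) Q)"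
      using insert.hyps si measurable_comp[OF ext_m f]
      unfolding image_insert by (intro Q.product_nn_integral_insert) (auto simp: comp_def)
    also have "\<dots> = (\<integral>\<^sup>+ v. (\<integral>\<^sup>+ y. f ((ext_fam T T s d v)(i := y)) \<partial>Q (s i)) \<partial>PiM (s ` T) Q)"
    proof (intro nn_integral_cong arg_cong[where f = f])
      fix v y
      show "ext_fam (insert i T) (insert i T) s d (v(s i := y)) = (ext_fam T T s d v)(i := y)"
        using si insert.hyps by (auto simp: ext_fam_def fun_eq_iff restrict_def) (metis imageI)
    qed
    also have "\<dots> \<le> (\<integral>\<^sup>+ v. (\<integral>\<^sup>+ y. f ((ext_fam T T s d v)(i := y)) \<partial>M i) \<partial>PiM (s ` T) Q)"
    proof (intro nn_integral_mono insert.prems(3))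
      fix v assume v: "v \<in> space (PiM (s ` T) Q)"
      have "ext_fam T T s d \<in> measurable (PiM (s ` T) Q) (PiM T M)"
        by (rule measurable_ext_fam) (use d insert.prems in auto)
      then have "ext_fam T T s d v \<in> space (PiM T M)" using v by (rule measurable_space)
      then show "(\<lambda>y. f ((ext_fam T T s d v)(i := y))) \<in> borel_measurable (M i)"
        using measurable_comp[OF measurable_component_update f, of "ext_fam T T s d v"] insert.hyps
        by (simp add: comp_def fun_upd_def)
    qed auto
    also have "\<dots> \<le> (\<integral>\<^sup>+ x. (\<integral>\<^sup>+ y. f (x(i := y)) \<partial>M i) \<partial>PiM T M)"
      by (rule insert.IH[OF _ _ _ g]) (use insert.prems in auto)
    also have "\<dots> = (\<integral>\<^sup>+ v. f v \<partial>PiM (insert i T) M)"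
      using insert.hyps f by (intro M.product_nn_integral_insert[symmetric]) auto
    finally show ?case .
  qed
  \<comment> \<open>Coordinates in \<open>R\<close> are added with \<open>T\<close> fixed; freezing
    one of them at \<open>d\<close> changes the integrand again.\<close>
  show ?thesis
    using fin(2) dis atom f
  proof (induction R arbitrary: f rule: finite_induct)
    case empty
    then show ?case using base by simp
  next
    case (insert i R)
    note f = \<open>f \<in> borel_measurable (PiM (T \<union> insert i R) M)\<close>
    have i: "i \<notin> T \<union> R" using insert by auto
    have eq: "T \<union> insert i R = insert i (T \<union> R)" by simp
    have g: "(\<lambda>x. f (x(i := d))) \<in> borel_measurable (PiM (T \<union> R) M)"
    proof -
      have "(\<lambda>x. x(i := d)) \<in> measurable (PiM (T \<union> R) M) (PiM (insert i (T \<union> R)) M)"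
        by (rule measurable_fun_upd[where J = "T \<union> R"]) (use d in auto)
      from measurable_comp[OF this f[unfolded eq]] show ?thesis by (simp add: comp_def)
    qed
    have "(\<Prod>i\<in>insert i R. w i) * (\<integral>\<^sup>+ v. f (ext_fam (T \<union> insert i R) T s d v) \<partial>PiM (s ` T) Q)
       = w i * ((\<Prod>i\<in>R. w i) * (\<integral>\<^sup>+ v. f ((ext_fam (T \<union> R) T s d v)(i := d)) \<partial>PiM (s ` T) Q))"
    proof -
      have "ext_fam (T \<union> insert i R) T s d v = (ext_fam (T \<union> R) T s d v)(i := d)" for v
        using i by (auto simp: ext_fam_def fun_eq_iff restrict_def)
      then show ?thesis using insert.hyps by (simp add: mult.assoc)
    qed
    also have "\<dots> \<le> w i * (\<integral>\<^sup>+ x. f (x(i := d)) \<partial>PiM (T \<union> R) M)"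
      by (intro mult_left_mono insert.IH[OF _ _ g]) (use insert.prems in auto)
    also have "\<dots> = (\<integral>\<^sup>+ x. w i * f (x(i := d)) \<partial>PiM (T \<union> R) M)"
      using g by (rule nn_integral_cmult[symmetric])
    also have "\<dots> \<le> (\<integral>\<^sup>+ x. (\<integral>\<^sup>+ y. f (x(i := y)) \<partial>M i) \<partial>PiM (T \<union> R) M)"
    proof (rule nn_integral_mono)
      fix x assume x: "x \<in> space (PiM (T \<union> R) M)"
      have "(\<lambda>y. f (x(i := y))) \<in> borel_measurable (M i)"
        using measurable_comp[OF measurable_component_update f[unfolded eq], of x] x i
        by (simp add: comp_def fun_upd_def)
      then show "w i * f (x(i := d)) \<le> (\<integral>\<^sup>+ y. f (x(i := y)) \<partial>M i)"
        by (intro insert.prems(2)) auto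
    qed
    also have "\<dots> = (\<integral>\<^sup>+ v. f v \<partial>PiM (T \<union> insert i R) M)"
      unfolding eq using i fin(1) insert.hyps f[unfolded eq]
      by (intro M.product_nn_integral_insert[symmetric]) auto
    finally show ?case .
  qed
qed

text \<open>Fubini with the coordinate \<open>a\<close> innermost. By \<open>some\<close> the atom
  at \<Delta> lies outside every slice, so only the planar part within \<open>B a\<close>
  counts.\<close>

lemma PiM_null_set_slices:
  assumes I: "finite I" "a \<in> I" and B: "\<And>i. B i \<in> sets borel" "\<And>i. bounded (B i)"
    and E: "E \<in> sets (PiM I (\<lambda>i. opt_meas (c i) (B i) (w i)))"
    and some: "\<And>v. v \<in> E \<Longrightarrow> v a \<noteq> None"
    and null: "\<And>x. {p. x(a := Some p) \<in> E} \<in> sets borel \<Longrightarrow>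
      emeasure lborel ({p. x(a := Some p) \<in> E} \<inter> B a) = 0"
  shows "E \<in> null_sets (PiM I (\<lambda>i. opt_meas (c i) (B i) (w i)))"
proof -
  let ?M = "\<lambda>i. opt_meas (c i) (B i) (w i)"
  interpret product_sigma_finite ?M
    by (intro product_sigma_finite.intro finite_measure.axioms(1) finite_measure_opt_meas B)
  define I' where "I' = I - {a}"
  have I': "finite I'" "a \<notin> I'" "I = insert a I'" using I by (auto simp: I'_def)
  have "emeasure (PiM I ?M) E = (\<integral>\<^sup>+ v. indicator E v \<partial>PiM I ?M)" using E by simp
  also have "\<dots> = (\<integral>\<^sup>+ x. (\<integral>\<^sup>+ y. indicator E (x(a := y)) \<partial>?M a) \<partial>PiM I' ?M)"
    using E I' by (simp only: I'(3)) (intro product_nn_integral_insert borel_measurable_indicator; simp)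
  also have "\<dots> = (\<integral>\<^sup>+ x. 0 \<partial>PiM I' ?M)"
  proof (intro nn_integral_cong)
    fix x assume x: "x \<in> space (PiM I' ?M)"
    define A where "A = {y. x(a := y) \<in> E}"
    have "(\<lambda>y. x(a := y)) \<in> measurable (?M a) (PiM I ?M)"
      using measurable_component_update[OF x I'(2)] I'(3) by simp
    from measurable_sets[OF this E] have A: "A \<in> sets (?M a)" by (simp add: A_def vimage_def)
    then have SA: "Some -` A \<in> sets borel" by (simp add: sets_opt_meas)
    have "None \<notin> A" using some[of "x(a := None)"] by (auto simp: A_def)
    moreover have "emeasure lborel (Some -` A \<inter> B a) = 0"
      using null[of x] SA by (simp add: A_def vimage_def)
    ultimately have "emeasure (?M a) A = 0"
      using SA by (simp add: emeasure_opt_meas[OF B(1)])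
    moreover have "(\<integral>\<^sup>+ y. indicator E (x(a := y)) \<partial>?M a) = (\<integral>\<^sup>+ y. indicator A y \<partial>?M a)"
      by (intro nn_integral_cong) (auto simp: A_def split: split_indicator)
    ultimately show "(\<integral>\<^sup>+ y. indicator E (x(a := y)) \<partial>?M a) = 0" using A by simp
  qed
  finally show ?thesis using E by (simp add: null_sets_def)
qed

text \<open>Turns an algebraic uniqueness statement into a null set: it suffices that membership in
  \<open>E\<close> determines the height of one point when everything else is fixed.\<close>

lemma PiM_null_set_planar:
  assumes I: "finite I" "a \<in> I" and B: "\<And>i. B i \<in> sets borel" "\<And>i. bounded (B i)"
    and E: "E \<in> sets (PiM I (\<lambda>i. opt_meas (c i) (B i) (w i)))"
    and some: "\<And>v. v \<in> E \<Longrightarrow> v a \<noteq> None"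
    and uniq: "\<And>x m h h'. x(a := Some (m - h, m + h)) \<in> E \<Longrightarrow> x(a := Some (m - h', m + h')) \<in> E \<Longrightarrow> h = h'"
  shows "E \<in> null_sets (PiM I (\<lambda>i. opt_meas (c i) (B i) (w i)))"
proof (rule PiM_null_set_slices[of I a B E c w, OF I B E])
  fix x assume S: "{p. x(a := Some p) \<in> E} \<in> sets borel"
  have "finite {h. (m - h, m + h) \<in> {p. x(a := Some p) \<in> E}}" for m
  proof (cases "{h. (m - h, m + h) \<in> {p. x(a := Some p) \<in> E}} = {}")
    case False
    then obtain h0 where "x(a := Some (m - h0, m + h0)) \<in> E" by auto
    then have "{h. (m - h, m + h) \<in> {p. x(a := Some p) \<in> E}} \<subseteq> {h0}"
      using uniq by auto
    then show ?thesis by (rule finite_subset) simp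
  qed (simp only: finite.emptyI)
  then have "emeasure lborel {p. x(a := Some p) \<in> E} = 0" by (rule planar_null_set[OF S])
  then show "emeasure lborel ({p. x(a := Some p) \<in> E} \<inter> B a) = 0"
    using emeasure_mono[of "{p. x(a := Some p) \<in> E} \<inter> B a" "{p. x(a := Some p) \<in> E}" lborel] S by simp
qed (rule some)

section \<open>Generic positions\<close>

definition vloc :: "(nat \<times> 'l \<Rightarrow> point option) \<Rightarrow> nat \<Rightarrow> 'l \<Rightarrow> point" where
  "vloc v i x = the (v (i, x))"

definition slice :: "(nat \<times> 'l) set \<Rightarrow> nat \<Rightarrow> 'l set" where
  "slice S i = {x. (i, x) \<in> S}"

lemma is_grouping_cong:
  assumes "\<And>i. i < N \<Longrightarrow> L i = L' i"
  shows "is_grouping N L = is_grouping N L'"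
proof -
  have "is_selection N L s = is_selection N L' s" for s using assms by (auto simp: is_selection_def)
  then show ?thesis using assms by (auto simp: is_grouping_def fun_eq_iff)
qed

lemma is_selection_mono:
  assumes "\<And>i. i < N \<Longrightarrow> L i \<subseteq> L' i" "is_selection N L s"
  shows "is_selection N L' s"
  using assms unfolding is_selection_def by blast

text \<open>Isolates the contribution of the single point \<open>a\<close>; the first summand does
  not see \<open>p\<close>.\<close>

lemma sel_sum_update:
  assumes "fst a < N"
  shows "sel_sum N (\<lambda>i l. F (vloc (v(a := Some p)) i l)) s =
     sel_sum N (\<lambda>i l. if (i, l) = a then 0 else F (vloc v i l)) s +
       (if s (fst a) = Some (snd a) then F p else 0)"
proof -
  have "sel_sum N (\<lambda>i l. F (vloc (v(a := Some p)) i l)) s =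
     (\<Sum>i<N. (case s i of None \<Rightarrow> 0 | Some l \<Rightarrow> if (i, l) = a then 0 else F (vloc v i l)) +
       (if i = fst a then if s (fst a) = Some (snd a) then F p else 0 else 0))"
    unfolding sel_sum_def by (rule sum.cong) (auto simp: vloc_def split: option.splits)
  also have "\<dots> = sel_sum N (\<lambda>i l. if (i, l) = a then 0 else F (vloc v i l)) s +
       (if s (fst a) = Some (snd a) then F p else 0)"
    using assms by (simp add: sum.distrib sel_sum_def)
  finally show ?thesis .
qed

text \<open>By \<open>grouping_sum\<close> the double sum is the same for all groupings, so two
  costs differ only in the other two terms.\<close>

lemma grouping_cost_alt:
  assumes "\<And>i. i < N \<Longrightarrow> finite (L i)" "is_grouping N L G"
  shows "grouping_cost N loc G =
    2 * ((\<Sum>i<N. \<Sum>l\<in>L i. (mc (loc i l))\<^sup>2 + (hc (loc i l))\<^sup>2)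
     - (\<Sum>s\<in>G. (sel_mc N loc s)\<^sup>2 / sel_size N s) - (\<Sum>s\<in>G. (sel_hc N loc s)\<^sup>2) / N)"
proof -
  have e: "(\<Sum>s\<in>G. sel_sum N (\<lambda>i l. (mc (loc i l))\<^sup>2 + (hc (loc i l))\<^sup>2) s) =
      (\<Sum>i<N. \<Sum>l\<in>L i. (mc (loc i l))\<^sup>2 + (hc (loc i l))\<^sup>2)"
    using assms by (intro grouping_sum) auto
  show ?thesis
    unfolding grouping_cost_def sel_cost_def sum_distrib_left[symmetric] sum_subtractf e
    by (simp add: sum_divide_distrib)
qed

text \<open>As a function of the height of a single point, the difference of the costs of two groupings is
  affine, with slope proportional to the difference of the height sums of the two selections
  which contain the point.\<close>

lemma grouping_cost_eq_unique:
  fixes v :: "nat \<times> 'l \<Rightarrow> point option" and a :: "nat \<times> 'l"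
  defines "loc \<equiv> \<lambda>m h. vloc (v(a := Some (m - h, m + h)))"
  assumes N: "N \<ge> 1" and fin: "\<And>i. i < N \<Longrightarrow> finite (L i)"
    and G: "is_grouping N L G" "is_grouping N L G'"
    and s: "s \<in> G" "t \<in> G'" "fst a < N" "s (fst a) = Some (snd a)" "t (fst a) = Some (snd a)"
    and ne: "sel_hc N (loc m h) s \<noteq> sel_hc N (loc m h) t"
    and eq: "grouping_cost N (loc m h) G = grouping_cost N (loc m h) G'"
      "grouping_cost N (loc m h') G = grouping_cost N (loc m h') G'"
  shows "h = h'"
proof -
  define R where "R u = sel_sum N (\<lambda>i l. if (i, l) = a then 0 else hc (vloc v i l)) u" for u
  have hs: "sel_hc N (loc m h) u = R u + (if u (fst a) = Some (snd a) then h else 0)" for h u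
    unfolding loc_def R_def sel_sum_update[OF s(3)] by simp
  \<comment> \<open>Moving the point across the diagonal changes no position along it, so the
    \<open>mc\<close> terms are constant in \<open>h\<close>.\<close>
  have ms: "sel_mc N (loc m h) u = sel_mc N (loc m 0) u" for h u
    unfolding loc_def sel_sum_update[OF s(3)] by (simp add: mc_def)
  have sq: "(\<Sum>u\<in>G. (sel_hc N (loc m h) u)\<^sup>2) = (\<Sum>u\<in>G - {s}. (R u)\<^sup>2) + (R s + h)\<^sup>2"
    if G: "is_grouping N L G" "s \<in> G" "s (fst a) = Some (snd a)" for G s h
  proof -
    have "u (fst a) \<noteq> Some (snd a)" if "u \<in> G - {s}" for u
      using grouping_unique[OF G(1) _ G(2) s(3) _ G(3), of u] that by auto
    then show ?thesis
      using finite_grouping[OF fin G(1)] G by (simp add: sum.remove[OF _ G(2)] hs)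
  qed
  define A where "A G = (\<Sum>s\<in>G. (sel_mc N (loc m 0) s)\<^sup>2 / sel_size N s)" for G
  define Sq where "Sq h = (\<Sum>i<N. \<Sum>l\<in>L i. (mc (loc m h i l))\<^sup>2 + (hc (loc m h i l))\<^sup>2)" for h
  have A: "(\<Sum>s\<in>G. (sel_mc N (loc m h) s)\<^sup>2 / sel_size N s) = A G" for h G
    unfolding A_def by (intro sum.cong refl) (metis ms)
  have cost: "grouping_cost N (loc m h) G =
     2 * (Sq h - A G - ((\<Sum>u\<in>G - {s}. (R u)\<^sup>2) + (R s + h)\<^sup>2) / N)"
    if "is_grouping N L G" "s \<in> G" "s (fst a) = Some (snd a)" for G s h
    using grouping_cost_alt[of N L G "loc m h", OF _ that(1)] fin
    by (simp only: sq[OF that] A Sq_def)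
  note e = eq[unfolded cost[OF G(1) s(1,4)] cost[OF G(2) s(2,5)]]
  \<comment> \<open>Subtracting the equations at \<open>h\<close> and \<open>h'\<close> removes
    \<open>Sq\<close>, the constants \<open>A\<close> and the sums over the other selections;
    afterwards the squares of \<open>h\<close> and \<open>h'\<close> cancel as well.\<close>
  have "(R s + h)\<^sup>2 / N - (R s + h')\<^sup>2 / N = (R t + h)\<^sup>2 / N - (R t + h')\<^sup>2 / N"
    using e by (simp add: add_divide_distrib)
  then have "(R s + h)\<^sup>2 - (R s + h')\<^sup>2 = (R t + h)\<^sup>2 - (R t + h')\<^sup>2"
    using N by (simp add: diff_divide_distrib[symmetric])
  then have "(R s - R t) * (h - h') = 0" by (simp add: power2_eq_square algebra_simps)
  moreover have "R s \<noteq> R t" using ne s by (simp add: hs)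
  ultimately show ?thesis by simp
qed

text \<open>Positive heights keep the points off the diagonal, distinct height sums supply the gap,
  and distinct costs make the cheapest grouping unique.\<close>

definition generic_at :: "nat \<Rightarrow> (nat \<Rightarrow> 'l set) \<Rightarrow> (nat \<Rightarrow> 'l \<Rightarrow> point) \<Rightarrow> bool" where
  "generic_at N L loc \<longleftrightarrow> (\<forall>i<N. \<forall>l\<in>L i. hc (loc i l) > 0) \<and>
     (\<forall>s t. is_selection N L s \<longrightarrow> is_selection N L t \<longrightarrow> s \<noteq> t \<longrightarrow> sel_hc N loc s \<noteq> sel_hc N loc t) \<and>
     (\<forall>G G'. is_grouping N L G \<longrightarrow> is_grouping N L G' \<longrightarrow> G \<noteq> G' \<longrightarrow>
        grouping_cost N loc G \<noteq> grouping_cost N loc G')"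

lemma generic_at_cong:
  assumes "\<And>i. i < N \<Longrightarrow> L i = L' i"
  shows "generic_at N L = generic_at N L'"
proof -
  have sel: "is_selection N L s = is_selection N L' s" for s using assms by (auto simp: is_selection_def)
  have grp: "is_grouping N L G = is_grouping N L' G" for G using is_grouping_cong[OF assms] by simp
  show ?thesis by (rule ext) (simp add: generic_at_def sel grp assms)
qed

definition present :: "(nat \<times> 'l \<Rightarrow> point option) \<Rightarrow> (nat \<times> 'l) set \<Rightarrow> (nat \<times> 'l) set" where
  "present v I = {j \<in> I. v j \<noteq> None}"

text \<open>One labeled tuple with independent perturbations, for abstract labels and weights; it is
  instantiated once for \<open>X\<close> and once for \<open>Y\<close>. The supports
  \<open>B\<close> lie above the diagonal.\<close>

locale perturbed_points =
  fixes N :: nat and L :: "nat \<Rightarrow> 'l set" and c w :: "nat \<times> 'l \<Rightarrow> real" and B :: "nat \<times> 'l \<Rightarrow> point set"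
  assumes N: "N \<ge> 1" and fin: "\<And>i. i < N \<Longrightarrow> finite (L i)"
    and B: "\<And>j. B j \<in> sets borel" "\<And>j. bounded (B j)"
    and hcB: "\<And>i l p. i < N \<Longrightarrow> l \<in> L i \<Longrightarrow> p \<in> B (i, l) \<Longrightarrow> hc p > 0"
begin

abbreviation "Q \<equiv> \<lambda>j. opt_meas (c j) (B j) (w j)"

definition "I = (SIGMA i:{..<N}. L i)"

abbreviation "P \<equiv> PiM I Q"

lemma finI: "finite I" using fin by (auto simp: I_def)

lemma in_I_iff: "(i, l) \<in> I \<longleftrightarrow> i < N \<and> l \<in> L i" by (auto simp: I_def)

lemma measurable_the_P:
  fixes g :: "point \<Rightarrow> real"
  assumes "g \<in> borel_measurable borel" "j \<in> I"
  shows "(\<lambda>v. g (the (v j))) \<in> borel_measurable P"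
  using measurable_compose[OF measurable_component_singleton[OF assms(2)] measurable_the_opt[OF assms(1)]] by simp

lemma measurable_sel_sum:
  fixes g :: "point \<Rightarrow> real"
  assumes "g \<in> borel_measurable borel" "is_selection N L s"
  shows "(\<lambda>v. sel_sum N (\<lambda>i l. g (vloc v i l)) s) \<in> borel_measurable P"
  unfolding sel_sum_def
proof (rule borel_measurable_sum)
  fix i assume "i \<in> {..<N}"
  then have "s i = None \<or> (\<exists>l. s i = Some l \<and> (i, l) \<in> I)"
    using assms(2) by (auto simp: is_selection_def in_I_iff)
  then show "(\<lambda>v. case s i of None \<Rightarrow> 0 | Some l \<Rightarrow> g (vloc v i l)) \<in> borel_measurable P"
    using measurable_the_P[OF assms(1)] by (auto simp: vloc_def)
qed

lemma hc_measurable: "hc \<in> borel_measurable borel"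
  unfolding hc_def by (intro borel_measurable_continuous_onI continuous_intros) auto

lemma mc_measurable: "mc \<in> borel_measurable borel"
  unfolding mc_def by (intro borel_measurable_continuous_onI continuous_intros) auto

lemma measurable_sel_cost:
  assumes "is_selection N L s"
  shows "(\<lambda>v. sel_cost N (vloc v) s) \<in> borel_measurable P"
  unfolding sel_cost_def
  by (intro borel_measurable_times borel_measurable_diff borel_measurable_divide borel_measurable_power
    borel_measurable_const measurable_sel_sum[OF mc_measurable assms] measurable_sel_sum[OF hc_measurable assms]
    measurable_sel_sum[OF _ assms, where g = "\<lambda>p. (mc p)\<^sup>2 + (hc p)\<^sup>2"] borel_measurable_add mc_measurable hc_measurable)

lemma measurable_grouping_cost:
  assumes "\<And>s. s \<in> G \<Longrightarrow> is_selection N L s"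
  shows "(\<lambda>v. grouping_cost N (vloc v) G) \<in> borel_measurable P"
  unfolding grouping_cost_def by (intro borel_measurable_sum measurable_sel_cost assms)

lemma sets_eq_None: "j \<in> I \<Longrightarrow> {v \<in> space P. v j = None} \<in> sets P"
  using measurable_sets[OF measurable_component_singleton[of j I Q], of "{None}"]
  by (auto simp: None_in_sets_opt vimage_def Int_def conj_commute)

lemma sets_neq_None: "j \<in> I \<Longrightarrow> {v \<in> space P. v j \<noteq> None} \<in> sets P"
  by (rule sets.sets_Collect_neg[OF sets_eq_None])

text \<open>Once the set \<open>S\<close> of surviving labels is fixed, selections and groupings
  range over finite families independent of \<open>v\<close>; events are finite unions over
  \<open>S\<close>.\<close>

definition "Pat S = {v \<in> space P. present v I = S}"

lemma sets_Pat: "Pat S \<in> sets P"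
proof (cases "S \<subseteq> I")
  case True
  have "Pat S = {v \<in> space P. \<forall>j\<in>I. if j \<in> S then v j \<noteq> None else v j = None}"
    using True by (auto simp: Pat_def present_def)
  moreover have "\<dots> \<in> sets P"
    by (intro sets.sets_Collect_finite_All finI) (auto simp: sets_eq_None sets_neq_None)
  ultimately show ?thesis by simp
next
  case False then have "Pat S = {}" by (auto simp: Pat_def present_def)
  then show ?thesis by simp
qed

lemma slice_subset: "S \<subseteq> I \<Longrightarrow> i < N \<Longrightarrow> slice S i \<subseteq> L i"
  by (auto simp: slice_def in_I_iff)

lemma finite_slice: "S \<subseteq> I \<Longrightarrow> i < N \<Longrightarrow> finite (slice S i)"
  by (rule finite_subset[OF slice_subset fin])

lemma selection_slice: "S \<subseteq> I \<Longrightarrow> is_selection N (slice S) s \<Longrightarrow> is_selection N L s"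
  by (rule is_selection_mono[of N "slice S"]) (use slice_subset in auto)

lemma grouping_slice: "S \<subseteq> I \<Longrightarrow> is_grouping N (slice S) G \<Longrightarrow> s \<in> G \<Longrightarrow> is_selection N L s"
  using groupingD(1) selection_slice by blast

definition "Bad = {v \<in> space P. \<not> generic_at N (slice (present v I)) (vloc v)}"

lemma null_hc:
  assumes "j \<in> I"
  shows "{v \<in> space P. v j \<noteq> None \<and> hc (the (v j)) \<le> 0} \<in> null_sets P"
proof (rule PiM_null_set_slices[of I j B _ c w, OF finI assms B])
  have "{v \<in> space P. hc (the (v j)) \<le> 0} \<in> sets P"
    using measurable_the_P[OF hc_measurable assms] by measurable
  from sets.Int[OF sets_neq_None[OF assms] this]
  show "{v \<in> space P. v j \<noteq> None \<and> hc (the (v j)) \<le> 0} \<in> sets P"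
    by (simp add: Int_def conj_ac cong: conj_cong)
  fix x
  have "{p. x(j := Some p) \<in> {v \<in> space P. v j \<noteq> None \<and> hc (the (v j)) \<le> 0}} \<inter> B j = {}"
    using hcB assms by (cases j) (force simp: in_I_iff)
  then show "emeasure lborel ({p. x(j := Some p) \<in> {v \<in> space P. v j \<noteq> None \<and> hc (the (v j)) \<le> 0}} \<inter> B j) = 0"
    by simp
qed auto

lemma sets_sel_hc_eq:
  assumes "is_selection N L s" "is_selection N L t"
  shows "{v \<in> space P. sel_hc N (vloc v) s = sel_hc N (vloc v) t} \<in> sets P"
  using measurable_sel_sum[OF hc_measurable assms(1)] measurable_sel_sum[OF hc_measurable assms(2)] by measurable

lemma sets_grouping_cost_eq:
  assumes "\<And>s. s \<in> G \<Longrightarrow> is_selection N L s" "\<And>s. s \<in> G' \<Longrightarrow> is_selection N L s"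
  shows "{v \<in> space P. grouping_cost N (vloc v) G = grouping_cost N (vloc v) G'} \<in> sets P"
  using measurable_grouping_cost[OF assms(1)] measurable_grouping_cost[OF assms(2)] by measurable

text \<open>The label occurs in \<open>s\<close> and not in \<open>t\<close>, so raising its point
  changes one height sum and leaves the other fixed.\<close>

lemma null_sel_hc:
  assumes s: "is_selection N L s" "is_selection N L t" "s i = Some l" "t i \<noteq> Some l"
  shows "{v \<in> space P. v (i, l) \<noteq> None \<and> sel_hc N (vloc v) s = sel_hc N (vloc v) t} \<in> null_sets P" (is "?E \<in> _")
proof -
  have i: "i < N" using s(1,3) by (metis is_selection_def leI option.distinct(1))
  then have I: "(i, l) \<in> I" using s(1,3) by (auto simp: is_selection_def in_I_iff)
  show ?thesis
  proof (rule PiM_null_set_planar[of I "(i, l)" B _ c w, OF finI I B])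
    have "{v \<in> space P. sel_hc N (vloc v) s = sel_hc N (vloc v) t} \<in> sets P"
      using measurable_sel_sum[OF hc_measurable s(1)] measurable_sel_sum[OF hc_measurable s(2)] by measurable
    from sets.Int[OF sets_neq_None[OF I] this]
    show "?E \<in> sets P" by (simp add: Int_def conj_ac cong: conj_cong)
    fix x m h h' assume "x((i, l) := Some (m - h, m + h)) \<in> ?E" "x((i, l) := Some (m - h', m + h')) \<in> ?E"
    then show "h = h'"
      using s(3,4) i by (simp add: sel_sum_update)
  qed auto
qed

text \<open>Coinciding height sums are excluded here because the slope of the cost difference could
  vanish there; they are covered by \<open>null_sel_hc\<close>.\<close>

lemma null_grouping_cost:
  assumes S: "S \<subseteq> I" and G: "is_grouping N (slice S) G" "is_grouping N (slice S) G'" "G \<noteq> G'"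
  shows "{v \<in> space P. (\<forall>j\<in>S. v j \<noteq> None) \<and> grouping_cost N (vloc v) G = grouping_cost N (vloc v) G' \<and>
      (\<forall>s\<in>G. \<forall>t\<in>G'. s \<noteq> t \<longrightarrow> sel_hc N (vloc v) s \<noteq> sel_hc N (vloc v) t)} \<in> null_sets P" (is "?E \<in> _")
proof -
  note finS = finite_slice[OF S]
  \<comment> \<open>The point to be moved is a label of a selection \<open>s\<close> of
    \<open>G\<close> that is not in \<open>G'\<close>; the selection \<open>t\<close> of
    \<open>G'\<close> with this label then differs from \<open>s\<close>.\<close>
  have "\<not> G \<subseteq> G'" using grouping_subset_eq[OF G(1,2)] G(3) by auto
  then obtain s where s: "s \<in> G" "s \<notin> G'" by auto
  obtain i l where il: "i < N" "l \<in> slice S i" "s i = Some l"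
    using selection_nonempty[OF groupingD[OF G(1) s(1)]] .
  obtain t where t: "t \<in> G'" "t i = Some l" using grouping_ex[OF G(2) il(1,2)] .
  have a: "(i, l) \<in> S" using il by (simp add: slice_def)
  have fG: "finite G" "finite G'" using finite_grouping[OF finS] G by auto
  show ?thesis
  proof (rule PiM_null_set_planar[of I "(i, l)" B _ c w, OF finI _ B])
    show "(i, l) \<in> I" using a S by auto
    have 1: "{v \<in> space P. \<forall>j\<in>S. v j \<noteq> None} \<in> sets P"
      by (intro sets.sets_Collect_finite_All sets_neq_None) (use S finI in \<open>auto intro: finite_subset\<close>)
    have 2: "{v \<in> space P. grouping_cost N (vloc v) G = grouping_cost N (vloc v) G'} \<in> sets P"
      using measurable_grouping_cost[of G] measurable_grouping_cost[of G'] grouping_slice[OF S G(1)] grouping_slice[OF S G(2)]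
      by measurable
    have 3: "{v \<in> space P. s \<noteq> t \<longrightarrow> sel_hc N (vloc v) s \<noteq> sel_hc N (vloc v) t} \<in> sets P"
      if "s \<in> G" "t \<in> G'" for s t
      using grouping_slice[OF S G(1) that(1)] grouping_slice[OF S G(2) that(2)]
      by (intro sets.sets_Collect_imp sets.sets_Collect_const sets.sets_Collect_neg sets_sel_hc_eq)
    show "?E \<in> sets P"
      by (intro sets.sets_Collect_conj 1 2 sets.sets_Collect_finite_All 3 fG)
    show "v (i, l) \<noteq> None" if "v \<in> ?E" for v using that a by auto
    fix x m h h' assume x: "x((i, l) := Some (m - h, m + h)) \<in> ?E" "x((i, l) := Some (m - h', m + h')) \<in> ?E"
    show "h = h'"
    proof (rule grouping_cost_eq_unique[OF N finS G(1,2) s(1) t(1), of "(i, l)"])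
      show "sel_hc N (vloc (x((i, l) := Some (m - h, m + h)))) s \<noteq> sel_hc N (vloc (x((i, l) := Some (m - h, m + h)))) t"
      proof -
        have "\<forall>s\<in>G. \<forall>t\<in>G'. s \<noteq> t \<longrightarrow> sel_hc N (vloc (x((i, l) := Some (m - h, m + h)))) s \<noteq>
           sel_hc N (vloc (x((i, l) := Some (m - h, m + h)))) t"
          using x(1) unfolding mem_Collect_eq by (elim conjE)
        moreover have "s \<noteq> t" using s t by auto
        ultimately show ?thesis using s(1) t(1) by simp
      qed
    qed (use il t x in auto)
  qed
qed

lemma sets_generic:
  assumes S: "S \<subseteq> I"
  shows "{v \<in> space P. generic_at N (slice S) (vloc v)} \<in> sets P"
proof -
  have eq: "generic_at N (slice S) (vloc v) \<longleftrightarrow> (\<forall>j\<in>S. hc (the (v j)) > 0) \<and>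
      (\<forall>s\<in>{s. is_selection N (slice S) s}. \<forall>t\<in>{s. is_selection N (slice S) s}.
         s \<noteq> t \<longrightarrow> sel_hc N (vloc v) s \<noteq> sel_hc N (vloc v) t) \<and>
      (\<forall>G\<in>{G. is_grouping N (slice S) G}. \<forall>G'\<in>{G. is_grouping N (slice S) G}.
         G \<noteq> G' \<longrightarrow> grouping_cost N (vloc v) G \<noteq> grouping_cost N (vloc v) G')" for v
  proof -
    have "(\<forall>i<N. \<forall>l\<in>slice S i. hc (vloc v i l) > 0) \<longleftrightarrow> (\<forall>j\<in>S. hc (the (v j)) > 0)"
      using S by (force simp: slice_def vloc_def in_I_iff)
    then show ?thesis unfolding generic_at_def by simp
  qed
  have 1: "{v \<in> space P. hc (the (v j)) > 0} \<in> sets P" if "j \<in> S" for j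
  proof -
    have "(\<lambda>v. hc (the (v j))) \<in> borel_measurable P"
      using measurable_the_P[OF hc_measurable, of j] that S by auto
    then show ?thesis by measurable
  qed
  have 2: "{v \<in> space P. s \<noteq> t \<longrightarrow> sel_hc N (vloc v) s \<noteq> sel_hc N (vloc v) t} \<in> sets P"
    if "s \<in> {s. is_selection N (slice S) s}" "t \<in> {s. is_selection N (slice S) s}" for s t
    using selection_slice[OF S] that
    by (intro sets.sets_Collect_imp sets.sets_Collect_const sets.sets_Collect_neg sets_sel_hc_eq) auto
  have 3: "{v \<in> space P. G \<noteq> G' \<longrightarrow> grouping_cost N (vloc v) G \<noteq> grouping_cost N (vloc v) G'} \<in> sets P"
    if "G \<in> {G. is_grouping N (slice S) G}" "G' \<in> {G. is_grouping N (slice S) G}" for G G'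
    using grouping_slice[OF S] that
    by (intro sets.sets_Collect_imp sets.sets_Collect_const sets.sets_Collect_neg sets_grouping_cost_eq) auto
  have fS: "finite S" using S finI by (rule finite_subset)
  note fs = finite_selections[OF finite_slice[OF S]] and fg = finite_groupings[OF finite_slice[OF S]]
  have c1: "{v \<in> space P. \<forall>j\<in>S. hc (the (v j)) > 0} \<in> sets P"
    by (intro sets.sets_Collect_finite_All 1 fS)
  have c2: "{v \<in> space P. \<forall>s\<in>{s. is_selection N (slice S) s}. \<forall>t\<in>{s. is_selection N (slice S) s}.
      s \<noteq> t \<longrightarrow> sel_hc N (vloc v) s \<noteq> sel_hc N (vloc v) t} \<in> sets P"
    by (intro sets.sets_Collect_finite_All fs 2)
  have c3: "{v \<in> space P. \<forall>G\<in>{G. is_grouping N (slice S) G}. \<forall>G'\<in>{G. is_grouping N (slice S) G}.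
      G \<noteq> G' \<longrightarrow> grouping_cost N (vloc v) G \<noteq> grouping_cost N (vloc v) G'} \<in> sets P"
    by (intro sets.sets_Collect_finite_All fg 3)
  show ?thesis
    unfolding eq by (intro sets.sets_Collect_conj c1 c2 c3)
qed

lemma sets_Bad: "Bad \<in> sets P"
proof -
  have "Bad = (\<Union>S\<in>Pow I. Pat S - {v \<in> space P. generic_at N (slice S) (vloc v)})"
  proof (intro set_eqI iffI)
    fix v assume "v \<in> Bad"
    then show "v \<in> (\<Union>S\<in>Pow I. Pat S - {v \<in> space P. generic_at N (slice S) (vloc v)})"
      by (intro UN_I[of "present v I"]) (auto simp: Bad_def Pat_def, auto simp: present_def)
  qed (auto simp: Bad_def Pat_def)
  moreover have "Pat S - {v \<in> space P. generic_at N (slice S) (vloc v)} \<in> sets P" if "S \<in> Pow I" for S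
    using sets.Diff[OF sets_Pat sets_generic] that by auto
  then have "(\<Union>S\<in>Pow I. Pat S - {v \<in> space P. generic_at N (slice S) (vloc v)}) \<in> sets P"
    using finI by (intro sets.finite_UN) auto
  ultimately show ?thesis by simp
qed

text \<open>A non-generic family has a point not above the diagonal, or two selections with equal
  height sums, or, failing these, two groupings of equal cost. Each alternative is a finite union of
  null sets.\<close>

lemma null_Bad: "Bad \<in> null_sets P"
proof -
  let ?Sel = "{s. is_selection N L s}"
  define T1 where "T1 = (\<Union>j\<in>I. {v \<in> space P. v j \<noteq> None \<and> hc (the (v j)) \<le> 0})"
  define I2 where "I2 = {((s, t), (i, l)) \<in> (?Sel \<times> ?Sel) \<times> I. s i = Some l \<and> t i \<noteq> Some l}"
  define E2 where "E2 = (\<lambda>((s, t), (i, l)). {v \<in> space P. v (i, l) \<noteq> None \<and> sel_hc N (vloc v) s = sel_hc N (vloc v) t})"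
  define I3 where "I3 = {(S, (G, G')) \<in> Pow I \<times> (Pow ?Sel \<times> Pow ?Sel).
     is_grouping N (slice S) G \<and> is_grouping N (slice S) G' \<and> G \<noteq> G'}"
  define E3 where "E3 = (\<lambda>(S, (G, G')). {v \<in> space P. (\<forall>j\<in>S. v j \<noteq> None) \<and>
      grouping_cost N (vloc v) G = grouping_cost N (vloc v) G' \<and>
      (\<forall>s\<in>G. \<forall>t\<in>G'. s \<noteq> t \<longrightarrow> sel_hc N (vloc v) s \<noteq> sel_hc N (vloc v) t)})"
  note finS = finite_selections[OF fin]
  have f2: "finite I2"
    unfolding I2_def by (rule finite_subset[of _ "(?Sel \<times> ?Sel) \<times> I"]) (use finS finI in auto)
  have f3: "finite I3"
    unfolding I3_def by (rule finite_subset[of _ "Pow I \<times> (Pow ?Sel \<times> Pow ?Sel)"]) (use finS finI in auto)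
  have n1: "T1 \<in> null_sets P"
    unfolding T1_def by (intro null_sets_UN' countable_finite finI null_hc)
  have n2: "(\<Union>x\<in>I2. E2 x) \<in> null_sets P"
  proof (intro null_sets_UN' countable_finite f2)
    fix x assume "x \<in> I2"
    then obtain s t i l where x: "x = ((s, t), (i, l))" "is_selection N L s" "is_selection N L t"
       "s i = Some l" "t i \<noteq> Some l" unfolding I2_def by blast
    then show "E2 x \<in> null_sets P" unfolding E2_def using null_sel_hc[OF x(2-5)] by simp
  qed
  have n3: "(\<Union>x\<in>I3. E3 x) \<in> null_sets P"
  proof (intro null_sets_UN' countable_finite f3)
    fix x assume "x \<in> I3"
    then obtain S G G' where x: "x = (S, (G, G'))" "S \<subseteq> I" "is_grouping N (slice S) G" "is_grouping N (slice S) G'"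
       "G \<noteq> G'" unfolding I3_def by blast
    then show "E3 x \<in> null_sets P" unfolding E3_def using null_grouping_cost[OF x(2-5)] by simp
  qed
  have "Bad \<subseteq> T1 \<union> (\<Union>x\<in>I2. E2 x) \<union> (\<Union>x\<in>I3. E3 x)"
  proof
    fix v assume "v \<in> Bad"
    then have v: "v \<in> space P" "\<not> generic_at N (slice (present v I)) (vloc v)" by (auto simp: Bad_def)
    let ?S = "present v I"
    have SI: "?S \<subseteq> I" by (auto simp: present_def)
    show "v \<in> T1 \<union> (\<Union>x\<in>I2. E2 x) \<union> (\<Union>x\<in>I3. E3 x)"
    proof (rule ccontr)
      assume "v \<notin> T1 \<union> (\<Union>x\<in>I2. E2 x) \<union> (\<Union>x\<in>I3. E3 x)"
      then have v1: "v \<notin> T1" and v2: "\<And>x. x \<in> I2 \<Longrightarrow> v \<notin> E2 x" and v3: "\<And>x. x \<in> I3 \<Longrightarrow> v \<notin> E3 x" by auto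
      have a: "hc (vloc v i l) > 0" if "i < N" "l \<in> slice ?S i" for i l
      proof -
        have "(i, l) \<in> I" "v (i, l) \<noteq> None" using that by (auto simp: present_def slice_def)
        then show ?thesis using v1 v(1) unfolding T1_def vloc_def by force
      qed
      have b0: "sel_hc N (vloc v) s \<noteq> sel_hc N (vloc v) t"
        if "is_selection N (slice ?S) s" "is_selection N (slice ?S) t" "s i = Some l" "t i \<noteq> Some l" for s t i l
      proof -
        have i: "i < N" using that(1,3) by (metis is_selection_def leI option.distinct(1))
        then have "(i, l) \<in> ?S" using that(1,3) by (auto simp: is_selection_def slice_def)
        then have il: "(i, l) \<in> I" "v (i, l) \<noteq> None" by (auto simp: present_def)
        moreover have "is_selection N L s" "is_selection N L t" using selection_slice[OF SI] that by auto
        ultimately have "((s, t), (i, l)) \<in> I2" using that by (simp add: I2_def)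
        from v2[OF this] show ?thesis using v(1) il(2) by (simp add: E2_def del: not_None_eq)
      qed
      have b: "sel_hc N (vloc v) s \<noteq> sel_hc N (vloc v) t"
        if "is_selection N (slice ?S) s" "is_selection N (slice ?S) t" "s \<noteq> t" for s t
      proof -
        obtain i where i: "s i \<noteq> t i" using \<open>s \<noteq> t\<close> by auto
        show ?thesis
        \<comment> \<open>\<open>b0\<close> asks for a label which only its first selection has; the
          roles are exchanged when \<open>s i\<close> is \<Delta>.\<close>
        proof (cases "s i")
          case None
          then obtain l where "t i = Some l" using i by (cases "t i") auto
          then show ?thesis using b0[OF that(2,1), of i l] None by auto
        next
          case (Some l)
          then show ?thesis using b0[OF that(1,2), of i l] i by auto
        qed
      qed
      have c: "grouping_cost N (vloc v) G \<noteq> grouping_cost N (vloc v) G'"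
        if G: "is_grouping N (slice ?S) G" "is_grouping N (slice ?S) G'" "G \<noteq> G'" for G G'
      proof
        assume e: "grouping_cost N (vloc v) G = grouping_cost N (vloc v) G'"
        have "(?S, (G, G')) \<in> I3"
          using G SI grouping_slice[OF SI G(1)] grouping_slice[OF SI G(2)] by (auto simp: I3_def)
        moreover have "\<forall>j\<in>?S. v j \<noteq> None" by (auto simp: present_def)
        moreover have "\<forall>s\<in>G. \<forall>t\<in>G'. s \<noteq> t \<longrightarrow> sel_hc N (vloc v) s \<noteq> sel_hc N (vloc v) t"
          using b groupingD(1)[OF G(1)] groupingD(1)[OF G(2)] by blast
        ultimately show False using v3[of "(?S, (G, G'))"] v(1) e by (simp add: E3_def)
      qed
      show False using v(2) a b c by (simp add: generic_at_def)
    qed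
  qed
  moreover have "T1 \<union> (\<Union>x\<in>I2. E2 x) \<union> (\<Union>x\<in>I3. E3 x) \<in> null_sets P"
    using n1 n2 n3 by (intro null_sets.Un)
  ultimately show ?thesis by (intro null_sets_subset[OF _ sets_Bad])
qed

end

section \<open>The random grouping\<close>

lemma trivial_selection_eq_Some [simp]: "trivial_selection i l k = Some m \<longleftrightarrow> k = i \<and> m = l"
  by (auto simp: trivial_selection_def)

lemma trivial_selection_nonempty [simp]: "trivial_selection i l \<noteq> (\<lambda>_. None)"
  by (auto simp: trivial_selection_def fun_eq_iff)

lemma is_selection_trivial: "i < N \<Longrightarrow> l \<in> L i \<Longrightarrow> is_selection N L (trivial_selection i l)"
  by (auto simp: is_selection_def trivial_selection_def)

definition trivials :: "(nat \<times> 'l) set \<Rightarrow> 'l selection set" where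
  "trivials S = {trivial_selection i l | i l. (i, l) \<in> S}"

text \<open>Strict minimality leaves room for at most one such grouping. It is the combinatorial
  counterpart of optimality for the Frechet function.\<close>

definition minimal_grouping :: "nat \<Rightarrow> (nat \<Rightarrow> 'l set) \<Rightarrow> (nat \<Rightarrow> 'l \<Rightarrow> point) \<Rightarrow> 'l selection set \<Rightarrow> bool" where
  "minimal_grouping N L loc G \<longleftrightarrow> is_grouping N L G \<and>
     (\<forall>G'. is_grouping N L G' \<longrightarrow> G' \<noteq> G \<longrightarrow> grouping_cost N loc G < grouping_cost N loc G')"

text \<open>Provides a grouping to start from, so that a cheapest one exists. Pairs with index at
  least \<open>N\<close> are removed, since selections have no entries there.\<close>

lemma is_grouping_trivials: "is_grouping N (slice S) (trivials {j \<in> S. fst j < N})"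
proof -
  have "\<exists>!s. s \<in> trivials {j \<in> S. fst j < N} \<and> s i = Some l" if "i < N" "(i, l) \<in> S" for i l
    using that by (intro ex1I[of _ "trivial_selection i l"]) (auto simp: trivials_def)
  then show ?thesis
    by (auto simp: is_grouping_def trivials_def slice_def intro: is_selection_trivial)
qed

lemma ex_minimal_grouping:
  assumes fin: "\<And>i. i < N \<Longrightarrow> finite (slice S i)" and gen: "generic_at N (slice S) loc"
  shows "\<exists>G. minimal_grouping N (slice S) loc G"
proof -
  let ?A = "{G. is_grouping N (slice S) G}"
  have "finite ?A" "?A \<noteq> {}" using finite_groupings[OF fin] is_grouping_trivials[of N S] by auto
  then obtain G where G: "G \<in> ?A" "\<And>G'. G' \<in> ?A \<Longrightarrow> grouping_cost N loc G \<le> grouping_cost N loc G'"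
    using ex_min_if_finite[of "grouping_cost N loc ` ?A"] by (fastforce simp: not_less)
  have "minimal_grouping N (slice S) loc G"
    unfolding minimal_grouping_def
  proof (intro conjI allI impI)
    fix G' assume G': "is_grouping N (slice S) G'" "G' \<noteq> G"
    have "grouping_cost N loc G' \<noteq> grouping_cost N loc G"
    proof -
      have "\<forall>G G'. is_grouping N (slice S) G \<longrightarrow> is_grouping N (slice S) G' \<longrightarrow> G \<noteq> G' \<longrightarrow>
        grouping_cost N loc G \<noteq> grouping_cost N loc G'"
        using gen unfolding generic_at_def by (elim conjE)
      then show ?thesis using G' G(1) by simp
    qed
    with G' show "grouping_cost N loc G < grouping_cost N loc G'" using G(2)[of G'] by simp
  qed (use G in auto)
  then show ?thesis ..
qed

lemma optimal_grouping_generic: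
  assumes "N \<ge> 1" "\<And>i. i < N \<Longrightarrow> finite (L i)" "generic_at N L loc" "minimal_grouping N L loc G0"
  shows "optimal_grouping N L loc G \<longleftrightarrow> G = G0"
proof (rule optimal_grouping_iff[OF assms(1)])
  have hc: "hc (loc i l) > 0" if "i < N" "l \<in> L i" for i l
    using assms(3) that by (simp add: generic_at_def)
  show "loc i l \<notin> diag" if "i < N" "l \<in> L i" for i l
    using hc[OF that] by (simp add: in_diag_iff)
  show "hc (loc i l) > 0" if "i < N" "l \<in> L i" for i l using hc[OF that] .
qed (use assms in \<open>auto simp: generic_at_def minimal_grouping_def\<close>)

text \<open>The labels outside \<open>S\<close>, those sent to \<Delta>, occur in no selection of
  \<open>G\<close>; their trivial selections complete it to a grouping of all labels.\<close>

lemma is_grouping_Un_trivials: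
  assumes G: "is_grouping N (slice S) G" and S: "S \<subseteq> Sigma {..<N} L"
  shows "is_grouping N L (G \<union> trivials (Sigma {..<N} L - S))"
  unfolding is_grouping_def
proof (intro conjI ballI allI impI)
  fix s assume "s \<in> G \<union> trivials (Sigma {..<N} L - S)"
  moreover have "is_selection N L s" if "s \<in> G"
    by (rule is_selection_mono[OF _ groupingD(1)[OF G that]]) (use S in \<open>auto simp: slice_def\<close>)
  ultimately show "is_selection N L s" "s \<noteq> (\<lambda>_. None)"
    using groupingD(2)[OF G, of s]
    by (auto simp: trivials_def trivial_selection_nonempty[symmetric] intro: is_selection_trivial)
next
  fix i l assume il: "i < N" "l \<in> L i"
  show "\<exists>!s. s \<in> G \<union> trivials (Sigma {..<N} L - S) \<and> s i = Some l"
  proof (cases "(i, l) \<in> S")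
    case True
    then obtain s where s: "s \<in> G" "s i = Some l"
      using grouping_ex[OF G il(1)] by (auto simp: slice_def)
    show ?thesis
    proof (rule ex1I[of _ s])
      fix t assume t: "t \<in> G \<union> trivials (Sigma {..<N} L - S) \<and> t i = Some l"
      then have "t \<in> G" using True by (auto simp: trivials_def)
      then show "t = s" using t s grouping_unique[OF G _ s(1) il(1) _ s(2)] by blast
    qed (use s in auto)
  next
    case False
    have "t i \<noteq> Some l" if "t \<in> G" for t
      using groupingD(1)[OF G that] il False by (auto simp: is_selection_def slice_def)
    then show ?thesis
      using il False by (intro ex1I[of _ "trivial_selection i l"]) (auto simp: trivials_def)
  qed
qed

context perturbed_points begin

definition "rand_grouping v = (THE G. optimal_grouping N (\<lambda>i. {x \<in> L i. v (i, x) \<noteq> None}) (\<lambda>i x. the (v (i, x))) G) \<union>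
     {trivial_selection i x | i x. i < N \<and> x \<in> L i \<and> v (i, x) = None}"

lemma present_subset: "present v I \<subseteq> I"
  by (auto simp: present_def)

lemma generic_off_Bad: "v \<in> space P \<Longrightarrow> v \<notin> Bad \<Longrightarrow> generic_at N (slice (present v I)) (vloc v)"
  by (auto simp: Bad_def)

text \<open>Off \<open>Bad\<close> the description by \<open>THE\<close> has a unique solution, the
  cheapest grouping, and that one is determined by finitely many measurable comparisons of
  costs.\<close>

lemma rand_grouping_eq:
  assumes v: "v \<in> space P" "v \<notin> Bad" and G0: "minimal_grouping N (slice (present v I)) (vloc v) G0"
  shows "rand_grouping v = G0 \<union> trivials (I - present v I)"
proof -
  let ?L = "\<lambda>i. {x \<in> L i. v (i, x) \<noteq> None}"
  have L: "slice (present v I) i = ?L i" if "i < N" for i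
    using that by (auto simp: slice_def present_def in_I_iff)
  have "optimal_grouping N ?L (vloc v) G \<longleftrightarrow> G = G0" for G
  proof (rule optimal_grouping_generic[OF N])
    show "generic_at N ?L (vloc v)"
      using generic_off_Bad[OF v] generic_at_cong[of N "slice (present v I)" ?L] L by simp
    show "minimal_grouping N ?L (vloc v) G0"
      using G0 is_grouping_cong[of N "slice (present v I)" ?L] L by (simp add: minimal_grouping_def)
  qed (use fin in auto)
  then have "(THE G. optimal_grouping N ?L (\<lambda>i x. the (v (i, x))) G) = G0"
    by (simp add: vloc_def[abs_def])
  moreover have "{trivial_selection i x | i x. i < N \<and> x \<in> L i \<and> v (i, x) = None} = trivials (I - present v I)"
  proof -
    have "I - present v I = {(i, x). i < N \<and> x \<in> L i \<and> v (i, x) = None}"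
    proof -
      have "I - present v I = {j \<in> I. v j = None}" unfolding present_def by (rule set_eqI) (simp only: Diff_iff mem_Collect_eq, argo)
      also have "\<dots> = {(i, x). i < N \<and> x \<in> L i \<and> v (i, x) = None}" by (auto simp: in_I_iff)
      finally show ?thesis .
    qed
    then show ?thesis by (simp add: trivials_def)
  qed
  ultimately show ?thesis by (simp add: rand_grouping_def)
qed

lemma ex_minimal_off_Bad:
  assumes "v \<in> space P" "v \<notin> Bad"
  shows "\<exists>G. minimal_grouping N (slice (present v I)) (vloc v) G"
  by (rule ex_minimal_grouping[OF finite_slice[OF present_subset] generic_off_Bad[OF assms]])

lemma rand_grouping_grouping:
  assumes v: "v \<in> space P" "v \<notin> Bad"
  shows "is_grouping N L (rand_grouping v)"
proof -
  obtain G where G: "minimal_grouping N (slice (present v I)) (vloc v) G" using ex_minimal_off_Bad[OF v] by auto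
  then show ?thesis
    using is_grouping_Un_trivials[of N "present v I" G L] present_subset[of v]
    by (simp add: rand_grouping_eq[OF v G] minimal_grouping_def I_def)
qed

text \<open>On \<open>Bad\<close> the description by \<open>THE\<close> is not under control;
  leaving \<open>Bad\<close> out yields an event that is measurable before completion.\<close>

definition "grouping_event G = {v \<in> space P - Bad. rand_grouping v = G}"

text \<open>A finite union, over the sets \<open>S\<close> of surviving labels and the groupings
  \<open>G0\<close> that extend to \<open>G\<close>, of the events that \<open>G0\<close> is
  cheapest.\<close>

lemma grouping_event_sets: "grouping_event G \<in> sets P"
proof -
  define A where "A S = {G0. is_grouping N (slice S) G0 \<and> G0 \<union> trivials (I - S) = G}" for S
  define E where "E S G0 = (Pat S - Bad) \<inter>
    {v \<in> space P. \<forall>G'\<in>{G'. is_grouping N (slice S) G'} - {G0}. grouping_cost N (vloc v) G0 < grouping_cost N (vloc v) G'}" for S G0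
  have "grouping_event G = (\<Union>S\<in>Pow I. \<Union>G0\<in>A S. E S G0)"
  proof (intro set_eqI iffI)
    fix v assume "v \<in> grouping_event G"
    then have v: "v \<in> space P" "v \<notin> Bad" "rand_grouping v = G" by (auto simp: grouping_event_def)
    obtain G0 where G0: "minimal_grouping N (slice (present v I)) (vloc v) G0" using ex_minimal_off_Bad[OF v(1,2)] by auto
    have "G0 \<in> A (present v I)" using rand_grouping_eq[OF v(1,2) G0] v(3) G0 by (simp add: A_def minimal_grouping_def)
    moreover have "v \<in> E (present v I) G0" using v G0 by (auto simp: E_def Pat_def minimal_grouping_def)
    ultimately show "v \<in> (\<Union>S\<in>Pow I. \<Union>G0\<in>A S. E S G0)" using present_subset by blast
  next
    fix v assume "v \<in> (\<Union>S\<in>Pow I. \<Union>G0\<in>A S. E S G0)"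
    then obtain S G0 where *: "G0 \<in> A S" "v \<in> E S G0" by auto
    then have v: "v \<in> space P" "v \<notin> Bad" "present v I = S" by (auto simp: E_def Pat_def)
    have "minimal_grouping N (slice (present v I)) (vloc v) G0"
      using * by (auto simp: v(3) A_def E_def minimal_grouping_def)
    from rand_grouping_eq[OF v(1,2) this] show "v \<in> grouping_event G"
      using *(1) v by (simp add: grouping_event_def A_def)
  qed
  moreover have "E S G0 \<in> sets P" if S: "S \<in> Pow I" and G0: "G0 \<in> A S" for S G0
    unfolding E_def
  proof (intro sets.Int sets.Diff sets_Pat sets_Bad sets.sets_Collect_finite_All)
    have S: "S \<subseteq> I" using S by auto
    show "finite ({G'. is_grouping N (slice S) G'} - {G0})"
      using finite_groupings[OF finite_slice[OF S]] by auto
    fix G' assume "G' \<in> {G'. is_grouping N (slice S) G'} - {G0}"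
    then show "{v \<in> space P. grouping_cost N (vloc v) G0 < grouping_cost N (vloc v) G'} \<in> sets P"
      using measurable_grouping_cost[of G0] measurable_grouping_cost[of G'] grouping_slice[OF S] G0
      by (intro borel_measurable_less) (auto simp: A_def)
  qed
  moreover have "finite (A S)" if "S \<in> Pow I" for S
    by (rule finite_subset[OF _ finite_groupings[OF finite_slice]]) (use that in \<open>auto simp: A_def\<close>)
  ultimately show ?thesis using finI by (auto intro!: sets.finite_UN)
qed

text \<open>The two events differ only inside the null set \<open>Bad\<close>; the completion makes
  the first of them measurable.\<close>

lemma measure_rand_grouping_completion:
  "measure (completion P) {v \<in> space (completion P). rand_grouping v = G} = measure P (grouping_event G)"
proof -
  let ?E = "{v \<in> space P. rand_grouping v = G}"
  have split: "?E = grouping_event G \<union> (?E \<inter> Bad)" by (auto simp: grouping_event_def)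
  have E: "?E \<in> sets (completion P)"
    by (rule sets_completionI[OF split _ null_Bad grouping_event_sets]) auto
  have "AE v in completion P. v \<notin> Bad" using null_Bad by (intro AE_completion AE_not_in)
  then have "measure (completion P) ?E = measure (completion P) (grouping_event G)"
    using E grouping_event_sets by (intro measure_eq_AE) (auto simp: grouping_event_def)
  then show ?thesis using grouping_event_sets by simp
qed

lemma sum_grouping_event:
  assumes "prob_space P"
  shows "(\<Sum>G | is_grouping N L G. measure P (grouping_event G)) = 1"
proof -
  interpret P: prob_space P by fact
  have fin: "finite {G. is_grouping N L G}" by (rule finite_groupings[OF fin])
  have "(\<Sum>G | is_grouping N L G. measure P (grouping_event G)) = measure P (\<Union>G\<in>{G. is_grouping N L G}. grouping_event G)"
    using fin grouping_event_sets
    by (intro P.finite_measure_finite_Union[symmetric]) (auto simp: disjoint_family_on_def grouping_event_def)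
  also have "(\<Union>G\<in>{G. is_grouping N L G}. grouping_event G) = space P - Bad"
    using rand_grouping_grouping by (auto simp: grouping_event_def)
  also have "measure P (space P - Bad) = 1"
    using null_Bad by (simp add: P.prob_compl[OF sets_Bad] measure_eq_0_null_sets)
  finally show ?thesis .
qed

end

section \<open>Discrete measures and couplings\<close>

text \<open>The index set is kept apart from the values because distinct groupings may have equal
  means: transport plans are built on indices and then pushed forward.\<close>

definition fin_meas :: "'a measure \<Rightarrow> 'i set \<Rightarrow> ('i \<Rightarrow> real) \<Rightarrow> ('i \<Rightarrow> 'a) \<Rightarrow> 'a measure" where
  "fin_meas B A p f = distr (point_measure A (\<lambda>i. ennreal (p i))) B f"

lemma sets_fin_meas [simp]: "sets (fin_meas B A p f) = sets B"
  and space_fin_meas [simp]: "space (fin_meas B A p f) = space B"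
  by (simp_all add: fin_meas_def)

lemma emeasure_fin_meas:
  assumes "finite A" "f \<in> A \<rightarrow> space B" "S \<in> sets B"
  shows "emeasure (fin_meas B A p f) S = (\<Sum>i\<in>A. ennreal (p i) * indicator S (f i))"
proof -
  have "emeasure (fin_meas B A p f) S = emeasure (point_measure A (\<lambda>i. ennreal (p i))) (f -` S \<inter> A)"
    unfolding fin_meas_def using assms by (subst emeasure_distr) (auto simp: space_point_measure)
  also have "\<dots> = (\<Sum>i\<in>f -` S \<inter> A. ennreal (p i))"
    using assms by (intro emeasure_point_measure_finite) auto
  also have "\<dots> = (\<Sum>i\<in>A. ennreal (p i) * indicator S (f i))"
    using assms by (intro sum.mono_neutral_cong_left) (auto split: split_indicator)
  finally show ?thesis .
qed

lemma measure_of_eq_fin_meas: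
  assumes "finite A" "f \<in> A \<rightarrow> space B"
  shows "measure_of (space B) (sets B) (\<lambda>S. \<Sum>i\<in>A. ennreal (p i) * indicator S (f i)) = fin_meas B A p f"
proof -
  have "measure_of (space B) (sets B) (\<lambda>S. \<Sum>i\<in>A. ennreal (p i) * indicator S (f i)) =
    measure_of (space B) (sets B) (emeasure (fin_meas B A p f))"
    by (rule measure_of_eq[OF sets.space_closed])
      (simp add: sets.sigma_sets_eq emeasure_fin_meas[OF assms])
  also have "\<dots> = fin_meas B A p f"
    using measure_of_of_measure[of "fin_meas B A p f"] by simp
  finally show ?thesis .
qed

text \<open>Stated for arbitrary \<open>h\<close>, since the squared distance is not shown to be
  measurable for the product sigma-algebra. The integral is a supremum over simple functions below
  \<open>h\<close>, and for these the formula is exact.\<close>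

lemma nn_integral_fin_meas_le:
  assumes "finite A" "f \<in> A \<rightarrow> space B"
  shows "(\<integral>\<^sup>+ x. h x \<partial>fin_meas B A p f) \<le> (\<Sum>i\<in>A. ennreal (p i) * h (f i))"
  unfolding nn_integral_def
proof (rule SUP_least, clarify)
  fix g assume g: "simple_function (fin_meas B A p f) g" "g \<le> (\<lambda>x. h x)"
  then have m: "g \<in> borel_measurable B"
    using borel_measurable_simple_function[OF g(1)] by (simp add: measurable_cong_sets[of "fin_meas B A p f" B])
  have "integral\<^sup>S (fin_meas B A p f) g = (\<integral>\<^sup>+ x. g x \<partial>fin_meas B A p f)"
    by (rule nn_integral_eq_simple_integral[OF g(1), symmetric])
  also have "\<dots> = (\<integral>\<^sup>+ i. g (f i) \<partial>point_measure A (\<lambda>i. ennreal (p i)))"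
    unfolding fin_meas_def using assms m by (intro nn_integral_distr) auto
  also have "\<dots> = (\<Sum>i\<in>A. ennreal (p i) * g (f i))"
    by (rule nn_integral_point_measure_finite[OF assms(1)])
  also have "\<dots> \<le> (\<Sum>i\<in>A. ennreal (p i) * h (f i))"
    using g(2) by (intro sum_mono mult_left_mono) (auto simp: le_fun_def)
  finally show "integral\<^sup>S (fin_meas B A p f) g \<le> (\<Sum>i\<in>A. ennreal (p i) * h (f i))" .
qed

lemma distr_fin_meas:
  assumes "f \<in> A \<rightarrow> space B" "h \<in> measurable B B'"
  shows "distr (fin_meas B A p f) B' h = fin_meas B' A p (\<lambda>i. h (f i))"
  unfolding fin_meas_def using assms by (subst distr_distr) (auto simp: comp_def)

lemma fin_meas_projection:
  assumes fin: "finite A" "finite A'" and f: "f \<in> A \<rightarrow> space B"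
    and nonneg: "\<And>i j. i \<in> A \<Longrightarrow> j \<in> A' \<Longrightarrow> q (i, j) \<ge> 0"
    and p: "\<And>i. i \<in> A \<Longrightarrow> (\<Sum>j\<in>A'. q (i, j)) = p i"
  shows "fin_meas B (A \<times> A') q (\<lambda>x. f (fst x)) = fin_meas B A p f"
proof (rule measure_eqI)
  fix S assume "S \<in> sets (fin_meas B (A \<times> A') q (\<lambda>x. f (fst x)))"
  then have S: "S \<in> sets B" by simp
  have "emeasure (fin_meas B (A \<times> A') q (\<lambda>x. f (fst x))) S = (\<Sum>x\<in>A \<times> A'. ennreal (q x) * indicator S (f (fst x)))"
    using fin f by (intro emeasure_fin_meas[OF _ _ S]) auto
  also have "\<dots> = (\<Sum>i\<in>A. (\<Sum>j\<in>A'. ennreal (q (i, j))) * indicator S (f i))"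
    by (simp add: sum.cartesian_product case_prod_unfold sum_distrib_right)
  also have "\<dots> = (\<Sum>i\<in>A. ennreal (p i) * indicator S (f i))"
    by (rule sum.cong) (simp_all add: sum_ennreal nonneg flip: p)
  also have "\<dots> = emeasure (fin_meas B A p f) S" by (rule emeasure_fin_meas[OF fin(1) f S, symmetric])
  finally show "emeasure (fin_meas B (A \<times> A') q (\<lambda>x. f (fst x))) S = emeasure (fin_meas B A p f) S" .
qed simp

lemma fin_meas_swap: "fin_meas B (A \<times> A') q h = fin_meas B (A' \<times> A) (\<lambda>x. q (prod.swap x)) (\<lambda>x. h (prod.swap x))"
  if "finite A" "finite A'" "h \<in> A \<times> A' \<rightarrow> space B"
proof (rule measure_eqI)
  fix S assume "S \<in> sets (fin_meas B (A \<times> A') q h)"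
  then have S: "S \<in> sets B" by simp
  have "bij_betw prod.swap (A' \<times> A) (A \<times> A')" by (auto simp: bij_betw_def)
  from sum.reindex_bij_betw[OF this, of "\<lambda>x. ennreal (q x) * indicator S (h x)"]
  show "emeasure (fin_meas B (A \<times> A') q h) S =
     emeasure (fin_meas B (A' \<times> A) (\<lambda>x. q (prod.swap x)) (\<lambda>x. h (prod.swap x))) S"
    using that by (subst (1 2) emeasure_fin_meas[OF _ _ S]) (auto simp: Pi_iff)
qed simp

text \<open>The transport matrix on the index sets is pushed forward by \<open>(f, g)\<close> to a
  coupling, whose cost bounds the infimum.\<close>

lemma wasserstein2_fin_meas_le:
  assumes fin: "finite A" "finite A'" and f: "f \<in> A \<rightarrow> space B" "g \<in> A' \<rightarrow> space B"
    and nonneg: "\<And>i j. i \<in> A \<Longrightarrow> j \<in> A' \<Longrightarrow> \<pi> i j \<ge> 0"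
    and p: "\<And>i. i \<in> A \<Longrightarrow> (\<Sum>j\<in>A'. \<pi> i j) = p i"
    and q: "\<And>j. j \<in> A' \<Longrightarrow> (\<Sum>i\<in>A. \<pi> i j) = q j"
  shows "wasserstein2 (fin_meas B A p f) (fin_meas B A' q g) \<le>
    esqrt (\<Sum>i\<in>A. \<Sum>j\<in>A'. ennreal (\<pi> i j) * (W2 (f i) (g j))\<^sup>2)"
proof -
  let ?\<nu> = "fin_meas B A p f" and ?\<eta> = "fin_meas B A' q g"
  let ?fg = "\<lambda>(i, j). (f i, g j)" and ?\<pi> = "\<lambda>(i, j). \<pi> i j"
  define \<gamma> where "\<gamma> = fin_meas (B \<Otimes>\<^sub>M B) (A \<times> A') ?\<pi> ?fg"
  have fg: "?fg \<in> A \<times> A' \<rightarrow> space (B \<Otimes>\<^sub>M B)" using f by (auto simp: space_pair_measure)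
  have fin2: "finite (A \<times> A')" using fin by simp
  have "distr \<gamma> ?\<nu> fst = distr \<gamma> B fst" by (rule distr_cong) simp_all
  also have "\<dots> = fin_meas B (A \<times> A') ?\<pi> (\<lambda>x. f (fst x))"
    unfolding \<gamma>_def by (subst distr_fin_meas[OF fg]) (simp_all add: case_prod_unfold)
  also have "\<dots> = ?\<nu>" by (rule fin_meas_projection[OF fin f(1)]) (use nonneg p in auto)
  finally have 1: "distr \<gamma> ?\<nu> fst = ?\<nu>" .
  have "distr \<gamma> ?\<eta> snd = distr \<gamma> B snd" by (rule distr_cong) simp_all
  also have "\<dots> = fin_meas B (A \<times> A') ?\<pi> (\<lambda>x. g (snd x))"
    unfolding \<gamma>_def by (subst distr_fin_meas[OF fg]) (simp_all add: case_prod_unfold)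
  also have "\<dots> = fin_meas B (A' \<times> A) (\<lambda>x. ?\<pi> (prod.swap x)) (\<lambda>x. g (fst x))"
    using fin f by (subst fin_meas_swap) auto
  also have "\<dots> = ?\<eta>" by (rule fin_meas_projection[OF fin(2,1) f(2)]) (use nonneg q in auto)
  finally have 2: "distr \<gamma> ?\<eta> snd = ?\<eta>" .
  have "sets \<gamma> = sets (?\<nu> \<Otimes>\<^sub>M ?\<eta>)"
    unfolding \<gamma>_def sets_fin_meas by (intro sets_pair_measure_cong) simp_all
  with 1 2 have \<gamma>: "\<gamma> \<in> couplings ?\<nu> ?\<eta>"
    by (simp add: couplings_def)
  have "(\<integral>\<^sup>+ (U, V). (W2 U V)\<^sup>2 \<partial>\<gamma>) \<le> (\<Sum>x\<in>A \<times> A'. ennreal (?\<pi> x) * (case ?fg x of (U, V) \<Rightarrow> (W2 U V)\<^sup>2))"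
    unfolding \<gamma>_def by (rule nn_integral_fin_meas_le[OF fin2 fg])
  also have "\<dots> = (\<Sum>i\<in>A. \<Sum>j\<in>A'. ennreal (\<pi> i j) * (W2 (f i) (g j))\<^sup>2)"
    by (simp add: sum.cartesian_product case_prod_unfold)
  finally have "(INF \<gamma>\<in>couplings ?\<nu> ?\<eta>. \<integral>\<^sup>+ (U, V). (W2 U V)\<^sup>2 \<partial>\<gamma>) \<le>
      (\<Sum>i\<in>A. \<Sum>j\<in>A'. ennreal (\<pi> i j) * (W2 (f i) (g j))\<^sup>2)"
    using \<gamma> by (rule INF_lower2[rotated])
  then show ?thesis unfolding wasserstein2_def by (simp add: esqrt_le_iff)
qed

text \<open>The mass not transported by the partial coupling \<open>a\<close> is transported by the product of the
  normalized residual measures.\<close>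

lemma partial_coupling_cost:
  fixes a k :: "'i \<Rightarrow> 'j \<Rightarrow> real"
  assumes fin: "finite A" "finite A'"
    and a: "\<And>i j. i \<in> A \<Longrightarrow> j \<in> A' \<Longrightarrow> a i j \<ge> 0"
    and p: "\<And>i. i \<in> A \<Longrightarrow> (\<Sum>j\<in>A'. a i j) \<le> p i" "(\<Sum>i\<in>A. p i) = 1"
    and q: "\<And>j. j \<in> A' \<Longrightarrow> (\<Sum>i\<in>A. a i j) \<le> q j" "(\<Sum>j\<in>A'. q j) = 1"
    and s: "1 - (\<Sum>i\<in>A. \<Sum>j\<in>A'. a i j) \<le> e"
    and k: "\<And>i j. i \<in> A \<Longrightarrow> j \<in> A' \<Longrightarrow> a i j > 0 \<Longrightarrow> k i j \<le> d" "\<And>i j. i \<in> A \<Longrightarrow> j \<in> A' \<Longrightarrow> k i j \<le> m"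
    and nonneg: "d \<ge> 0" "m \<ge> 0"
  shows "\<exists>\<pi>. (\<forall>i\<in>A. \<forall>j\<in>A'. \<pi> i j \<ge> 0) \<and> (\<forall>i\<in>A. (\<Sum>j\<in>A'. \<pi> i j) = p i) \<and> (\<forall>j\<in>A'. (\<Sum>i\<in>A. \<pi> i j) = q j) \<and>
     (\<Sum>i\<in>A. \<Sum>j\<in>A'. \<pi> i j * k i j) \<le> d + e * m"
proof -
  define S where "S = (\<Sum>i\<in>A. \<Sum>j\<in>A'. a i j)"
  define u where "u i = p i - (\<Sum>j\<in>A'. a i j)" for i
  define v where "v j = q j - (\<Sum>i\<in>A. a i j)" for j
  have uv: "\<And>i. i \<in> A \<Longrightarrow> u i \<ge> 0" "\<And>j. j \<in> A' \<Longrightarrow> v j \<ge> 0" using p(1) q(1) by (auto simp: u_def v_def)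
  have su: "(\<Sum>i\<in>A. u i) = 1 - S" using p(2) by (simp add: u_def sum_subtractf S_def)
  have sv: "(\<Sum>j\<in>A'. v j) = 1 - S"
    using q(2) sum.swap[of a A' A] by (simp add: v_def sum_subtractf S_def)
  have S1: "S \<le> 1" using sum_nonneg[of A u] uv su by simp
  have S0: "S \<ge> 0" unfolding S_def by (intro sum_nonneg a)
  \<comment> \<open>For \<open>S = 1\<close> the quotient is 0 because \<open>x / 0 = 0\<close>;
    this is the right value, as all residues vanish in that case.\<close>
  define \<pi> where "\<pi> i j = a i j + u i * v j / (1 - S)" for i j
  have z: "u i = 0" if "S = 1" "i \<in> A" for i
    using su that sum_nonneg_eq_0_iff[OF fin(1), of u] uv by simp
  have z': "v j = 0" if "S = 1" "j \<in> A'" for j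
    using sv that sum_nonneg_eq_0_iff[OF fin(2), of v] uv by simp
  have "\<pi> i j \<ge> 0" if "i \<in> A" "j \<in> A'" for i j
    using a[OF that] uv that S1 by (simp add: \<pi>_def)
  moreover have "(\<Sum>j\<in>A'. \<pi> i j) = p i" if "i \<in> A" for i
  proof -
    have "(\<Sum>j\<in>A'. \<pi> i j) = (\<Sum>j\<in>A'. a i j) + u i * (\<Sum>j\<in>A'. v j) / (1 - S)"
      by (simp add: \<pi>_def sum.distrib sum_distrib_left sum_divide_distrib)
    then show ?thesis using sv z[OF _ that] by (cases "S = 1") (auto simp: u_def)
  qed
  moreover have "(\<Sum>i\<in>A. \<pi> i j) = q j" if "j \<in> A'" for j
  proof -
    have "(\<Sum>i\<in>A. \<pi> i j) = (\<Sum>i\<in>A. a i j) + (\<Sum>i\<in>A. u i) * v j / (1 - S)"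
      by (simp add: \<pi>_def sum.distrib sum_distrib_right sum_divide_distrib)
    then show ?thesis using su z'[OF _ that] by (cases "S = 1") (auto simp: v_def)
  qed
  moreover have "(\<Sum>i\<in>A. \<Sum>j\<in>A'. \<pi> i j * k i j) \<le> d + e * m"
  proof -
    have "(\<Sum>i\<in>A. \<Sum>j\<in>A'. \<pi> i j * k i j) \<le> (\<Sum>i\<in>A. \<Sum>j\<in>A'. a i j * d + u i * v j / (1 - S) * m)"
    proof (intro sum_mono)
      fix i j assume ij: "i \<in> A" "j \<in> A'"
      have "a i j * k i j \<le> a i j * d"
        using a[OF ij] k(1)[OF ij] by (cases "a i j = 0") (auto intro: mult_left_mono)
      moreover have "u i * v j / (1 - S) * k i j \<le> u i * v j / (1 - S) * m"
        using uv ij S1 k(2)[OF ij] by (intro mult_left_mono) auto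
      ultimately show "\<pi> i j * k i j \<le> a i j * d + u i * v j / (1 - S) * m"
        by (simp add: \<pi>_def distrib_right)
    qed
    also have "\<dots> = S * d + (\<Sum>i\<in>A. u i) * (\<Sum>j\<in>A'. v j) / (1 - S) * m"
      unfolding sum_product by (simp add: sum.distrib S_def sum_distrib_right sum_divide_distrib)
    also have "\<dots> = S * d + (1 - S) * m" by (simp add: su sv)
    also have "\<dots> \<le> d + e * m"
      using S0 S1 s nonneg by (intro add_mono mult_right_mono mult_left_le_one_le) (auto simp: S_def)
    finally show ?thesis .
  qed
  ultimately show ?thesis by (intro exI[of _ \<pi>]) auto
qed

section \<open>Comparison of means\<close>

definition relabel :: "(nat \<Rightarrow> 'l \<Rightarrow> 'k) \<Rightarrow> 'l selection \<Rightarrow> 'k selection" where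
  "relabel \<tau> s = (\<lambda>i. map_option (\<tau> i) (s i))"

lemma sel_sum_relabel: "sel_sum N F (relabel \<tau> s) = sel_sum N (\<lambda>i l. F i (\<tau> i l)) s"
  unfolding sel_sum_def relabel_def by (rule sum.cong) (auto split: option.splits)

lemma relabel_trivial [simp]: "relabel \<tau> (trivial_selection i l) = trivial_selection i (\<tau> i l)"
  by (auto simp: relabel_def trivial_selection_def fun_eq_iff)

lemma relabel_eq_empty [simp]: "relabel \<tau> s = (\<lambda>_. None) \<longleftrightarrow> s = (\<lambda>_. None)"
  by (auto simp: relabel_def fun_eq_iff)

lemma is_selection_relabel:
  assumes "\<And>i. i < N \<Longrightarrow> \<tau> i ` L i \<subseteq> L' i" "is_selection N L s"
  shows "is_selection N L' (relabel \<tau> s)"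
  using assms unfolding is_selection_def relabel_def by (fastforce simp: image_subset_iff)

lemma relabel_inverse:
  assumes "\<And>i l. i < N \<Longrightarrow> l \<in> L i \<Longrightarrow> \<sigma> i (\<tau> i l) = l" "is_selection N L s"
  shows "relabel \<sigma> (relabel \<tau> s) = s"
proof
  fix i
  show "relabel \<sigma> (relabel \<tau> s) i = s i"
    using assms by (cases "i < N") (force simp: is_selection_def relabel_def)+
qed

lemma is_grouping_relabel:
  assumes bij: "\<And>i. i < N \<Longrightarrow> bij_betw (\<tau> i) (L i) (L' i)" and G: "is_grouping N L G"
  shows "is_grouping N L' (relabel \<tau> ` G)"
  unfolding is_grouping_def
proof (intro conjI ballI allI impI)
  fix s assume "s \<in> relabel \<tau> ` G"
  then obtain u where u: "u \<in> G" "s = relabel \<tau> u" by auto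
  show "is_selection N L' s" "s \<noteq> (\<lambda>_. None)"
    using groupingD[OF G u(1)] is_selection_relabel[of N \<tau> L L' u] bij
    by (auto simp: u(2) bij_betw_def)
next
  fix i k assume i: "i < N" "k \<in> L' i"
  then obtain l where l: "l \<in> L i" "\<tau> i l = k"
    using bij[OF i(1)] i(2) unfolding bij_betw_def by (metis imageE)
  obtain s where s: "s \<in> G" "s i = Some l" using grouping_ex[OF G i(1) l(1)] .
  show "\<exists>!s. s \<in> relabel \<tau> ` G \<and> s i = Some k"
  proof (rule ex1I[of _ "relabel \<tau> s"])
    show "relabel \<tau> s \<in> relabel \<tau> ` G \<and> relabel \<tau> s i = Some k" using s l by (auto simp: relabel_def)
    fix t assume t: "t \<in> relabel \<tau> ` G \<and> t i = Some k"
    then obtain u l' where u: "u \<in> G" "t = relabel \<tau> u" "u i = Some l'" "\<tau> i l' = k"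
      by (auto simp: relabel_def)
    have "l' \<in> L i" using groupingD(1)[OF G u(1)] i(1) u(3) by (auto simp: is_selection_def)
    then have "l' = l" using bij[OF i(1)] l u(4) by (auto simp: bij_betw_def inj_on_def)
    then show "t = relabel \<tau> s" using grouping_unique[OF G u(1) s(1) i(1)] u s by auto
  qed
qed

lemma grouping_cost_relabel:
  assumes bij: "\<And>i. i < N \<Longrightarrow> bij_betw (\<tau> i) (L i) (L' i)" and G: "is_grouping N L G"
    and loc: "\<And>i l. i < N \<Longrightarrow> l \<in> L i \<Longrightarrow> loc' i (\<tau> i l) = loc i l"
  shows "grouping_cost N loc' (relabel \<tau> ` G) = grouping_cost N loc G"
proof -
  have "inj_on (relabel \<tau>) G"
  proof (rule inj_on_inverseI[of _ "relabel (\<lambda>i. inv_into (L i) (\<tau> i))"])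
    fix s assume "s \<in> G"
    then show "relabel (\<lambda>i. inv_into (L i) (\<tau> i)) (relabel \<tau> s) = s"
      using groupingD(1)[OF G] bij by (intro relabel_inverse[of N L]) (auto simp: bij_betw_def)
  qed
  moreover have "sel_cost N loc' (relabel \<tau> s) = sel_cost N loc s" if "s \<in> G" for s
  proof -
    have l: "loc' i (\<tau> i l) = loc i l" if "i < N" "s i = Some l" for i l
      using groupingD(1)[OF G \<open>s \<in> G\<close>] loc that by (auto simp: is_selection_def)
    have "sel_sum N (\<lambda>i l. F (loc' i (\<tau> i l))) s = sel_sum N (\<lambda>i l. F (loc i l)) s" for F :: "point \<Rightarrow> real"
      by (rule sel_sum_cong) (simp add: l)
    from this[of mc] this[of hc] this[of "\<lambda>p. (mc p)\<^sup>2 + (hc p)\<^sup>2"] show ?thesis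
      by (simp add: sel_cost_def sel_sum_relabel)
  qed
  ultimately show ?thesis by (simp add: grouping_cost_def sum.reindex)
qed

text \<open>Relabelling preserves costs in both directions, so the image of a cheapest grouping
  costs no more than \<open>G'\<close>; strict minimality of \<open>G'\<close> forces
  equality.\<close>

lemma minimal_grouping_relabel:
  assumes bij: "\<And>i. i < N \<Longrightarrow> bij_betw (\<tau> i) (L i) (L' i)"
    and loc: "\<And>i l. i < N \<Longrightarrow> l \<in> L i \<Longrightarrow> loc' i (\<tau> i l) = loc i l"
    and G: "minimal_grouping N L loc G" and G': "minimal_grouping N L' loc' G'"
  shows "G' = relabel \<tau> ` G"
proof (rule ccontr)
  assume ne: "G' \<noteq> relabel \<tau> ` G"
  have g: "is_grouping N L G" "is_grouping N L' G'" using G G' by (auto simp: minimal_grouping_def)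
  define \<sigma> where "\<sigma> i = inv_into (L i) (\<tau> i)" for i
  have bij': "bij_betw (\<sigma> i) (L' i) (L i)" if "i < N" for i
    unfolding \<sigma>_def by (rule bij_betw_inv_into[OF bij[OF that]])
  have inv: "\<tau> i (\<sigma> i k) = k" if "i < N" "k \<in> L' i" for i k
    unfolding \<sigma>_def by (rule bij_betw_inv_into_right[OF bij[OF that(1)] that(2)])
  have loc': "loc i (\<sigma> i k) = loc' i k" if "i < N" "k \<in> L' i" for i k
    using loc[OF that(1), of "\<sigma> i k"] inv[OF that] bij_betwE[OF bij'[OF that(1)]] that(2) by auto
  have "grouping_cost N loc' G' < grouping_cost N loc' (relabel \<tau> ` G)"
    using G' ne is_grouping_relabel[OF bij g(1)] by (auto simp: minimal_grouping_def)
  also have "\<dots> = grouping_cost N loc G" using bij g(1) loc by (rule grouping_cost_relabel)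
  also have "\<dots> \<le> grouping_cost N loc (relabel \<sigma> ` G')"
    using G is_grouping_relabel[OF bij' g(2)] unfolding minimal_grouping_def
    by (cases "relabel \<sigma> ` G' = G") (auto intro: less_imp_le)
  also have "\<dots> = grouping_cost N loc' G'" using bij' g(2) loc' by (rule grouping_cost_relabel)
  finally show False by simp
qed

section \<open>Displacement of means under displacement of the points\<close>

lemma sel_sum_Cauchy_Schwarz: "(sel_sum N F s)\<^sup>2 \<le> sel_size N s * sel_sum N (\<lambda>i l. (F i l)\<^sup>2) s"
proof -
  let ?k = "sel_size N s" and ?a = "sel_sum N F s" and ?b = "sel_sum N (\<lambda>i l. (F i l)\<^sup>2) s"
  have k: "?k \<ge> 0" by (rule sel_sum_nonneg) simp
  have "0 \<le> sel_sum N (\<lambda>i l. (?k * F i l - ?a)\<^sup>2) s" by (rule sel_sum_nonneg) simp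
  also have "\<dots> = sel_sum N (\<lambda>i l. ?k\<^sup>2 * (F i l)\<^sup>2 + ((- 2 * ?k * ?a) * F i l + ?a\<^sup>2)) s"
    by (rule sel_sum_cong) (simp add: power2_eq_square algebra_simps)
  also have "\<dots> = ?k\<^sup>2 * ?b + ((- 2 * ?k * ?a) * ?a + ?a\<^sup>2 * ?k)"
    by (simp only: sel_sum_add sel_sum_cmult sel_sum_const[of N "?a\<^sup>2"])
  finally have *: "?k * ?a\<^sup>2 \<le> ?k * (?k * ?b)" by (simp add: power2_eq_square algebra_simps)
  show ?thesis
  proof (cases "?k = 0")
    case True
    have "s i = None" if "i < N" for i
      using sel_size_ge1[of i N s] that True by fastforce
    then have "?a = 0" unfolding sel_sum_def by (intro sum.neutral) auto
    then show ?thesis using True by simp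
  next
    case False
    then show ?thesis using * k by simp
  qed
qed

text \<open>The position difference is an average over \<open>?k\<close> entries and the height
  difference a sum of \<open>?k\<close> terms divided by \<open>N\<close>, where \<open>?k\<close>
  is between 1 and \<open>N\<close>. Cauchy-Schwarz bounds either square by the sum of the squared
  differences.\<close>

lemma norm_sel_mean_diff_le:
  assumes N: "N \<ge> 1" and s: "is_selection N L s" "s \<noteq> (\<lambda>_. None)"
    and s': "is_selection N L' (relabel \<tau> s)"
  shows "(norm (sel_mean N loc s - sel_mean N loc' (relabel \<tau> s)))\<^sup>2 \<le>
    sel_sum N (\<lambda>i l. (norm (loc i l - loc' i (\<tau> i l)))\<^sup>2) s"
proof -
  let ?k = "sel_size N s"
  define dm where "dm i l = mc (loc i l) - mc (loc' i (\<tau> i l))" for i l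
  define dh where "dh i l = hc (loc i l) - hc (loc' i (\<tau> i l))" for i l
  obtain i l where "i < N" "s i = Some l" using selection_nonempty[OF s] by metis
  then have k: "1 \<le> ?k" "?k \<le> N" using sel_size_ge1[of i N s] sel_size_le[of N s] by auto
  have s'2: "relabel \<tau> s \<noteq> (\<lambda>_. None)" using s(2) by simp
  have m: "mc (sel_mean N loc s) - mc (sel_mean N loc' (relabel \<tau> s)) = sel_sum N dm s / ?k"
    unfolding sel_mean_eq(1)[OF N s] sel_mean_eq(1)[OF N s' s'2] sel_sum_relabel dm_def
    by (simp add: sel_sum_diff diff_divide_distrib)
  have h: "hc (sel_mean N loc s) - hc (sel_mean N loc' (relabel \<tau> s)) = sel_sum N dh s / N"
    unfolding sel_mean_eq(2)[OF N s] sel_mean_eq(2)[OF N s' s'2] sel_sum_relabel dh_def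
    by (simp add: sel_sum_diff diff_divide_distrib)
  have nn: "sel_sum N (\<lambda>i l. (F i l)\<^sup>2) s \<ge> 0" for F by (rule sel_sum_nonneg) simp
  have "(sel_sum N dm s / ?k)\<^sup>2 \<le> ?k * sel_sum N (\<lambda>i l. (dm i l)\<^sup>2) s / ?k\<^sup>2"
    unfolding power_divide by (intro divide_right_mono sel_sum_Cauchy_Schwarz) simp
  also have "\<dots> = sel_sum N (\<lambda>i l. (dm i l)\<^sup>2) s / ?k" using k by (simp add: power2_eq_square)
  also have "\<dots> \<le> sel_sum N (\<lambda>i l. (dm i l)\<^sup>2) s / 1" using k nn by (intro divide_left_mono) auto
  finally have 1: "(sel_sum N dm s / ?k)\<^sup>2 \<le> sel_sum N (\<lambda>i l. (dm i l)\<^sup>2) s" by simp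
  have "(sel_sum N dh s / N)\<^sup>2 \<le> ?k * sel_sum N (\<lambda>i l. (dh i l)\<^sup>2) s / (real N)\<^sup>2"
    unfolding power_divide by (intro divide_right_mono sel_sum_Cauchy_Schwarz) simp
  also have "\<dots> \<le> (real N)\<^sup>2 * sel_sum N (\<lambda>i l. (dh i l)\<^sup>2) s / (real N)\<^sup>2"
  proof (intro divide_right_mono mult_right_mono nn)
    have "real N \<le> (real N)\<^sup>2" using N by (simp add: power2_eq_square)
    then show "?k \<le> (real N)\<^sup>2" using k by linarith
  qed simp
  also have "\<dots> = sel_sum N (\<lambda>i l. (dh i l)\<^sup>2) s" using N by simp
  finally have 2: "(sel_sum N dh s / N)\<^sup>2 \<le> sel_sum N (\<lambda>i l. (dh i l)\<^sup>2) s" .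
  have "(norm (sel_mean N loc s - sel_mean N loc' (relabel \<tau> s)))\<^sup>2 \<le>
     2 * (sel_sum N (\<lambda>i l. (dm i l)\<^sup>2) s + sel_sum N (\<lambda>i l. (dh i l)\<^sup>2) s)"
    unfolding norm_point_sq m h using 1 2 by simp
  also have "\<dots> = sel_sum N (\<lambda>i l. (norm (loc i l - loc' i (\<tau> i l)))\<^sup>2) s"
    unfolding norm_point_sq dm_def dh_def by (simp only: sel_sum_add sel_sum_cmult)
  finally show ?thesis .
qed

text \<open>The \<Delta>-entries divide the height of a trivial mean by \<open>N\<close>, so
  projecting it to the diagonal is no dearer than moving the point itself to any diagonal
  point.\<close>

lemma norm_trivial_mean_le:
  assumes N: "N \<ge> 1" and i: "i < N" and q: "q \<in> diag"
  shows "(norm (sel_mean N loc (trivial_selection i l) - diag_proj (sel_mean N loc (trivial_selection i l))))\<^sup>2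
    \<le> (norm (loc i l - q))\<^sup>2"
proof -
  let ?s = "trivial_selection i l"
  have "sel_hc N loc ?s = (\<Sum>k<N. if k = i then hc (loc i l) else 0)"
    unfolding sel_sum_def by (rule sum.cong) (auto simp: trivial_selection_def)
  then have "sel_hc N loc ?s = hc (loc i l)" using i by simp
  then have "hc (sel_mean N loc ?s) = hc (loc i l) / N"
    using sel_mean_eq(2)[OF N is_selection_trivial[OF i, of l "\<lambda>_. UNIV"] trivial_selection_nonempty, of loc] by simp
  then have "(hc (sel_mean N loc ?s))\<^sup>2 = (hc (loc i l))\<^sup>2 / (real N)\<^sup>2" by (simp add: power_divide)
  also have "\<dots> \<le> (hc (loc i l))\<^sup>2 / 1" using N by (intro divide_left_mono) auto
  finally have "(hc (sel_mean N loc ?s))\<^sup>2 \<le> (hc (loc i l))\<^sup>2" by simp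
  then show ?thesis
    using q by (simp add: norm_point_sq in_diag_iff add_increasing)
qed

text \<open>Writes the mean of a grouping with extra trivial selections over a disjoint sum. The
  summand \<open>V\<close> reserves diagonal positions for the trivial means of the other
  tuple.\<close>

lemma mk_diagram_sum_index:
  assumes inj: "inj_on h U" and dis: "h ` U \<inter> G = {}"
    and f: "\<And>s. s \<in> G \<Longrightarrow> f (Inl s) = m s" "\<And>j. j \<in> U \<Longrightarrow> f (Inr (Inl j)) = m (h j)"
      "\<And>j. j \<in> V \<Longrightarrow> f (Inr (Inr j)) \<in> diag"
  shows "mk_diagram (G <+> (U <+> V)) f = mk_diagram (G \<union> h ` U) m"
proof -
  define h' where "h' = case_sum (\<lambda>s. s) (case_sum h (\<lambda>j. if j \<in> V then undefined else undefined))"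
  have "mk_diagram (G <+> (U <+> {})) f = mk_diagram (G \<union> h ` U) m"
  proof (rule mk_diagram_reindex[where h = h'])
    show "inj_on h' (G <+> (U <+> {}))"
    proof (rule inj_onI)
      have ne: "h j \<noteq> s" "s \<noteq> h j" if "j \<in> U" "s \<in> G" for j s using dis that by auto
      fix x y assume "x \<in> G <+> (U <+> {})" "y \<in> G <+> (U <+> {})" "h' x = h' y"
      then show "x = y"
        by (elim PlusE) (auto simp: h'_def ne inj_on_eq_iff[OF inj])
    qed
    show "f i = m (h' i)" if "i \<in> G <+> (U <+> {})" for i using that f by (auto simp: h'_def)
    have "j \<in> h' ` (G <+> (U <+> {}))" if "j \<in> G \<union> h ` U" for j
      using that
    proof
      assume "j \<in> G"
      then show ?thesis by (intro image_eqI[of _ _ "Inl j"]) (auto simp: h'_def)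
    next
      assume "j \<in> h ` U"
      then obtain u where "u \<in> U" "j = h u" by auto
      then show ?thesis by (intro image_eqI[of _ _ "Inr (Inl u)"]) (auto simp: h'_def)
    qed
    then show "m j \<in> diag" if "j \<in> G \<union> h ` U - h' ` (G <+> (U <+> {}))" for j using that by auto
    show "f i \<in> diag" if "i \<in> G <+> (U <+> {})" "h' i \<notin> G \<union> h ` U" for i
      using that by (auto simp: h'_def)
  qed
  moreover have "mk_diagram (G <+> (U <+> {})) f = mk_diagram (G <+> (U <+> V)) f"
    by (rule mk_diagram_reindex[where h = "\<lambda>x. x"]) (use f in \<open>auto\<close>)
  ultimately show ?thesis by simp
qed

lemma trivials_eq: "trivials S = (\<lambda>(i, l). trivial_selection i l) ` S"
  by (auto simp: trivials_def)

lemma inj_trivial: "inj_on (\<lambda>(i, l). trivial_selection i l) S"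
  by (rule inj_onI, clarify) (metis trivial_selection_eq_Some)

text \<open>The matching cost has disjoint parts for the pairs off the diagonal, for points of
  \<open>X\<close> sent to the diagonal, and for points of \<open>Y\<close> reached from it.
  \<open>F\<close> and \<open>F'\<close> are abstract because the estimate serves twice: for the
  projections of trivial means and for the squared perturbation radii.\<close>

lemma sum_dist_le_matching_cost:
  fixes N :: nat and X Y :: "nat \<Rightarrow> diagram" and \<phi> :: "nat \<Rightarrow> dpoint \<Rightarrow> dpoint"
  defines "J \<equiv> {(i, x). i < N \<and> x \<in> offpts (X i) \<and> fst (\<phi> i x) \<notin> diag}"
    and "t \<equiv> \<lambda>(i, x). (i, \<phi> i x)"
    and "IX \<equiv> Sigma {..<N} (\<lambda>i. offpts (X i))" and "IY \<equiv> Sigma {..<N} (\<lambda>i. offpts (Y i))"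
  assumes fin: "\<And>i. i < N \<Longrightarrow> finite (offpts (X i))" "\<And>i. i < N \<Longrightarrow> finite (offpts (Y i))"
    and match: "\<And>i. i < N \<Longrightarrow> matching (X i) (Y i) (\<phi> i)"
    and F: "\<And>i x q. i < N \<Longrightarrow> q \<in> diag \<Longrightarrow> F (i, x) \<le> (norm (fst x - q))\<^sup>2"
    and F': "\<And>i y q. i < N \<Longrightarrow> q \<in> diag \<Longrightarrow> F' (i, y) \<le> (norm (fst y - q))\<^sup>2"
  shows "ennreal ((\<Sum>(i, x)\<in>J. (norm (fst x - fst (\<phi> i x)))\<^sup>2) + (\<Sum>j\<in>IX - J. F j) + (\<Sum>j\<in>IY - t ` J. F' j))
      \<le> (\<Sum>i<N. (matching_cost (X i) (\<phi> i))\<^sup>2)"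
proof -
  have bij: "bij_betw (\<phi> i) (pts (X i)) (pts (Y i))" if "i < N" for i
    using match[OF that] by (simp add: matching_def)
  have inj: "\<phi> i x = \<phi> i y \<longleftrightarrow> x = y" if "i < N" "x \<in> pts (X i)" "y \<in> pts (X i)" for i x y
    using bij[OF that(1)] that by (auto simp: bij_betw_def inj_on_def)
  have off: "offpts D \<subseteq> pts D" for D by (auto simp: offpts_def)
  define UX where "UX = IX - J"
  define UY where "UY = IY - t ` J"
  have finJ: "\<And>i. i < N \<Longrightarrow> finite (slice J i)"
    by (rule finite_subset[OF _ fin(1)]) (auto simp: slice_def J_def)
  have sigJ: "Sigma {..<N} (slice J) = J" by (auto simp: slice_def J_def)
  define D where "D i x = (norm (fst x - fst (\<phi> i x)))\<^sup>2" for i x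
  \<comment> \<open>Diagonal copies in \<open>X i\<close> whose partner is off the diagonal; through
    them the unmatched points of \<open>Y i\<close> enter a sum over
    \<open>pts (X i)\<close>.\<close>
  define V where "V i = {x \<in> pts (X i). x \<notin> offpts (X i) \<and> \<phi> i x \<in> offpts (Y i)}" for i
  have finV: "finite (V i)" if "i < N" for i
  proof (rule inj_on_finite[OF _ _ fin(2)[OF that]])
    show "inj_on (\<phi> i) (V i)" using inj[OF that] by (auto simp: inj_on_def V_def)
  qed (auto simp: V_def)
  have slJ: "slice J i \<subseteq> offpts (X i)" for i by (auto simp: slice_def J_def)
  have V_img: "\<phi> i ` V i = {y. (i, y) \<in> UY}" if i: "i < N" for i
  proof (intro set_eqI iffI)
    fix y assume "y \<in> \<phi> i ` V i"
    then obtain x where x: "x \<in> pts (X i)" "x \<notin> offpts (X i)" "y = \<phi> i x" "y \<in> offpts (Y i)" by (auto simp: V_def)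
    have "(i, y) \<notin> t ` J"
    proof
      assume "(i, y) \<in> t ` J"
      then obtain x' where x': "x' \<in> offpts (X i)" "y = \<phi> i x'" by (auto simp: t_def J_def)
      have "x' = x" using inj[OF i subsetD[OF off x'(1)] x(1)] x(3) x'(2) by metis
      then show False using x' x by simp
    qed
    then show "y \<in> {y. (i, y) \<in> UY}" using x i by (auto simp: UY_def IY_def)
  next
    fix y assume "y \<in> {y. (i, y) \<in> UY}"
    then have y: "y \<in> offpts (Y i)" "(i, y) \<notin> t ` J" by (auto simp: UY_def IY_def)
    have "y \<in> \<phi> i ` pts (X i)" using y(1) off bij[OF i] by (auto simp: bij_betw_def)
    then obtain x where x: "x \<in> pts (X i)" "y = \<phi> i x" by auto
    have "x \<notin> offpts (X i)"
    proof
      assume "x \<in> offpts (X i)"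
      then have "(i, x) \<in> J" using i x y(1) by (auto simp: J_def offpts_def)
      then have "t (i, x) \<in> t ` J" by (rule imageI)
      then show False using y(2) x by (simp add: t_def)
    qed
    then show "y \<in> \<phi> i ` V i" using x y by (auto simp: V_def)
  qed
  have injV: "inj_on (\<phi> i) (V i)" if "i < N" for i
    using inj[OF that] by (auto simp: inj_on_def V_def)
  have UX_sig: "UX = Sigma {..<N} (\<lambda>i. offpts (X i) - slice J i)"
    by (auto simp: UX_def IX_def slice_def)
  have UY_sig: "UY = Sigma {..<N} (\<lambda>i. \<phi> i ` V i)"
    using V_img by (auto simp: UY_def IY_def)
  have "(\<Sum>j\<in>UX. F j) + (\<Sum>j\<in>UY. F' j) \<le>
      (\<Sum>(i, x)\<in>UX. D i x) + (\<Sum>(i, y)\<in>UY. D i (inv_into (V i) (\<phi> i) y))"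
  proof (intro add_mono sum_mono)
    fix j assume j: "j \<in> UX"
    obtain i x where ix: "j = (i, x)" by (cases j)
    have i: "i < N" "fst (\<phi> i x) \<in> diag" using j by (auto simp: ix UX_def IX_def J_def)
    show "F j \<le> (case j of (i, x) \<Rightarrow> D i x)" using F[OF i, of x] by (simp add: ix D_def)
  next
    fix j assume j: "j \<in> UY"
    obtain i y where iy: "j = (i, y)" by (cases j)
    then have i: "i < N" "y \<in> \<phi> i ` V i" using j by (auto simp: UY_sig)
    define x where "x = inv_into (V i) (\<phi> i) y"
    have x: "x \<in> V i" "\<phi> i x = y" using i(2) by (auto simp: x_def inv_into_into f_inv_into_f)
    then have d: "fst x \<in> diag" by (auto simp: V_def offpts_def)
    have "F' (i, y) \<le> D i x" using F'[OF i(1) d, of y] x by (simp add: D_def norm_minus_commute)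
    then show "F' j \<le> (case j of (i, y) \<Rightarrow> D i (inv_into (V i) (\<phi> i) y))"
      by (simp add: iy x_def)
  qed
  also have "(\<Sum>(i, x)\<in>UX. D i x) = (\<Sum>i<N. \<Sum>x\<in>offpts (X i) - slice J i. D i x)"
    unfolding UX_sig using fin by (subst sum.Sigma) auto
  also have "(\<Sum>(i, y)\<in>UY. D i (inv_into (V i) (\<phi> i) y)) = (\<Sum>i<N. \<Sum>y\<in>\<phi> i ` V i. D i (inv_into (V i) (\<phi> i) y))"
    unfolding UY_sig using finV by (subst sum.Sigma) auto
  also have "\<dots> = (\<Sum>i<N. \<Sum>x\<in>V i. D i x)"
    by (rule sum.cong[OF refl]) (simp add: sum.reindex[OF injV] injV)
  finally have le: "(\<Sum>j\<in>UX. F j) + (\<Sum>j\<in>UY. F' j) \<le>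
      (\<Sum>i<N. \<Sum>x\<in>offpts (X i) - slice J i. D i x) + (\<Sum>i<N. \<Sum>x\<in>V i. D i x)" .
  have "(\<Sum>(i, x)\<in>J. D i x) = (\<Sum>i<N. \<Sum>x\<in>slice J i. D i x)"
    using finJ by (subst sum.Sigma) (auto simp: sigJ)
  moreover have "(\<Sum>i<N. \<Sum>x\<in>slice J i. D i x) + ((\<Sum>i<N. \<Sum>x\<in>offpts (X i) - slice J i. D i x) + (\<Sum>i<N. \<Sum>x\<in>V i. D i x))
     = (\<Sum>i<N. \<Sum>x\<in>offpts (X i) \<union> V i. D i x)"
  proof -
    have "(\<Sum>x\<in>slice J i. D i x) + ((\<Sum>x\<in>offpts (X i) - slice J i. D i x) + (\<Sum>x\<in>V i. D i x)) = (\<Sum>x\<in>offpts (X i) \<union> V i. D i x)"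
      if i: "i < N" for i
    proof -
      have "(\<Sum>x\<in>offpts (X i) \<union> V i. D i x) = (\<Sum>x\<in>offpts (X i). D i x) + (\<Sum>x\<in>V i. D i x)"
        using fin(1)[OF i] finV[OF i] by (intro sum.union_disjoint) (auto simp: V_def)
      moreover have "(\<Sum>x\<in>offpts (X i). D i x) = (\<Sum>x\<in>offpts (X i) - slice J i. D i x) + (\<Sum>x\<in>slice J i. D i x)"
        using fin(1)[OF i] slJ by (intro sum.subset_diff) auto
      ultimately show ?thesis by simp
    qed
    then show ?thesis by (simp flip: sum.distrib)
  qed
  ultimately have "(\<Sum>(i, x)\<in>J. D i x) + (\<Sum>j\<in>UX. F j) + (\<Sum>j\<in>UY. F' j) \<le> (\<Sum>i<N. \<Sum>x\<in>offpts (X i) \<union> V i. D i x)"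
    using le by linarith
  then have "ennreal ((\<Sum>(i, x)\<in>J. D i x) + (\<Sum>j\<in>UX. F j) + (\<Sum>j\<in>UY. F' j)) \<le>
      ennreal (\<Sum>i<N. \<Sum>x\<in>offpts (X i) \<union> V i. D i x)" by (rule ennreal_leI)
  also have "\<dots> = (\<Sum>i<N. \<Sum>x\<in>offpts (X i) \<union> V i. ennreal (D i x))"
    by (simp add: sum_ennreal sum_nonneg D_def)
  also have "\<dots> \<le> (\<Sum>i<N. (matching_cost (X i) (\<phi> i))\<^sup>2)"
    unfolding matching_cost_def esqrt_sq D_def
    using fin(1) finV off by (intro sum_mono finite_sum_le_infsum_ennreal) (auto simp: V_def)
  finally show ?thesis by (simp add: UX_def UY_def D_def)
qed

text \<open>\<open>S\<close> stands for the matched labels that survive the perturbation. Means are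
  formed at the original positions, so the bound is the same for all \<open>S\<close> and
  \<open>G0\<close>.\<close>

lemma W2_grouping_means_le:
  fixes N :: nat and X Y :: "nat \<Rightarrow> diagram" and \<phi> :: "nat \<Rightarrow> dpoint \<Rightarrow> dpoint"
  defines "J \<equiv> {(i, x). i < N \<and> x \<in> offpts (X i) \<and> fst (\<phi> i x) \<notin> diag}"
    and "t \<equiv> \<lambda>(i, x). (i, \<phi> i x)"
    and "IX \<equiv> Sigma {..<N} (\<lambda>i. offpts (X i))" and "IY \<equiv> Sigma {..<N} (\<lambda>i. offpts (Y i))"
  assumes N: "N \<ge> 1" and fin: "\<And>i. i < N \<Longrightarrow> finite (offpts (X i))" "\<And>i. i < N \<Longrightarrow> finite (offpts (Y i))"
    and match: "\<And>i. i < N \<Longrightarrow> matching (X i) (Y i) (\<phi> i)"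
    and S: "S \<subseteq> J" and G0: "is_grouping N (slice S) G0"
  shows "(W2 (grouping_mean N (\<lambda>_. fst) (G0 \<union> trivials (IX - S)))
             (grouping_mean N (\<lambda>_. fst) (relabel \<phi> ` G0 \<union> trivials (IY - t ` S))))\<^sup>2
      \<le> (\<Sum>i<N. (matching_cost (X i) (\<phi> i))\<^sup>2)"
proof -
  have bij: "bij_betw (\<phi> i) (pts (X i)) (pts (Y i))" if "i < N" for i
    using match[OF that] by (simp add: matching_def)
  have inj: "\<phi> i x = \<phi> i y \<longleftrightarrow> x = y" if "i < N" "x \<in> pts (X i)" "y \<in> pts (X i)" for i x y
    using bij[OF that(1)] that by (auto simp: bij_betw_def inj_on_def)
  have off: "offpts D \<subseteq> pts D" for D by (auto simp: offpts_def)
  have JX: "J \<subseteq> IX" by (auto simp: J_def IX_def)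
  have JY: "t ` J \<subseteq> IY"
    using bij off by (auto simp: J_def IY_def t_def offpts_def bij_betw_def)
  have injt: "inj_on t J"
  proof (rule inj_onI)
    fix a b assume ab: "a \<in> J" "b \<in> J" "t a = t b"
    obtain i x where a: "a = (i, x)" by (cases a)
    obtain y where b: "b = (i, y)" using ab(3) a by (cases b) (auto simp: t_def)
    have "i < N" "x \<in> pts (X i)" "y \<in> pts (X i)" using ab(1,2) off a b by (auto simp: J_def)
    then have "x = y" using ab(3) a b inj[of i x y] by (simp add: t_def)
    then show "a = b" using a b by simp
  qed
  have finJ: "\<And>i. i < N \<Longrightarrow> finite (slice J i)"
    by (rule finite_subset[OF _ fin(1)]) (auto simp: slice_def J_def)
  have sigJ: "Sigma {..<N} (slice J) = J" by (auto simp: slice_def J_def)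
  \<comment> \<open>Matched labels outside \<open>S\<close> have trivial selections on both sides,
    which correspond under \<open>relabel \<phi>\<close>; \<open>G1\<close> absorbs them, so that
    only unmatched labels stay apart.\<close>
  define G1 where "G1 = G0 \<union> trivials (J - S)"
  have G1: "is_grouping N (slice J) G1"
    using is_grouping_Un_trivials[OF G0, of "slice J"] S by (simp add: G1_def sigJ)
  have finG1: "finite G1" by (rule finite_grouping[OF finJ G1])
  define UX where "UX = IX - J"
  define UY where "UY = IY - t ` J"
  have finU: "finite UX" "finite UY" using fin by (auto simp: UX_def UY_def IX_def IY_def)
  have tr_Un: "trivials (A \<union> B) = trivials A \<union> trivials B" for A B :: "(nat \<times> dpoint) set"
    by (auto simp: trivials_def)
  have GX: "G0 \<union> trivials (IX - S) = G1 \<union> trivials UX"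
  proof -
    have "IX - S = (J - S) \<union> UX" using S JX by (auto simp: UX_def)
    then show ?thesis by (simp add: G1_def tr_Un Un_assoc)
  qed
  have GY: "relabel \<phi> ` G0 \<union> trivials (IY - t ` S) = relabel \<phi> ` G1 \<union> trivials UY"
  proof -
    have "t ` (J - S) = t ` J - t ` S" using injt S by (intro inj_on_image_set_diff) auto
    then have "IY - t ` S = t ` (J - S) \<union> UY" using S JY by (auto simp: UY_def)
    moreover have "relabel \<phi> ` trivials (J - S) = trivials (t ` (J - S))"
      by (simp add: trivials_eq image_image t_def case_prod_unfold)
    ultimately show ?thesis by (simp add: G1_def tr_Un Un_assoc image_Un)
  qed
  have bijJ: "bij_betw (\<phi> i) (slice J i) (slice (t ` J) i)" if "i < N" for i
  proof -
    have "slice (t ` J) i = \<phi> i ` slice J i" by (auto simp: slice_def t_def image_iff) force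
    moreover have "inj_on (\<phi> i) (slice J i)"
      by (rule inj_on_subset[OF bij_betw_imp_inj_on[OF bij[OF that]]])
        (auto simp: slice_def J_def intro: subsetD[OF off])
    ultimately show ?thesis by (simp add: bij_betw_def)
  qed
  have G1': "is_grouping N (slice (t ` J)) (relabel \<phi> ` G1)"
    by (rule is_grouping_relabel[OF bijJ G1])
  have disX: "trivials UX \<inter> G1 = {}"
  proof -
    have "trivial_selection i x \<notin> G1" if "(i, x) \<in> UX" for i x
      using groupingD(1)[OF G1, of "trivial_selection i x"] that
      by (auto simp: is_selection_def slice_def UX_def IX_def trivial_selection_def split: if_splits)
    then show ?thesis by (auto simp: trivials_def)
  qed
  have disY: "trivials UY \<inter> relabel \<phi> ` G1 = {}"
  proof -
    have "trivial_selection i x \<notin> relabel \<phi> ` G1" if "(i, x) \<in> UY" for i x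
    proof
      assume "trivial_selection i x \<in> relabel \<phi> ` G1"
      from groupingD(1)[OF G1' this] that show False
        by (auto simp: is_selection_def slice_def UY_def IY_def trivial_selection_def split: if_splits)
    qed
    then show ?thesis unfolding trivials_def by blast
  qed
  let ?m = "sel_mean N (\<lambda>_. fst) :: dpoint selection \<Rightarrow> point"
    and ?tr = "\<lambda>(i, x :: dpoint). trivial_selection i x"
  \<comment> \<open>One index set for both means: corresponding selections share an index, and the
    trivial mean of an unmatched point is paired with its own projection on the other side.\<close>
  define I where "I = G1 <+> (UX <+> UY)"
  define f where "f = case_sum ?m (case_sum (\<lambda>j. ?m (?tr j)) (\<lambda>j. diag_proj (?m (?tr j))))"
  define g where "g = case_sum (\<lambda>s. ?m (relabel \<phi> s)) (case_sum (\<lambda>j. diag_proj (?m (?tr j))) (\<lambda>j. ?m (?tr j)))"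
  have finI: "finite I" using finG1 finU by (simp add: I_def)
  have X_eq: "grouping_mean N (\<lambda>_. fst) (G0 \<union> trivials (IX - S)) = mk_diagram I f"
    unfolding grouping_mean_def GX I_def unfolding trivials_eq
    by (rule mk_diagram_sum_index[OF inj_trivial, symmetric]) (use disX in \<open>auto simp: f_def trivials_eq\<close>)
  have injr: "inj_on (relabel \<phi>) G1"
  proof (rule inj_on_inverseI[of _ "relabel (\<lambda>i. inv_into (slice J i) (\<phi> i))"])
    fix s assume "s \<in> G1"
    then show "relabel (\<lambda>i. inv_into (slice J i) (\<phi> i)) (relabel \<phi> s) = s"
      using groupingD(1)[OF G1] bijJ by (intro relabel_inverse[of N "slice J"]) (auto simp: bij_betw_def)
  qed
  have Y_eq: "grouping_mean N (\<lambda>_. fst) (relabel \<phi> ` G0 \<union> trivials (IY - t ` S)) = mk_diagram I g"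
  proof -
    \<comment> \<open>Exchanges the two unmatched summands, so that
      \<open>mk_diagram_sum_index\<close> applies with the trivial selections of \<open>Y\<close> in
      second place.\<close>
    define swp where "swp = case_sum (\<lambda>s. Inl (relabel \<phi> s) :: dpoint selection + (nat \<times> dpoint) + (nat \<times> dpoint))
       (case_sum (\<lambda>j. Inr (Inr j)) (\<lambda>j. Inr (Inl j)))"
    define g' where "g' = case_sum ?m (case_sum (\<lambda>j. ?m (?tr j)) (\<lambda>j. diag_proj (?m (?tr j))))"
    have "mk_diagram I g = mk_diagram (relabel \<phi> ` G1 <+> (UY <+> UX)) g'"
    proof (rule mk_diagram_reindex[where h = swp])
      show "inj_on swp I"
      proof (rule inj_onI)
        fix x y assume "x \<in> I" "y \<in> I" "swp x = swp y"
        then show "x = y" unfolding I_def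
          by (elim PlusE) (auto simp: swp_def inj_on_eq_iff[OF injr])
      qed
      show "g i = g' (swp i)" if "i \<in> I" for i using that by (auto simp: I_def g_def g'_def swp_def)
      have "j \<in> swp ` I" if "j \<in> relabel \<phi> ` G1 <+> (UY <+> UX)" for j
        using that
      proof (elim PlusE imageE)
        fix b u assume "j = Inr b" "b = Inl u" "u \<in> UY"
        then show ?thesis by (intro image_eqI[of _ _ "Inr (Inr u)"]) (auto simp: swp_def I_def)
      next
        fix b u assume "j = Inr b" "b = Inr u" "u \<in> UX"
        then show ?thesis by (intro image_eqI[of _ _ "Inr (Inl u)"]) (auto simp: swp_def I_def)
      next
        fix a s assume "j = Inl a" "a = relabel \<phi> s" "s \<in> G1"
        then show ?thesis by (intro image_eqI[of _ _ "Inl s"]) (auto simp: swp_def I_def)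
      qed
      then show "g' j \<in> diag" if "j \<in> (relabel \<phi> ` G1 <+> (UY <+> UX)) - swp ` I" for j using that by auto
      show "g i \<in> diag" if "i \<in> I" "swp i \<notin> relabel \<phi> ` G1 <+> (UY <+> UX)" for i
        using that by (auto simp: I_def swp_def)
    qed
    also have "\<dots> = mk_diagram (relabel \<phi> ` G1 \<union> ?tr ` UY) ?m"
      by (rule mk_diagram_sum_index[OF inj_trivial]) (use disY in \<open>auto simp: g'_def trivials_eq\<close>)
    finally show ?thesis unfolding grouping_mean_def GY unfolding trivials_eq by (rule sym)
  qed
  have "(\<Sum>i\<in>I. (norm (f i - g i))\<^sup>2) = (\<Sum>s\<in>G1. (norm (f (Inl s) - g (Inl s)))\<^sup>2) +
      (\<Sum>j\<in>UX. (norm (f (Inr (Inl j)) - g (Inr (Inl j))))\<^sup>2) +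
       (\<Sum>j\<in>UY. (norm (f (Inr (Inr j)) - g (Inr (Inr j))))\<^sup>2)"
    unfolding I_def using finG1 finU by (simp add: sum.Plus)
  also have "(\<Sum>s\<in>G1. (norm (f (Inl s) - g (Inl s)))\<^sup>2) \<le> (\<Sum>s\<in>G1. sel_sum N (\<lambda>i x. (norm (fst x - fst (\<phi> i x)))\<^sup>2) s)"
  proof (rule sum_mono)
    fix s assume s: "s \<in> G1"
    have "is_selection N (slice (t ` J)) (relabel \<phi> s)" using groupingD(1)[OF G1'] s by auto
    from norm_sel_mean_diff_le[OF N groupingD[OF G1 s] this, of "\<lambda>_. fst" "\<lambda>_. fst"]
    show "(norm (f (Inl s) - g (Inl s)))\<^sup>2 \<le> sel_sum N (\<lambda>i x. (norm (fst x - fst (\<phi> i x)))\<^sup>2) s"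
      by (simp add: f_def g_def)
  qed
  also have "(\<Sum>s\<in>G1. sel_sum N (\<lambda>i x. (norm (fst x - fst (\<phi> i x)))\<^sup>2) s) =
      (\<Sum>i<N. \<Sum>x\<in>slice J i. (norm (fst x - fst (\<phi> i x)))\<^sup>2)"
    using finJ G1 by (rule grouping_sum)
  also have "\<dots> = (\<Sum>(i, x)\<in>J. (norm (fst x - fst (\<phi> i x)))\<^sup>2)"
    using finJ by (subst sum.Sigma) (auto simp: sigJ)
  finally have main: "(\<Sum>i\<in>I. (norm (f i - g i))\<^sup>2) \<le> (\<Sum>(i, x)\<in>J. (norm (fst x - fst (\<phi> i x)))\<^sup>2) +
      (\<Sum>j\<in>UX. (norm (f (Inr (Inl j)) - g (Inr (Inl j))))\<^sup>2) +
       (\<Sum>j\<in>UY. (norm (f (Inr (Inr j)) - g (Inr (Inr j))))\<^sup>2)" by simp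
  have "(W2 (mk_diagram I f) (mk_diagram I g))\<^sup>2 \<le> (\<Sum>i\<in>I. ennreal ((norm (f i - g i))\<^sup>2))"
    by (rule W2_mk_diagram_le[OF finI])
  also have "\<dots> = ennreal (\<Sum>i\<in>I. (norm (f i - g i))\<^sup>2)" by (simp add: sum_ennreal)
  also have "\<dots> \<le> ennreal ((\<Sum>(i, x)\<in>J. (norm (fst x - fst (\<phi> i x)))\<^sup>2) +
      (\<Sum>j\<in>UX. (norm (f (Inr (Inl j)) - g (Inr (Inl j))))\<^sup>2) +
       (\<Sum>j\<in>UY. (norm (f (Inr (Inr j)) - g (Inr (Inr j))))\<^sup>2))" using main by (rule ennreal_leI)
  also have "\<dots> \<le> (\<Sum>i<N. (matching_cost (X i) (\<phi> i))\<^sup>2)"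
    unfolding J_def UX_def UY_def IX_def IY_def t_def
  proof (rule sum_dist_le_matching_cost[OF fin match])
    fix i x and q :: point
    assume ix: "i < N" and q: "q \<in> diag"
    show "(norm (f (Inr (Inl (i, x))) - g (Inr (Inl (i, x)))))\<^sup>2 \<le> (norm (fst x - q))\<^sup>2"
      "(norm (f (Inr (Inr (i, x))) - g (Inr (Inr (i, x)))))\<^sup>2 \<le> (norm (fst x - q))\<^sup>2"
      using norm_trivial_mean_le[OF N ix q, of "\<lambda>_. fst" x] by (simp_all add: f_def g_def norm_minus_commute)
  qed
  finally show ?thesis by (simp add: X_eq Y_eq)
qed

section \<open>Bounds inside the space of diagrams\<close>

lemma diagram_spaceD:
  assumes "D \<in> diagram_space M K"
  shows "D \<in> diagrams" "finite (offpts D)" "card (offpts D) \<le> K" "mk_diagram (offpts D) fst = D"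
    and "\<And>x. x \<in> offpts D \<Longrightarrow> 0 \<le> fst (fst x) \<and> fst (fst x) < snd (fst x) \<and> snd (fst x) \<le> M"
proof -
  show D: "D \<in> diagrams" "finite (offpts D)" "card (offpts D) \<le> K" using assms by (auto simp: diagram_space_def)
  show "mk_diagram (offpts D) fst = D" by (rule mk_diagram_offpts[OF D(1,2)])
  fix x assume x: "x \<in> offpts D"
  obtain b d k where b: "x = ((b, d), k)" by (metis surj_pair)
  have "(b, d) \<notin> diag" "D (b, d) \<noteq> 0"
    using x by (auto simp: b offpts_def pts_def)
  then have "b < d" using D(1) by (auto simp: diagrams_def)
  then show "0 \<le> fst (fst x) \<and> fst (fst x) < snd (fst x) \<and> snd (fst x) \<le> M"
    using assms x by (force simp: diagram_space_def b)
qed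

lemma mk_diagram_in_space:
  assumes "finite I" "card I \<le> K" "\<And>i. i \<in> I \<Longrightarrow> 0 \<le> fst (f i) \<and> fst (f i) \<le> snd (f i) \<and> snd (f i) \<le> M"
  shows "mk_diagram I f \<in> diagram_space M K"
proof -
  have "mk_diagram I f \<in> diagrams"
    by (rule mk_diagram_in_diagrams[OF assms(1)]) (use assms(3) in \<open>auto simp: hc_def\<close>)
  moreover have "0 \<le> fst (fst x) \<and> fst (fst x) \<le> M \<and> 0 \<le> snd (fst x) \<and> snd (fst x) \<le> M"
    if x: "x \<in> offpts (mk_diagram I f)" for x
  proof -
    obtain i where "i \<in> I" "fst x = f i" using finite_offpts_mk_diagram(3)[OF assms(1) x] by auto
    then show ?thesis using assms(3)[of i] by auto
  qed
  ultimately show ?thesis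
    using finite_offpts_mk_diagram(1,2)[OF assms(1), of f] assms(2) by (auto simp: diagram_space_def)
qed

text \<open>Averages stay in the triangle between the diagonal and the bounds 0 and
  \<open>M\<close>. Dividing the heights by \<open>N\<close> instead of the smaller
  \<open>?k\<close> only moves the plain average towards the diagonal.\<close>

lemma grouping_mean_in_space:
  assumes N: "N \<ge> 1" and X: "\<And>i. i < N \<Longrightarrow> X i \<in> diagram_space M K"
    and G: "is_grouping N (\<lambda>i. offpts (X i)) G"
  shows "grouping_mean N (\<lambda>_. fst) G \<in> diagram_space M (N * K)"
  unfolding grouping_mean_def
proof (rule mk_diagram_in_space)
  note fin = diagram_spaceD(2)[OF X]
  show "finite G" by (rule finite_grouping[OF fin G])
  have "card G \<le> (\<Sum>i<N. card (offpts (X i)))" by (rule card_grouping_le[OF fin G])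
  also have "\<dots> \<le> (\<Sum>i<N. K)" by (intro sum_mono diagram_spaceD(3)[OF X]) auto
  finally show "card G \<le> N * K" by simp
  fix s assume s: "s \<in> G"
  note sel = groupingD[OF G s]
  let ?k = "sel_size N s" and ?m = "sel_mc N (\<lambda>_. fst) s" and ?h = "sel_hc N (\<lambda>_. fst) s"
  obtain i l where "i < N" "s i = Some l" using selection_nonempty[OF sel] by metis
  then have k: "1 \<le> ?k" "?k \<le> N" using sel_size_ge1[of i N s] sel_size_le[of N s] by auto
  have pt: "0 \<le> fst (fst l) \<and> fst (fst l) < snd (fst l) \<and> snd (fst l) \<le> M" if "i < N" "s i = Some l" for i l
  proof -
    have "s i \<in> Some ` offpts (X i)" using sel(1) that by (auto simp: is_selection_def)
    then have "l \<in> offpts (X i)" using that(2) by auto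
    then show ?thesis by (rule diagram_spaceD(5)[OF X[OF that(1)]])
  qed
  have h0: "0 \<le> ?h" by (rule sel_sum_nonneg) (use pt in \<open>force simp: hc_def\<close>)
  have "0 \<le> sel_sum N (\<lambda>i l. mc (fst l) - hc (fst l)) s"
    by (rule sel_sum_nonneg) (use pt in \<open>force simp: hc_def mc_def field_simps\<close>)
  then have lo: "?h \<le> ?m" by (simp add: sel_sum_diff)
  have "sel_sum N (\<lambda>i l. mc (fst l) + hc (fst l)) s \<le> sel_sum N (\<lambda>i l. M) s"
    by (rule sel_sum_mono) (use pt in \<open>force simp: hc_def mc_def field_simps\<close>)
  then have up: "?m + ?h \<le> M * ?k" by (simp add: sel_sum_add sel_sum_const[of N M])
  have hN: "?h / N \<le> ?h / ?k" using k h0 by (intro divide_left_mono) auto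
  have "0 \<le> (?m - ?h) / ?k" using lo k by simp
  then have 1: "0 \<le> ?m / ?k - ?h / N" using hN by (simp add: diff_divide_distrib)
  have "(?m + ?h) / ?k \<le> M" using up k by (simp add: pos_divide_le_eq)
  then have 2: "?m / ?k + ?h / N \<le> M" using hN by (simp add: add_divide_distrib)
  let ?z = "sel_mean N (\<lambda>_. fst) s"
  have "fst ?z = mc ?z - hc ?z" "snd ?z = mc ?z + hc ?z" by (simp_all add: mc_def hc_def field_simps)
  then show "0 \<le> fst ?z \<and> fst ?z \<le> snd ?z \<and> snd ?z \<le> M"
    using 1 2 h0 N by (simp add: sel_mean_eq(1,2)[OF N sel])
qed

text \<open>All points of both diagrams are sent to the diagonal: at most \<open>2 * K\<close> of
  them, each with height at most \<open>M / 2\<close>.\<close>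

lemma W2_sq_diagram_space_le:
  assumes U: "U \<in> diagram_space M K" and V: "V \<in> diagram_space M K"
  shows "(W2 U V)\<^sup>2 \<le> ennreal (2 * real K * M\<^sup>2)"
proof -
  note U' = diagram_spaceD[OF U] and V' = diagram_spaceD[OF V]
  let ?I = "offpts U <+> offpts V"
  define f where "f = case_sum (fst :: dpoint \<Rightarrow> point) (\<lambda>y :: dpoint. diag_proj (fst y))"
  define g where "g = case_sum (\<lambda>x :: dpoint. diag_proj (fst x)) (fst :: dpoint \<Rightarrow> point)"
  have fin: "finite ?I" using U'(2) V'(2) by simp
  have "mk_diagram (offpts U) fst = mk_diagram ?I f"
    by (rule mk_diagram_reindex[where h = Inl]) (auto simp: f_def)
  moreover have "mk_diagram (offpts V) fst = mk_diagram ?I g"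
    by (rule mk_diagram_reindex[where h = Inr]) (auto simp: g_def)
  ultimately have "(W2 U V)\<^sup>2 \<le> (\<Sum>i\<in>?I. ennreal ((norm (f i - g i))\<^sup>2))"
    using W2_mk_diagram_le[OF fin, of f g] U'(4) V'(4) by simp
  also have "\<dots> \<le> (\<Sum>i\<in>?I. ennreal (M\<^sup>2))"
  proof (intro sum_mono ennreal_leI)
    have b: "2 * (hc (fst x))\<^sup>2 \<le> M\<^sup>2"
      if "0 \<le> fst (fst x) \<and> fst (fst x) < snd (fst x) \<and> snd (fst x) \<le> M" for x :: dpoint
    proof -
      have "(hc (fst x))\<^sup>2 \<le> (M / 2)\<^sup>2" using that by (intro power_mono) (auto simp: hc_def)
      also have "2 * \<dots> \<le> M\<^sup>2" by (simp add: power2_eq_square)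
      finally show ?thesis by simp
    qed
    fix i assume "i \<in> ?I"
    then show "(norm (f i - g i))\<^sup>2 \<le> M\<^sup>2"
      by (elim PlusE) (use b[OF U'(5)] b[OF V'(5)] in \<open>auto simp: f_def g_def norm_point_sq\<close>)
  qed
  also have "\<dots> = ennreal (card ?I * M\<^sup>2)" by (simp add: ennreal_mult ennreal_of_nat_eq_real_of_nat)
  also have "\<dots> \<le> ennreal (2 * real K * M\<^sup>2)"
    using U'(3) V'(3) U'(2) V'(2) by (intro ennreal_leI mult_right_mono) (simp_all add: card_Plus)
  finally show ?thesis .
qed

lemma W2_eq_W2r:
  assumes "U \<in> diagram_space M K" "V \<in> diagram_space M K"
  shows "W2 U V = ennreal (W2r U V)"
proof -
  have "(W2 U V)\<^sup>2 < top" using W2_sq_diagram_space_le[OF assms] by (rule le_less_trans) simp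
  then show ?thesis by (simp add: W2r_def power_less_top_ennreal)
qed

lemma W2_sq_eq:
  assumes "U \<in> diagram_space M K" "V \<in> diagram_space M K"
  shows "(W2 U V)\<^sup>2 = ennreal ((W2r U V)\<^sup>2)"
proof -
  have "W2r U V \<ge> 0" by (simp add: W2r_def)
  then show ?thesis by (subst W2_eq_W2r[OF assms]) (rule ennreal_power)
qed

text \<open>A real supremum is an upper bound only for a bounded set; the boundedness comes from
  \<open>W2_sq_diagram_space_le\<close>.\<close>

lemma W2r_le_max_dist:
  assumes "U \<in> diagram_space M K" "V \<in> diagram_space M K"
  shows "W2r U V \<le> max_dist M K"
proof -
  have "W2r U V \<le> sqrt (2 * real K * M\<^sup>2)" if "U \<in> diagram_space M K" "V \<in> diagram_space M K" for U V
  proof -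
    have "ennreal ((W2r U V)\<^sup>2) \<le> ennreal (2 * real K * M\<^sup>2)"
      using W2_sq_diagram_space_le[OF that] by (simp only: W2_sq_eq[OF that])
    then show ?thesis by (intro real_le_rsqrt) (simp add: ennreal_le_iff)
  qed
  then have "bdd_above ((\<lambda>(U, V). W2r U V) ` (diagram_space M K \<times> diagram_space M K))"
    by (intro bdd_aboveI[of _ "sqrt (2 * real K * M\<^sup>2)"]) auto
  from cSUP_upper[OF _ this, of "(U, V)"] show ?thesis using assms by (simp add: max_dist_def)
qed

section \<open>Overlap of perturbation laws\<close>

definition perturb_radius :: "real \<Rightarrow> point \<Rightarrow> real" where "perturb_radius \<alpha> p = min \<alpha> (infdist p diag)"

lemma perturb_radius_bounds:
  assumes "\<alpha> > 0"
  shows "0 \<le> perturb_radius \<alpha> p" "perturb_radius \<alpha> p \<le> \<alpha>" "perturb_radius \<alpha> p \<le> infdist p diag"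
  using assms by (auto simp: perturb_radius_def infdist_nonneg)

lemma perturb_radius_Lipschitz: "perturb_radius \<alpha> p \<le> perturb_radius \<alpha> q + norm (p - q)"
proof -
  have "infdist p diag \<le> infdist q diag + norm (p - q)"
    using infdist_triangle[of p diag q] by (simp add: dist_norm)
  moreover have "0 \<le> norm (p - q)" by simp
  ultimately show ?thesis unfolding perturb_radius_def by linarith
qed

lemma perturb_radius_sq_le:
  assumes "\<alpha> > 0" "q \<in> diag"
  shows "(perturb_radius \<alpha> p)\<^sup>2 \<le> (norm (p - q))\<^sup>2"
  using perturb_radius_bounds[OF assms(1), of p] infdist_diag_le[OF assms(2), of p] by (intro power_mono) linarith+

text \<open>The radius is at most the distance to the diagonal, so the ball cannot cross it.\<close>

lemma hc_pos_ball:
  assumes "hc x > 0" "p \<in> ball x (perturb_radius \<alpha> x)"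
  shows "hc p > 0"
proof (rule ccontr)
  assume "\<not> hc p > 0"
  then have "(hc x)\<^sup>2 \<le> (hc x - hc p)\<^sup>2" using assms(1) by (intro power_mono) auto
  also have "2 * \<dots> \<le> (norm (x - p))\<^sup>2" by (simp add: norm_point_sq)
  finally have "(infdist x diag)\<^sup>2 \<le> (norm (x - p))\<^sup>2" by (simp add: infdist_diag_sq)
  then have "infdist x diag \<le> norm (x - p)" by (rule power2_le_imp_le) simp
  moreover have "norm (x - p) < infdist x diag" using assms(2) by (simp add: perturb_radius_def dist_norm)
  ultimately show False by simp
qed

text \<open>The minimum of the two laws: both have the same constant density on their balls, so the
  planar part lives on the intersection, and the smaller atom remains.\<close>

definition overlap :: "real \<Rightarrow> point \<Rightarrow> point \<Rightarrow> point option measure" where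
  "overlap \<alpha> p q = opt_meas (1 / (pi * \<alpha>\<^sup>2)) (ball p (perturb_radius \<alpha> p) \<inter> ball q (perturb_radius \<alpha> q))
     (min ((\<alpha>\<^sup>2 - (perturb_radius \<alpha> p)\<^sup>2) / \<alpha>\<^sup>2) ((\<alpha>\<^sup>2 - (perturb_radius \<alpha> q)\<^sup>2) / \<alpha>\<^sup>2))"

lemma perturb_eq_opt_meas: "perturb \<alpha> x = opt_meas (1 / (pi * \<alpha>\<^sup>2)) (ball x (perturb_radius \<alpha> x)) ((\<alpha>\<^sup>2 - (perturb_radius \<alpha> x)\<^sup>2) / \<alpha>\<^sup>2)"
  by (simp add: perturb_eq perturb_radius_def)

lemma nn_integral_overlap_le:
  "(\<integral>\<^sup>+ u. g u \<partial>overlap \<alpha> p q) \<le> (\<integral>\<^sup>+ u. g u \<partial>perturb \<alpha> p)"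
  "(\<integral>\<^sup>+ u. g u \<partial>overlap \<alpha> p q) \<le> (\<integral>\<^sup>+ u. g u \<partial>perturb \<alpha> q)"
  unfolding overlap_def perturb_eq_opt_meas by (intro nn_integral_opt_meas_mono; auto)+

lemma finite_measure_overlap: "finite_measure (overlap \<alpha> p q)"
  unfolding overlap_def by (intro finite_measure_opt_meas) (auto intro: bounded_subset[OF bounded_ball])

lemma overlap_sym: "overlap \<alpha> p q = overlap \<alpha> q p"
  by (simp add: overlap_def Int_commute min.commute)

text \<open>The ball around \<open>p\<close> of radius \<open>perturb_radius \<alpha> q - \<parallel>p - q\<parallel>\<close> lies in both balls.\<close>

lemma overlap_mass_aux:
  assumes a: "\<alpha> > 0" and le: "perturb_radius \<alpha> p \<le> perturb_radius \<alpha> q"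
  shows "ennreal (1 - 2 * norm (p - q) / \<alpha>) \<le> emeasure (overlap \<alpha> p q) UNIV"
proof -
  \<comment> \<open>\<open>q\<close> has the larger radius and therefore the smaller atom, so the
    atom of the overlap is \<open>w\<close>.\<close>
  define r where "r = perturb_radius \<alpha> q"
  define d where "d = norm (p - q)"
  define w where "w = (\<alpha>\<^sup>2 - r\<^sup>2) / \<alpha>\<^sup>2"
  note b = perturb_radius_bounds[OF a]
  have r: "0 \<le> r" "r \<le> \<alpha>" using b(1)[of q] b(2)[of q] by (auto simp: r_def)
  have w0: "w \<ge> 0" using power_mono[OF r(2,1), of 2] by (simp add: w_def)
  have "(perturb_radius \<alpha> p)\<^sup>2 \<le> r\<^sup>2" using le b(1)[of p] by (auto simp: r_def intro: power_mono)
  then have "w \<le> (\<alpha>\<^sup>2 - (perturb_radius \<alpha> p)\<^sup>2) / \<alpha>\<^sup>2" unfolding w_def by (intro divide_right_mono) auto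
  then have em: "emeasure (overlap \<alpha> p q) UNIV =
      ennreal (1 / (pi * \<alpha>\<^sup>2)) * emeasure lborel (ball p (perturb_radius \<alpha> p) \<inter> ball q r) + ennreal w"
    unfolding overlap_def by (subst emeasure_opt_meas) (auto simp: r_def w_def min_def)
  show ?thesis
  proof (cases "d < r")
    \<comment> \<open>The balls may be disjoint, but the atom alone suffices: \<open>r\<close> is at
      most \<open>d\<close> and at most \<open>\<alpha>\<close>, so \<open>r * r\<close> is at most
      \<open>d * \<alpha>\<close>.\<close>
    case False
    have "1 - 2 * d / \<alpha> \<le> 1 - d / \<alpha>" using a by (simp add: d_def field_simps)
    also have "\<dots> \<le> 1 - r\<^sup>2 / \<alpha>\<^sup>2"
    proof -
      have "r / \<alpha> * (r / \<alpha>) \<le> d / \<alpha> * 1"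
        using False r a by (intro mult_mono) (auto simp: divide_right_mono d_def)
      then show ?thesis by (simp add: power2_eq_square)
    qed
    also have "\<dots> = w" using a by (simp add: w_def field_simps)
    finally have "ennreal (1 - 2 * norm (p - q) / \<alpha>) \<le> ennreal w" unfolding d_def by (rule ennreal_leI)
    then show ?thesis unfolding em by (simp add: add_increasing)
  next
    case True
    have "r - d \<le> perturb_radius \<alpha> p" using perturb_radius_Lipschitz[of \<alpha> q p] by (simp add: r_def d_def norm_minus_commute)
    then have sub: "ball p (r - d) \<subseteq> ball p (perturb_radius \<alpha> p) \<inter> ball q r"
      using dist_triangle[of q _ p] by (auto simp: d_def dist_norm norm_minus_commute) (smt (verit) dist_norm dist_triangle norm_minus_commute)
    have "ennreal (pi * (r - d)\<^sup>2) \<le> emeasure lborel (ball p (perturb_radius \<alpha> p) \<inter> ball q r)"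
      using emeasure_mono[OF sub, of lborel] True by (simp add: emeasure_ball_point)
    then have "ennreal (1 / (pi * \<alpha>\<^sup>2)) * ennreal (pi * (r - d)\<^sup>2) + ennreal w \<le> emeasure (overlap \<alpha> p q) UNIV"
      unfolding em by (intro add_mono mult_left_mono) auto
    moreover have "ennreal (1 / (pi * \<alpha>\<^sup>2)) * ennreal (pi * (r - d)\<^sup>2) + ennreal w = ennreal ((r - d)\<^sup>2 / \<alpha>\<^sup>2 + w)"
      using w0 by (simp flip: ennreal_mult ennreal_plus)
    \<comment> \<open>Expanding the square, the loss is at most \<open>2 * d * r\<close> over
      \<alpha> squared, and \<open>r\<close> is at most \<open>\<alpha>\<close>.\<close>
    moreover have "1 - 2 * d / \<alpha> \<le> (r - d)\<^sup>2 / \<alpha>\<^sup>2 + w"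
    proof -
      have "2 * d * r \<le> 2 * d * \<alpha>" using r by (intro mult_left_mono) (auto simp: d_def)
      moreover have "(r - d)\<^sup>2 = r\<^sup>2 - 2 * d * r + d\<^sup>2" by (simp add: power2_diff)
      moreover have "0 \<le> d\<^sup>2" by simp
      ultimately have "\<alpha>\<^sup>2 - 2 * d * \<alpha> \<le> (r - d)\<^sup>2 + (\<alpha>\<^sup>2 - r\<^sup>2)" by linarith
      then have "(\<alpha>\<^sup>2 - 2 * d * \<alpha>) / \<alpha>\<^sup>2 \<le> ((r - d)\<^sup>2 + (\<alpha>\<^sup>2 - r\<^sup>2)) / \<alpha>\<^sup>2"
        by (rule divide_right_mono) simp
      moreover have "(\<alpha>\<^sup>2 - 2 * d * \<alpha>) / \<alpha>\<^sup>2 = 1 - 2 * d / \<alpha>" using a by (simp add: field_simps power2_eq_square)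
      ultimately show ?thesis by (simp add: w_def add_divide_distrib)
    qed
    ultimately show ?thesis unfolding d_def by (metis (no_types, lifting) ennreal_leI order_trans)
  qed
qed

lemma overlap_mass:
  assumes a: "\<alpha> > 0"
  shows "1 - 2 * norm (p - q) / \<alpha> \<le> measure (overlap \<alpha> p q) UNIV" "measure (overlap \<alpha> p q) UNIV \<le> 1"
proof -
  interpret finite_measure "overlap \<alpha> p q" by (rule finite_measure_overlap)
  have "ennreal (1 - 2 * norm (p - q) / \<alpha>) \<le> emeasure (overlap \<alpha> p q) UNIV"
    using overlap_mass_aux[OF a, of p q] overlap_mass_aux[OF a, of q p]
    by (cases "perturb_radius \<alpha> p \<le> perturb_radius \<alpha> q") (auto simp: overlap_sym[of \<alpha> q p] norm_minus_commute)
  then show "1 - 2 * norm (p - q) / \<alpha> \<le> measure (overlap \<alpha> p q) UNIV"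
    by (simp add: emeasure_eq_measure)
  have "emeasure (overlap \<alpha> p q) UNIV = (\<integral>\<^sup>+ u. 1 \<partial>overlap \<alpha> p q)" by (simp add: overlap_def)
  also have "\<dots> \<le> (\<integral>\<^sup>+ u. 1 \<partial>perturb \<alpha> p)" by (rule nn_integral_overlap_le)
  also have "\<dots> = 1" using prob_space.emeasure_space_1[OF prob_space_perturb[OF a]] by simp
  finally show "measure (overlap \<alpha> p q) UNIV \<le> 1" by (simp add: emeasure_eq_measure)
qed

text \<open>The Weierstrass product inequality, here a union bound for independent losses; it rests
  on x y >= x + y - 1 for x, y in [0, 1].\<close>

lemma prod_ge_one_minus_sum:
  fixes e :: "'a \<Rightarrow> real"
  assumes "finite A" "\<And>x. x \<in> A \<Longrightarrow> 0 \<le> u x \<and> u x \<le> 1 \<and> 1 - e x \<le> u x"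
  shows "1 - (\<Sum>x\<in>A. e x) \<le> (\<Prod>x\<in>A. u x)"
  using assms
proof (induction rule: finite_induct)
  case (insert x A)
  have P: "0 \<le> (\<Prod>x\<in>A. u x)" "(\<Prod>x\<in>A. u x) \<le> 1" using insert by (auto intro: prod_nonneg prod_le_1)
  have "0 \<le> (1 - u x) * (1 - (\<Prod>x\<in>A. u x))" using P insert.prems[of x] by (intro mult_nonneg_nonneg) auto
  then have "u x + (\<Prod>x\<in>A. u x) - 1 \<le> u x * (\<Prod>x\<in>A. u x)" by (simp add: algebra_simps)
  moreover have "1 - (\<Sum>x\<in>A. e x) \<le> (\<Prod>x\<in>A. u x)" "1 - e x \<le> u x" using insert by auto
  ultimately show ?case using insert.hyps by simp
qed simp

text \<open>The set function in \<open>pfm\<close> is a finite sum of point masses at elements of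
  the space, so \<open>measure_of\<close> yields an actual measure with these values.\<close>

lemma pfm_eq_fin_meas:
  assumes N: "N \<ge> 1" and X: "\<And>i. i < N \<Longrightarrow> X i \<in> diagram_space M K"
  shows "pfm M N K \<alpha> X = fin_meas (diagram_borel M (N * K)) {G. is_grouping N (\<lambda>i. offpts (X i)) G}
      (grouping_prob N \<alpha> X) (grouping_mean N (\<lambda>_. fst))"
proof -
  have sp: "space (diagram_borel M (N * K)) = diagram_space M (N * K)"
    by (simp add: diagram_borel_def space_measure_of_conv)
  have "finite {G. is_grouping N (\<lambda>i. offpts (X i)) G}"
    by (rule finite_groupings) (rule diagram_spaceD(2)[OF X])
  moreover have "grouping_mean N (\<lambda>_. fst) \<in> {G. is_grouping N (\<lambda>i. offpts (X i)) G} \<rightarrow> space (diagram_borel M (N * K))"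
    using grouping_mean_in_space[OF N X] by (auto simp: sp)
  ultimately show ?thesis
    using measure_of_eq_fin_meas[of "{G. is_grouping N (\<lambda>i. offpts (X i)) G}" "grouping_mean N (\<lambda>_. fst)"
       "diagram_borel M (N * K)" "grouping_prob N \<alpha> X"]
    by (simp add: pfm_def sp)
qed

locale pfm_setup =
  fixes N K :: nat and M \<alpha> :: real and X :: "nat \<Rightarrow> diagram"
  assumes N: "N \<ge> 1" and a: "\<alpha> > 0" and X: "\<And>i. i < N \<Longrightarrow> X i \<in> diagram_space M K"
begin

sublocale perturbed_points N "\<lambda>i. offpts (X i)" "\<lambda>_. 1 / (pi * \<alpha>\<^sup>2)"
  "\<lambda>j. (\<alpha>\<^sup>2 - (perturb_radius \<alpha> (fst (snd j)))\<^sup>2) / \<alpha>\<^sup>2" "\<lambda>j. ball (fst (snd j)) (perturb_radius \<alpha> (fst (snd j)))"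
proof
  fix i and l :: dpoint and p assume l: "i < N" "l \<in> offpts (X i)" and p: "p \<in> ball (fst (snd (i, l))) (perturb_radius \<alpha> (fst (snd (i, l))))"
  have "hc (fst l) > 0" using diagram_spaceD(5)[OF X[OF l(1)] l(2)] by (simp add: hc_def)
  then show "hc p > 0" using p hc_pos_ball by simp
qed (use N diagram_spaceD(2)[OF X] in auto)

lemma Q_eq: "Q j = perturb \<alpha> (fst (snd j))"
  by (simp add: perturb_eq_opt_meas)

lemma prob_space_Q: "prob_space (Q j)"
  unfolding Q_eq by (rule prob_space_perturb[OF a])

lemma product_sigma_finite_Q: "product_sigma_finite Q"
  using prob_space_Q by (intro product_sigma_finite.intro prob_space_imp_sigma_finite)

lemma prob_space_P: "prob_space P"
  by (rule prob_space_PiM[OF prob_space_Q])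

lemma perturb_space_eq: "perturb_space N \<alpha> X = completion P"
proof -
  have "(\<lambda>(i, x). perturb \<alpha> (fst x)) = Q" by (auto simp: fun_eq_iff perturb_eq_opt_meas)
  then show ?thesis by (simp add: perturb_space_def I_def)
qed

lemma grouping_prob_eq: "grouping_prob N \<alpha> X G = measure P (grouping_event G)"
proof -
  have "random_grouping N X = rand_grouping" by (simp add: fun_eq_iff random_grouping_def rand_grouping_def)
  then show ?thesis unfolding grouping_prob_def perturb_space_eq by (simp only: measure_rand_grouping_completion)
qed

lemma sum_grouping_prob: "(\<Sum>G | is_grouping N (\<lambda>i. offpts (X i)) G. grouping_prob N \<alpha> X G) = 1"
  unfolding grouping_prob_eq by (rule sum_grouping_event[OF prob_space_P])

lemma weight_bounds: "0 \<le> (\<alpha>\<^sup>2 - (perturb_radius \<alpha> p)\<^sup>2) / \<alpha>\<^sup>2" "(\<alpha>\<^sup>2 - (perturb_radius \<alpha> p)\<^sup>2) / \<alpha>\<^sup>2 \<le> 1"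
  "(\<alpha>\<^sup>2 - (perturb_radius \<alpha> p)\<^sup>2) / \<alpha>\<^sup>2 = 1 - (perturb_radius \<alpha> p)\<^sup>2 / \<alpha>\<^sup>2"
proof -
  have "(perturb_radius \<alpha> p)\<^sup>2 \<le> \<alpha>\<^sup>2" using perturb_radius_bounds[OF a, of p] by (intro power_mono) auto
  then show "0 \<le> (\<alpha>\<^sup>2 - (perturb_radius \<alpha> p)\<^sup>2) / \<alpha>\<^sup>2" by simp
  show "(\<alpha>\<^sup>2 - (perturb_radius \<alpha> p)\<^sup>2) / \<alpha>\<^sup>2 \<le> 1" using a by (simp add: field_simps)
  show "(\<alpha>\<^sup>2 - (perturb_radius \<alpha> p)\<^sup>2) / \<alpha>\<^sup>2 = 1 - (perturb_radius \<alpha> p)\<^sup>2 / \<alpha>\<^sup>2" using a by (simp add: field_simps)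
qed

text \<open>The domination result for indicators, with the labels outside \<open>T\<close> frozen at
  \<Delta>; their atoms form the factor in front.\<close>

lemma emeasure_ext_fam_le:
  fixes s :: "nat \<times> dpoint \<Rightarrow> 'j"
  assumes T: "T \<subseteq> I" "inj_on s T" and R: "product_sigma_finite R"
    and sets: "\<And>j. j \<in> T \<Longrightarrow> sets (R (s j)) = sets (Q j)"
    and le: "\<And>j g. j \<in> T \<Longrightarrow> (\<integral>\<^sup>+ u. g u \<partial>R (s j)) \<le> (\<integral>\<^sup>+ u. g u \<partial>Q j)"
    and A: "A \<in> sets P"
  shows "ennreal (\<Prod>j\<in>I - T. (\<alpha>\<^sup>2 - (perturb_radius \<alpha> (fst (snd j)))\<^sup>2) / \<alpha>\<^sup>2) *
      emeasure (PiM (s ` T) R) (ext_fam I T s None -` A \<inter> space (PiM (s ` T) R)) \<le> emeasure P A"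
proof -
  let ?KJ = "PiM (s ` T) R" and ?v = "ext_fam I T s None"
  have I: "T \<union> (I - T) = I" using T by auto
  have H: "(\<Prod>j\<in>I - T. ennreal ((\<alpha>\<^sup>2 - (perturb_radius \<alpha> (fst (snd j)))\<^sup>2) / \<alpha>\<^sup>2)) *
      (\<integral>\<^sup>+ v. indicator A (ext_fam (T \<union> (I - T)) T s None v) \<partial>?KJ)
     \<le> (\<integral>\<^sup>+ v. indicator A v \<partial>PiM (T \<union> (I - T)) Q)"
  proof (rule nn_integral_PiM_ext_fam_le[OF product_sigma_finite_Q R])
    show "finite T" "finite (I - T)" using T(1) finI by (auto intro: finite_subset)
    show "ennreal ((\<alpha>\<^sup>2 - (perturb_radius \<alpha> (fst (snd j)))\<^sup>2) / \<alpha>\<^sup>2) * g None \<le> (\<integral>\<^sup>+ y. g y \<partial>Q j)"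
      if "g \<in> borel_measurable (Q j)" for j :: "nat \<times> dpoint" and g
      using that by (intro opt_meas_atom_le) auto
    show "indicator A \<in> borel_measurable (PiM (T \<union> (I - T)) Q)"
      unfolding I by (rule borel_measurable_indicator[OF A])
  qed (use T sets le in auto)
  have "(\<integral>\<^sup>+ v. indicator A (?v v) \<partial>?KJ) = (\<integral>\<^sup>+ v. indicator (?v -` A \<inter> space ?KJ) v \<partial>?KJ)"
    by (intro nn_integral_cong) (auto split: split_indicator)
  moreover have "?v -` A \<inter> space ?KJ \<in> sets ?KJ"
    by (rule measurable_sets[OF measurable_ext_fam A]) (use sets in auto)
  ultimately show ?thesis
    using H[unfolded I] A weight_bounds(1) by (simp add: prod_ennreal)
qed

end

section \<open>The coupling\<close>

locale pfm_pair =
  X: pfm_setup N K M \<alpha> X + Y: pfm_setup N K M \<alpha> Y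
  for N K :: nat and M \<alpha> :: real and X Y :: "nat \<Rightarrow> diagram" +
  fixes \<phi> :: "nat \<Rightarrow> dpoint \<Rightarrow> dpoint"
  assumes opt: "\<And>i. i < N \<Longrightarrow> optimal_matching (X i) (Y i) (\<phi> i)"
begin

definition "J = {(i, x). i < N \<and> x \<in> offpts (X i) \<and> fst (\<phi> i x) \<notin> diag}"

definition "t = (\<lambda>(i, x). (i, \<phi> i x))"

definition "t_inv = inv_into J t"

abbreviation "R \<equiv> \<lambda>(i, x). overlap \<alpha> (fst x) (fst (\<phi> i x))"

lemma match: "i < N \<Longrightarrow> matching (X i) (Y i) (\<phi> i)"
  using opt by (simp add: optimal_matching_def)

lemma finX: "i < N \<Longrightarrow> finite (offpts (X i))" and finY: "i < N \<Longrightarrow> finite (offpts (Y i))"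
  using diagram_spaceD(2) X.X Y.X by blast+

lemma J_subset: "J \<subseteq> X.I"
  by (auto simp: J_def X.I_def)

lemma finJ: "finite J"
  by (rule finite_subset[OF J_subset X.finI])

lemma tJ_subset: "t ` J \<subseteq> Y.I"
proof -
  have "\<phi> i x \<in> offpts (Y i)" if "i < N" "x \<in> offpts (X i)" "fst (\<phi> i x) \<notin> diag" for i x
    using match[OF that(1)] that by (auto simp: offpts_def matching_def bij_betw_def)
  then show ?thesis by (auto simp: J_def Y.in_I_iff t_def)
qed

lemma inj_t: "inj_on t J"
proof (rule inj_onI)
  fix a b assume ab: "a \<in> J" "b \<in> J" "t a = t b"
  obtain i x where a: "a = (i, x)" by (cases a)
  obtain y where b: "b = (i, y)" using ab(3) a by (cases b) (auto simp: t_def)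
  have "i < N" "x \<in> pts (X i)" "y \<in> pts (X i)" using ab(1,2) a b by (auto simp: J_def offpts_def)
  then have "x = y" using ab(3) a b match[of i] by (auto simp: t_def matching_def bij_betw_def inj_on_def)
  then show "a = b" using a b by simp
qed

lemma t_inv_t [simp]: "j \<in> J \<Longrightarrow> t_inv (t j) = j"
  unfolding t_inv_def by (rule inv_into_f_f[OF inj_t])

lemma t_inv_image: "t_inv ` t ` J = J"
  by (simp add: image_image)

lemma inj_t_inv: "inj_on t_inv (t ` J)"
  by (rule inj_on_inverseI[of _ t]) auto

text \<open>Under \<open>KJ\<close> both points of every matched pair are perturbed to the same value; \<open>vX\<close> and \<open>vY\<close>
  read this as perturbations of \<open>X\<close> and \<open>Y\<close> which send all unmatched points to \<open>\<Delta>\<close>.\<close>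

definition "KJ = PiM J R"

definition "vX = ext_fam X.I J id None"

definition "vY = ext_fam Y.I (t ` J) t_inv None"

lemma finite_measure_R: "finite_measure (R j)"
  by (cases j) (simp add: finite_measure_overlap)

lemma psf_R: "product_sigma_finite R"
  using finite_measure_R by (intro product_sigma_finite.intro) (auto simp: finite_measure_def)

lemma sets_R: "sets (R j) = {A. Some -` A \<in> sets borel}"
  by (cases j) (simp add: overlap_def sets_opt_meas)

lemma space_R: "space (R j) = UNIV"
  by (cases j) (simp add: overlap_def)

text \<open>The probability that the perturbation of \<open>X\<close> sends all unmatched points to
  \<Delta>.\<close>

definition "cX = (\<Prod>j\<in>X.I - J. (\<alpha>\<^sup>2 - (perturb_radius \<alpha> (fst (snd j)))\<^sup>2) / \<alpha>\<^sup>2)"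

definition "cY = (\<Prod>j\<in>Y.I - t ` J. (\<alpha>\<^sup>2 - (perturb_radius \<alpha> (fst (snd j)))\<^sup>2) / \<alpha>\<^sup>2)"

lemma c_bounds: "0 \<le> cX" "cX \<le> 1" "0 \<le> cY" "cY \<le> 1"
  unfolding cX_def cY_def using X.weight_bounds by (auto intro!: prod_nonneg prod_le_1)

lemma measurable_vX: "vX \<in> measurable KJ X.P"
  unfolding vX_def KJ_def by (rule measurable_ext_fam) (auto simp: sets_R sets_opt_meas)

lemma measurable_vY: "vY \<in> measurable KJ Y.P"
  unfolding vY_def KJ_def by (rule measurable_ext_fam) (auto simp: sets_R sets_opt_meas)

text \<open>Overlaps lie below the laws of the matched points of \<open>X\<close>, and
  \<open>cX\<close> accounts for the atoms of the others. So the law of \<open>vX\<close> scaled by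
  \<open>cX\<close> is part of the perturbation law.\<close>

lemma vX_le:
  assumes A: "A \<in> sets X.P"
  shows "ennreal cX * emeasure KJ (vX -` A \<inter> space KJ) \<le> emeasure X.P A"
proof -
  have "(\<integral>\<^sup>+ u. g u \<partial>R (id j)) \<le> (\<integral>\<^sup>+ u. g u \<partial>X.Q j)" for g and j :: "nat \<times> dpoint"
    using nn_integral_overlap_le(1)[of \<alpha> "fst (snd j)" _ g] by (cases j) (simp add: perturb_eq_opt_meas)
  then show ?thesis
    using X.emeasure_ext_fam_le[OF J_subset _ psf_R _ _ A, of id]
    by (simp add: cX_def KJ_def vX_def sets_R sets_opt_meas)
qed

lemma vY_le:
  assumes A: "A \<in> sets Y.P"
  shows "ennreal cY * emeasure KJ (vY -` A \<inter> space KJ) \<le> emeasure Y.P A"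
proof -
  have "(\<integral>\<^sup>+ u. g u \<partial>R (t_inv j)) \<le> (\<integral>\<^sup>+ u. g u \<partial>Y.Q j)" if j: "j \<in> t ` J" for g and j :: "nat \<times> dpoint"
  proof -
    obtain i x where ix: "(i, x) \<in> J" "j = t (i, x)" using j by auto
    then show ?thesis
      using nn_integral_overlap_le(2)[of \<alpha> "fst x" "fst (\<phi> i x)" g] by (simp add: perturb_eq_opt_meas) (simp add: t_def)
  qed
  then show ?thesis
    using Y.emeasure_ext_fam_le[OF tJ_subset inj_t_inv psf_R _ _ A]
    by (simp add: cY_def KJ_def vY_def sets_R sets_opt_meas t_inv_image)
qed

lemma KJ_mass: "emeasure KJ (space KJ) = ennreal (\<Prod>(i, x)\<in>J. measure (overlap \<alpha> (fst x) (fst (\<phi> i x))) UNIV)"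
proof -
  interpret product_sigma_finite R by (rule psf_R)
  have "emeasure KJ (space KJ) = (\<Prod>j\<in>J. emeasure (R j) (space (R j)))"
    unfolding KJ_def space_PiM by (rule emeasure_PiM[OF finJ]) auto
  also have "\<dots> = (\<Prod>j\<in>J. ennreal (measure (R j) UNIV))"
    by (rule prod.cong) (simp_all add: space_R finite_measure.emeasure_eq_measure[OF finite_measure_R])
  also have "\<dots> = ennreal (\<Prod>j\<in>J. measure (R j) UNIV)" by (rule prod_ennreal) simp
  also have "(\<Prod>j\<in>J. measure (R j) UNIV) = (\<Prod>(i, x)\<in>J. measure (overlap \<alpha> (fst x) (fst (\<phi> i x))) UNIV)"
    by (rule prod.cong) auto
  finally show ?thesis .
qed

lemma finite_measure_KJ: "finite_measure KJ"
  using KJ_mass by (intro finite_measureI) simp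

lemma total_mass_ge:
  "1 - ((\<Sum>j\<in>X.I - J. (perturb_radius \<alpha> (fst (snd j)))\<^sup>2 / \<alpha>\<^sup>2) + (\<Sum>j\<in>Y.I - t ` J. (perturb_radius \<alpha> (fst (snd j)))\<^sup>2 / \<alpha>\<^sup>2)
      + (\<Sum>(i, x)\<in>J. 2 * norm (fst x - fst (\<phi> i x)) / \<alpha>)) \<le> cX * cY * measure KJ (space KJ)"
proof -
  have mass: "measure KJ (space KJ) = (\<Prod>(i, x)\<in>J. measure (overlap \<alpha> (fst x) (fst (\<phi> i x))) UNIV)"
    using KJ_mass by (simp add: measure_def prod_nonneg case_prod_unfold)
  have "1 - (\<Sum>(i, x)\<in>J. 2 * norm (fst x - fst (\<phi> i x)) / \<alpha>) \<le> measure KJ (space KJ)"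
    unfolding mass by (rule prod_ge_one_minus_sum[OF finJ]) (simp_all add: case_prod_unfold overlap_mass[OF X.a])
  moreover have "measure KJ (space KJ) \<le> 1"
    unfolding mass by (rule prod_le_1) (simp_all add: case_prod_unfold overlap_mass[OF X.a])
  moreover have "1 - (\<Sum>j\<in>X.I - J. (perturb_radius \<alpha> (fst (snd j)))\<^sup>2 / \<alpha>\<^sup>2) \<le> cX"
    unfolding cX_def by (rule prod_ge_one_minus_sum) (use X.finI X.weight_bounds in auto)
  moreover have "1 - (\<Sum>j\<in>Y.I - t ` J. (perturb_radius \<alpha> (fst (snd j)))\<^sup>2 / \<alpha>\<^sup>2) \<le> cY"
    unfolding cY_def by (rule prod_ge_one_minus_sum) (use Y.finI X.weight_bounds in auto)
  \<comment> \<open>Used twice, it turns the product of three masses into a sum of their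
    losses.\<close>
  moreover have "x + y - 1 \<le> x * y" if "x \<le> 1" "y \<le> 1" for x y :: real
    using mult_nonneg_nonneg[of "1 - x" "1 - y"] that by (simp add: algebra_simps)
  note this[of cX cY] this[of "cX * cY" "measure KJ (space KJ)"]
  moreover have "cX * cY \<le> 1" using c_bounds by (simp add: mult_le_one)
  ultimately show ?thesis using c_bounds by linarith
qed

text \<open>Domination pulls null sets back only if the scaling constants are positive; otherwise
  the coupled mass is 0.\<close>

lemma null_preimage:
  assumes "cX * cY > 0"
  shows "vX -` X.Bad \<inter> space KJ \<in> null_sets KJ" "vY -` Y.Bad \<inter> space KJ \<in> null_sets KJ"
proof -
  have c: "cX > 0" "cY > 0" using assms c_bounds by (auto simp: zero_less_mult_iff)
  have "ennreal cX * emeasure KJ (vX -` X.Bad \<inter> space KJ) = 0"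
    using vX_le[OF X.sets_Bad] X.null_Bad by (simp add: null_setsD1)
  then show "vX -` X.Bad \<inter> space KJ \<in> null_sets KJ"
    using c measurable_sets[OF measurable_vX X.sets_Bad] by (auto simp: null_sets_def)
  have "ennreal cY * emeasure KJ (vY -` Y.Bad \<inter> space KJ) = 0"
    using vY_le[OF Y.sets_Bad] Y.null_Bad by (simp add: null_setsD1)
  then show "vY -` Y.Bad \<inter> space KJ \<in> null_sets KJ"
    using c measurable_sets[OF measurable_vY Y.sets_Bad] by (auto simp: null_sets_def)
qed

definition "GX = {G. is_grouping N (\<lambda>i. offpts (X i)) G}"

definition "GY = {G. is_grouping N (\<lambda>i. offpts (Y i)) G}"

definition "both G G' = (vX -` X.grouping_event G \<inter> space KJ) \<inter> (vY -` Y.grouping_event G' \<inter> space KJ)"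

text \<open>Mass of the part where unmatched points on both sides go to \<Delta>, matched pairs
  share their perturbation, and the groupings are \<open>G\<close> and \<open>G'\<close>. It is only
  a partial coupling, which \<open>partial_coupling_cost\<close> completes.\<close>

definition "joint_mass G G' = cX * cY * measure KJ (both G G')"

lemma finG: "finite GX" "finite GY"
  unfolding GX_def GY_def using finX finY by (auto intro: finite_groupings)

lemma sets_both: "both G G' \<in> sets KJ"
  unfolding both_def
  by (intro sets.Int measurable_sets[OF measurable_vX X.grouping_event_sets] measurable_sets[OF measurable_vY Y.grouping_event_sets])

lemma joint_mass_nonneg: "joint_mass G G' \<ge> 0"
  using c_bounds by (simp add: joint_mass_def)

text \<open>The events for different \<open>G'\<close> are disjoint; bounding \<open>cY\<close> by 1
  leaves a quantity to which \<open>vX_le\<close> applies.\<close>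

lemma joint_mass_row: "(\<Sum>G'\<in>GY. joint_mass G G') \<le> grouping_prob N \<alpha> X G"
proof -
  interpret finite_measure KJ by (rule finite_measure_KJ)
  interpret PX: prob_space X.P by (rule X.prob_space_P)
  have m: "vX -` X.grouping_event G \<inter> space KJ \<in> sets KJ" by (rule measurable_sets[OF measurable_vX X.grouping_event_sets])
  have "(\<Sum>G'\<in>GY. measure KJ (both G G')) = measure KJ (\<Union>G'\<in>GY. both G G')"
    using finG sets_both
    by (intro finite_measure_finite_Union[symmetric]) (auto simp: disjoint_family_on_def both_def Y.grouping_event_def)
  also have "\<dots> \<le> measure KJ (vX -` X.grouping_event G \<inter> space KJ)"
    by (rule finite_measure_mono[OF _ m]) (auto simp: both_def)
  finally have "(\<Sum>G'\<in>GY. joint_mass G G') \<le> cX * cY * measure KJ (vX -` X.grouping_event G \<inter> space KJ)"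
    unfolding joint_mass_def sum_distrib_left[symmetric] using c_bounds by (intro mult_left_mono) auto
  also have "\<dots> \<le> cX * 1 * measure KJ (vX -` X.grouping_event G \<inter> space KJ)"
    using c_bounds by (intro mult_right_mono mult_left_mono) auto
  also have "\<dots> \<le> measure X.P (X.grouping_event G)"
    using vX_le[OF X.grouping_event_sets[of G]] c_bounds
    by (simp add: emeasure_eq_measure PX.emeasure_eq_measure flip: ennreal_mult)
  finally show ?thesis by (simp add: X.grouping_prob_eq)
qed

lemma joint_mass_column: "(\<Sum>G\<in>GX. joint_mass G G') \<le> grouping_prob N \<alpha> Y G'"
proof -
  interpret finite_measure KJ by (rule finite_measure_KJ)
  interpret PY: prob_space Y.P by (rule Y.prob_space_P)
  have m: "vY -` Y.grouping_event G' \<inter> space KJ \<in> sets KJ" by (rule measurable_sets[OF measurable_vY Y.grouping_event_sets])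
  have "(\<Sum>G\<in>GX. measure KJ (both G G')) = measure KJ (\<Union>G\<in>GX. both G G')"
    using finG sets_both
    by (intro finite_measure_finite_Union[symmetric]) (auto simp: disjoint_family_on_def both_def X.grouping_event_def)
  also have "\<dots> \<le> measure KJ (vY -` Y.grouping_event G' \<inter> space KJ)"
    by (rule finite_measure_mono[OF _ m]) (auto simp: both_def)
  finally have "(\<Sum>G\<in>GX. joint_mass G G') \<le> cX * cY * measure KJ (vY -` Y.grouping_event G' \<inter> space KJ)"
    unfolding joint_mass_def sum_distrib_left[symmetric] using c_bounds by (intro mult_left_mono) auto
  also have "\<dots> \<le> 1 * cY * measure KJ (vY -` Y.grouping_event G' \<inter> space KJ)"
    using c_bounds by (intro mult_right_mono) auto
  also have "\<dots> \<le> measure Y.P (Y.grouping_event G')"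
    using vY_le[OF Y.grouping_event_sets[of G']] c_bounds
    by (simp add: emeasure_eq_measure PY.emeasure_eq_measure flip: ennreal_mult)
  finally show ?thesis by (simp add: Y.grouping_prob_eq)
qed

text \<open>Off the preimages of the two sets \<open>Bad\<close> every family determines a pair of
  groupings; if a scaling constant is 0, both sides vanish.\<close>

lemma joint_mass_total: "(\<Sum>G\<in>GX. \<Sum>G'\<in>GY. joint_mass G G') = cX * cY * measure KJ (space KJ)"
proof (cases "cX * cY > 0")
  case False
  then have "cX * cY = 0" using c_bounds by (simp add: zero_less_mult_iff)
  then show ?thesis by (simp only: joint_mass_def mult_zero_left sum.neutral_const)
next
  case True
  interpret finite_measure KJ by (rule finite_measure_KJ)
  let ?N = "(vX -` X.Bad \<inter> space KJ) \<union> (vY -` Y.Bad \<inter> space KJ)"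
  have N: "?N \<in> null_sets KJ" using null_preimage[OF True] by (rule null_sets.Un)
  have "(\<Sum>G\<in>GX. \<Sum>G'\<in>GY. measure KJ (both G G')) = (\<Sum>x\<in>GX \<times> GY. measure KJ (both (fst x) (snd x)))"
    by (simp add: sum.cartesian_product case_prod_unfold)
  also have "\<dots> = measure KJ (\<Union>x\<in>GX \<times> GY. both (fst x) (snd x))"
    using finG sets_both
    by (intro finite_measure_finite_Union[symmetric])
      (auto simp: disjoint_family_on_def both_def X.grouping_event_def Y.grouping_event_def)
  also have "(\<Union>x\<in>GX \<times> GY. both (fst x) (snd x)) = space KJ - ?N"
  proof (intro set_eqI iffI)
    fix v assume v: "v \<in> space KJ - ?N"
    then have "vX v \<in> space X.P" "vX v \<notin> X.Bad" "vY v \<in> space Y.P" "vY v \<notin> Y.Bad"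
      using measurable_space[OF measurable_vX] measurable_space[OF measurable_vY] by auto
    then have "X.rand_grouping (vX v) \<in> GX" "Y.rand_grouping (vY v) \<in> GY" "v \<in> both (X.rand_grouping (vX v)) (Y.rand_grouping (vY v))"
      using v X.rand_grouping_grouping Y.rand_grouping_grouping by (auto simp: GX_def GY_def both_def X.grouping_event_def Y.grouping_event_def)
    then show "v \<in> (\<Union>x\<in>GX \<times> GY. both (fst x) (snd x))" by force
  qed (auto simp: both_def X.grouping_event_def Y.grouping_event_def)
  also have "measure KJ (space KJ - ?N) = measure KJ (space KJ)"
    by (rule measure_Diff_null_set) (use N in auto)
  finally show ?thesis unfolding joint_mass_def sum_distrib_left[symmetric] by simp
qed

lemma present_vX: "present (vX v) X.I = {j \<in> J. v j \<noteq> None}"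
  using J_subset by (auto simp: present_def vX_def ext_fam_def)

lemma present_vY: "present (vY v) Y.I = t ` {j \<in> J. v j \<noteq> None}"
  using tJ_subset by (auto simp: present_def vY_def ext_fam_def image_iff)

text \<open>For a coupled family the surviving labels correspond under \<open>t\<close> and have
  equal perturbed positions, so the cheapest groupings correspond by
  \<open>minimal_grouping_relabel\<close>. Their means at the original points are then
  compared.\<close>

lemma W2_means_le_of_both:
  assumes v: "v \<in> both G G'"
  shows "(W2 (grouping_mean N (\<lambda>_. fst) G) (grouping_mean N (\<lambda>_. fst) G'))\<^sup>2
     \<le> (\<Sum>i<N. (matching_cost (X i) (\<phi> i))\<^sup>2)"
proof -
  have vX: "vX v \<in> space X.P" "vX v \<notin> X.Bad" "X.rand_grouping (vX v) = G"
    and vY: "vY v \<in> space Y.P" "vY v \<notin> Y.Bad" "Y.rand_grouping (vY v) = G'"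
    using v by (auto simp: both_def X.grouping_event_def Y.grouping_event_def)
  define S where "S = {j \<in> J. v j \<noteq> None}"
  have SJ: "S \<subseteq> J" by (auto simp: S_def)
  note pX = present_vX[of v, folded S_def] and pY = present_vY[of v, folded S_def]
  obtain G0 where G0: "minimal_grouping N (slice S) (vloc (vX v)) G0"
    using X.ex_minimal_off_Bad[OF vX(1,2)] unfolding pX by auto
  obtain G0' where G0': "minimal_grouping N (slice (t ` S)) (vloc (vY v)) G0'"
    using Y.ex_minimal_off_Bad[OF vY(1,2)] unfolding pY by auto
  have G: "G = G0 \<union> trivials (X.I - S)"
    using X.rand_grouping_eq[OF vX(1,2), of G0] G0 unfolding pX vX(3) by simp
  have G': "G' = G0' \<union> trivials (Y.I - t ` S)"
    using Y.rand_grouping_eq[OF vY(1,2), of G0'] G0' unfolding pY vY(3) by simp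
  have "G0' = relabel \<phi> ` G0"
  proof (rule minimal_grouping_relabel[OF _ _ G0 G0'])
    fix i assume i: "i < N"
    have "slice (t ` S) i = \<phi> i ` slice S i" by (auto simp: slice_def t_def image_iff) force
    moreover have "inj_on (\<phi> i) (slice S i)"
    proof (rule inj_onI)
      fix x y assume "x \<in> slice S i" "y \<in> slice S i" "\<phi> i x = \<phi> i y"
      then have "t (i, x) = t (i, y)" "(i, x) \<in> J" "(i, y) \<in> J"
        using SJ by (auto simp: slice_def t_def)
      then have "(i, x) = (i, y)" by (rule inj_onD[OF inj_t])
      then show "x = y" by simp
    qed
    ultimately show "bij_betw (\<phi> i) (slice S i) (slice (t ` S) i)" by (simp add: bij_betw_def)
    fix x assume "x \<in> slice S i"
    then have ix: "(i, x) \<in> J" using SJ by (auto simp: slice_def)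
    then have "(i, x) \<in> X.I" "t (i, x) \<in> t ` J" "t (i, x) \<in> Y.I" using J_subset tJ_subset by auto
    then have "vY v (t (i, x)) = vX v (i, x)"
      using ix by (simp add: vY_def vX_def ext_fam_def)
    then show "vloc (vY v) i (\<phi> i x) = vloc (vX v) i x" by (simp add: vloc_def t_def)
  qed
  then show ?thesis
    using W2_grouping_means_le[of N X Y \<phi> S G0, OF X.N finX finY match] SJ G0
    by (simp add: G G' J_def t_def X.I_def Y.I_def minimal_grouping_def)
qed

text \<open>Here the optimality of the matchings enters; the estimates before it hold for any
  matchings.\<close>

lemma sum_matching_cost: "(\<Sum>i<N. (matching_cost (X i) (\<phi> i))\<^sup>2) = ennreal ((d2_vec N X Y)\<^sup>2)"
proof -
  have "(\<Sum>i<N. (matching_cost (X i) (\<phi> i))\<^sup>2) = (\<Sum>i<N. ennreal ((W2r (X i) (Y i))\<^sup>2))"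
    using opt W2_sq_eq[OF X.X Y.X] by (intro sum.cong) (auto simp: optimal_matching_def)
  also have "\<dots> = ennreal (\<Sum>i<N. (W2r (X i) (Y i))\<^sup>2)" by (simp add: sum_ennreal)
  also have "(\<Sum>i<N. (W2r (X i) (Y i))\<^sup>2) = (d2_vec N X Y)\<^sup>2" by (simp add: d2_vec_def sum_nonneg)
  finally show ?thesis .
qed

abbreviation "matched_dist \<equiv> (\<Sum>i<N. \<Sum>x | x \<in> offpts (X i) \<and> fst (\<phi> i x) \<notin> diag. norm (fst x - fst (\<phi> i x)))"

lemma uncoupled_mass_le:
  "1 - (\<Sum>G\<in>GX. \<Sum>G'\<in>GY. joint_mass G G') \<le> 2 / \<alpha> * matched_dist + (d2_vec N X Y)\<^sup>2 / \<alpha>\<^sup>2"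
proof -
  \<comment> \<open>The loss at an unmatched point is its squared radius over \<alpha> squared, and
    the radius is at most the distance to any diagonal point, in particular to its partner.\<close>
  let ?F = "\<lambda>j :: nat \<times> dpoint. (perturb_radius \<alpha> (fst (snd j)))\<^sup>2"
  have "ennreal ((\<Sum>(i, x)\<in>J. (norm (fst x - fst (\<phi> i x)))\<^sup>2) + (\<Sum>j\<in>X.I - J. ?F j) + (\<Sum>j\<in>Y.I - t ` J. ?F j))
      \<le> ennreal ((d2_vec N X Y)\<^sup>2)"
    unfolding sum_matching_cost[symmetric] J_def t_def X.I_def Y.I_def
    by (rule sum_dist_le_matching_cost[OF finX finY match]) (simp_all add: perturb_radius_sq_le[OF X.a])
  then have "(\<Sum>(i, x)\<in>J. (norm (fst x - fst (\<phi> i x)))\<^sup>2) + (\<Sum>j\<in>X.I - J. ?F j) + (\<Sum>j\<in>Y.I - t ` J. ?F j) \<le> (d2_vec N X Y)\<^sup>2"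
    by (simp only: ennreal_le_iff zero_le_power2)
  moreover have "0 \<le> (\<Sum>(i, x)\<in>J. (norm (fst x - fst (\<phi> i x)))\<^sup>2)" by (intro sum_nonneg) auto
  ultimately have "((\<Sum>j\<in>X.I - J. ?F j) + (\<Sum>j\<in>Y.I - t ` J. ?F j)) / \<alpha>\<^sup>2 \<le> (d2_vec N X Y)\<^sup>2 / \<alpha>\<^sup>2"
    by (intro divide_right_mono) auto
  moreover have "(\<Sum>(i, x)\<in>J. 2 * norm (fst x - fst (\<phi> i x)) / \<alpha>) = 2 / \<alpha> * matched_dist"
  proof -
    have "J = Sigma {..<N} (\<lambda>i. {x. x \<in> offpts (X i) \<and> fst (\<phi> i x) \<notin> diag})" by (auto simp: J_def)
    then have "matched_dist = (\<Sum>(i, x)\<in>J. norm (fst x - fst (\<phi> i x)))"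
      using finX by (simp add: sum.Sigma)
    then show ?thesis by (simp add: sum_distrib_left case_prod_unfold)
  qed
  ultimately show ?thesis
    using total_mass_ge unfolding joint_mass_total by (simp add: sum_divide_distrib add_divide_distrib)
qed

lemma wasserstein2_pfm_le:
  "wasserstein2 (pfm M N K \<alpha> X) (pfm M N K \<alpha> Y) \<le> esqrt (ennreal ((d2_vec N X Y)\<^sup>2 +
     (2 / \<alpha> * matched_dist + (d2_vec N X Y)\<^sup>2 / \<alpha>\<^sup>2) * (max_dist M (N * K))\<^sup>2))"
proof -
  let ?m = "grouping_mean N (\<lambda>_. fst) :: dpoint selection set \<Rightarrow> diagram"
  let ?B = "diagram_borel M (N * K)"
  define k where "k G G' = (W2r (?m G) (?m G'))\<^sup>2" for G G'
  have mX: "?m G \<in> diagram_space M (N * K)" if "G \<in> GX" for G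
    using grouping_mean_in_space[OF X.N X.X] that by (simp add: GX_def)
  have mY: "?m G \<in> diagram_space M (N * K)" if "G \<in> GY" for G
    using grouping_mean_in_space[OF Y.N Y.X] that by (simp add: GY_def)
  have sp: "space ?B = diagram_space M (N * K)"
    by (simp add: diagram_borel_def space_measure_of_conv)
  have "\<exists>\<pi>. (\<forall>G\<in>GX. \<forall>G'\<in>GY. \<pi> G G' \<ge> 0) \<and> (\<forall>G\<in>GX. (\<Sum>G'\<in>GY. \<pi> G G') = grouping_prob N \<alpha> X G) \<and>
     (\<forall>G'\<in>GY. (\<Sum>G\<in>GX. \<pi> G G') = grouping_prob N \<alpha> Y G') \<and>
     (\<Sum>G\<in>GX. \<Sum>G'\<in>GY. \<pi> G G' * k G G') \<le> (d2_vec N X Y)\<^sup>2 +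
       (2 / \<alpha> * matched_dist + (d2_vec N X Y)\<^sup>2 / \<alpha>\<^sup>2) * (max_dist M (N * K))\<^sup>2"
  proof (rule partial_coupling_cost[OF finG joint_mass_nonneg joint_mass_row _ joint_mass_column _ uncoupled_mass_le])
    show "(\<Sum>G\<in>GX. grouping_prob N \<alpha> X G) = 1" "(\<Sum>G\<in>GY. grouping_prob N \<alpha> Y G) = 1"
      unfolding GX_def GY_def by (rule X.sum_grouping_prob Y.sum_grouping_prob)+
    fix G G' assume G: "G \<in> GX" "G' \<in> GY"
    show "k G G' \<le> (max_dist M (N * K))\<^sup>2"
      unfolding k_def using W2r_le_max_dist[OF mX mY] G by (intro power_mono) (auto simp: W2r_def)
    assume "joint_mass G G' > 0"
    \<comment> \<open>A pair of positive mass is realized by some family, and one such family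
      suffices to compare the two means.\<close>
    then have "both G G' \<noteq> {}" by (auto simp: joint_mass_def)
    then have "(W2 (?m G) (?m G'))\<^sup>2 \<le> ennreal ((d2_vec N X Y)\<^sup>2)"
      using W2_means_le_of_both unfolding sum_matching_cost by blast
    then have "ennreal (k G G') \<le> ennreal ((d2_vec N X Y)\<^sup>2)"
      using W2_sq_eq[OF mX[OF G(1)] mY[OF G(2)]] by (simp only: k_def)
    then show "k G G' \<le> (d2_vec N X Y)\<^sup>2" by (simp only: ennreal_le_iff zero_le_power2)
  qed auto
  then obtain \<pi> where \<pi>': "\<forall>G\<in>GX. \<forall>G'\<in>GY. \<pi> G G' \<ge> 0" "\<forall>G\<in>GX. (\<Sum>G'\<in>GY. \<pi> G G') = grouping_prob N \<alpha> X G"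
     "\<forall>G'\<in>GY. (\<Sum>G\<in>GX. \<pi> G G') = grouping_prob N \<alpha> Y G'"
     "(\<Sum>G\<in>GX. \<Sum>G'\<in>GY. \<pi> G G' * k G G') \<le> (d2_vec N X Y)\<^sup>2 +
       (2 / \<alpha> * matched_dist + (d2_vec N X Y)\<^sup>2 / \<alpha>\<^sup>2) * (max_dist M (N * K))\<^sup>2" by (elim exE conjE)
  note \<pi> = \<pi>'(1)[rule_format] \<pi>'(2)[rule_format] \<pi>'(3)[rule_format] \<pi>'(4)
  have pfm_X: "pfm M N K \<alpha> X = fin_meas ?B GX (grouping_prob N \<alpha> X) ?m"
    unfolding GX_def by (rule pfm_eq_fin_meas[OF X.N]) (rule X.X)
  have pfm_Y: "pfm M N K \<alpha> Y = fin_meas ?B GY (grouping_prob N \<alpha> Y) ?m"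
    unfolding GY_def by (rule pfm_eq_fin_meas[OF Y.N]) (rule Y.X)
  have "wasserstein2 (pfm M N K \<alpha> X) (pfm M N K \<alpha> Y) \<le>
      esqrt (\<Sum>G\<in>GX. \<Sum>G'\<in>GY. ennreal (\<pi> G G') * (W2 (?m G) (?m G'))\<^sup>2)"
    unfolding pfm_X pfm_Y
    by (rule wasserstein2_fin_meas_le[OF finG _ _ \<pi>(1-3)]) (auto simp: sp mX mY)
  also have "(\<Sum>G\<in>GX. \<Sum>G'\<in>GY. ennreal (\<pi> G G') * (W2 (?m G) (?m G'))\<^sup>2) =
      (\<Sum>G\<in>GX. \<Sum>G'\<in>GY. ennreal (\<pi> G G' * k G G'))"
    by (intro sum.cong refl) (simp add: W2_sq_eq[OF mX mY] k_def \<pi>(1) ennreal_mult)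
  also have "\<dots> = ennreal (\<Sum>G\<in>GX. \<Sum>G'\<in>GY. \<pi> G G' * k G G')"
    using \<pi>(1) by (simp add: sum_ennreal sum_nonneg k_def)
  also have "esqrt \<dots> \<le> esqrt (ennreal ((d2_vec N X Y)\<^sup>2 +
     (2 / \<alpha> * matched_dist + (d2_vec N X Y)\<^sup>2 / \<alpha>\<^sup>2) * (max_dist M (N * K))\<^sup>2))"
    unfolding esqrt_le_iff esqrt_sq using \<pi>(4) by (rule ennreal_leI)
  finally show ?thesis .
qed

end

theorem theorem5p3:
  fixes N K :: nat and M \<alpha> C :: real
    and X Y :: "nat \<Rightarrow> diagram" and \<phi> :: "nat \<Rightarrow> dpoint \<Rightarrow> dpoint"
  assumes "N \<ge> 1" and "K \<ge> 1" and "M > 0" and "\<alpha> > 0"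
    and "\<And>i. i < N \<Longrightarrow> X i \<in> diagram_space M K"
    and "\<And>i. i < N \<Longrightarrow> Y i \<in> diagram_space M K"
    and "\<And>i. i < N \<Longrightarrow> optimal_matching (X i) (Y i) (\<phi> i)"
    and "C = sqrt (2 * (1 / (real N)\<^sup>2 + (max_dist M (N * K))\<^sup>2 / \<alpha>\<^sup>2)
                   + 4 * (max_dist M (N * K))\<^sup>2 / \<alpha> + 1)"
  shows "wasserstein2 (pfm M N K \<alpha> X) (pfm M N K \<alpha> Y) \<le>
    ennreal (C * sqrt ((\<Sum>i<N. \<Sum>x | x \<in> offpts (X i) \<and> fst (\<phi> i x) \<notin> diag.
                          norm (fst x - fst (\<phi> i x))) + (d2_vec N X Y)\<^sup>2))"
proof -
  interpret pfm_pair N K M \<alpha> X Y \<phi>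
    by unfold_locales (use assms in auto)
  let ?m2 = "(max_dist M (N * K))\<^sup>2" and ?d2 = "(d2_vec N X Y)\<^sup>2" and ?S = "matched_dist"
  have nn: "?S \<ge> 0" "?d2 \<ge> 0" "?m2 \<ge> 0" by (auto intro!: sum_nonneg)
  define c where "c = 2 * (1 / (real N)\<^sup>2 + ?m2 / \<alpha>\<^sup>2) + 4 * ?m2 / \<alpha> + 1"
  have C: "C = sqrt c" unfolding c_def by (rule assms(8))
  have c: "2 * ?m2 / \<alpha> \<le> c" "?m2 / \<alpha>\<^sup>2 + 1 \<le> c" "0 \<le> c"
  proof -
    have p: "0 \<le> 1 / (real N)\<^sup>2" "0 \<le> ?m2 / \<alpha>\<^sup>2" "0 \<le> ?m2 / \<alpha>" using assms(4) by auto
    have e: "2 * ?m2 / \<alpha> = 2 * (?m2 / \<alpha>)" "4 * ?m2 / \<alpha> = 4 * (?m2 / \<alpha>)" by simp_all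
    show "2 * ?m2 / \<alpha> \<le> c" "?m2 / \<alpha>\<^sup>2 + 1 \<le> c" "0 \<le> c" unfolding c_def e distrib_left using p by linarith+
  qed
  \<comment> \<open>Collecting the terms in \<open>?S\<close> and in \<open>?d2\<close> leaves two
    coefficients, each of which is at most \<open>c\<close>.\<close>
  have "?d2 + (2 / \<alpha> * ?S + ?d2 / \<alpha>\<^sup>2) * ?m2 = (2 * ?m2 / \<alpha>) * ?S + (?m2 / \<alpha>\<^sup>2 + 1) * ?d2"
    by (simp add: algebra_simps)
  also have "\<dots> \<le> c * ?S + c * ?d2" using c nn by (intro add_mono mult_right_mono) auto
  also have "\<dots> = (C * sqrt (?S + ?d2))\<^sup>2"
    using c(3) nn by (simp add: C power_mult_distrib distrib_left)
  finally have "ennreal (?d2 + (2 / \<alpha> * ?S + ?d2 / \<alpha>\<^sup>2) * ?m2) \<le> (ennreal (C * sqrt (?S + ?d2)))\<^sup>2"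
    using c(3) nn by (simp add: C ennreal_power ennreal_leI)
  then have "esqrt (ennreal (?d2 + (2 / \<alpha> * ?S + ?d2 / \<alpha>\<^sup>2) * ?m2)) \<le> ennreal (C * sqrt (?S + ?d2))"
    by (simp only: esqrt_le_iff)
  with wasserstein2_pfm_le show ?thesis by (rule order_trans)
qed

end
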